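(* Let $\beta\in[0,1)$ and, for $n\ge 1$, let $\mathrm{d}_n(t)$ be the worst-case total variation distance to stationarity at time $t$ of the continuous-time Glauber dynamics for the Curie-Weiss model on $n$ vertices with parameter $\beta$. For any $\theta\in\mathbb{R}$, let $t_{n,\theta}=\frac{1}{2(1-\beta)}\log n+\theta$. Then $$\lim_{n\to\infty}\mathrm{d}_n(t_{n,\theta})=\Psi(\theta):=\left\lVert N\left(e^{-(1-\beta)\theta+c(\beta)},\frac{1}{1-\beta}\right)-N\left(0,\frac{1}{1-\beta}\right)\right\rVert_{\mathrm{TV}},$$ where $$c(\beta):=-\int_0^1\frac{\frac{\beta t-\tanh(\beta t)}{t^2}}{1-\frac{\tanh(\beta t)}{t}}\,\mathrm{d}t$$ is a real constant depending only on $\beta$.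
   Context: The Curie-Weiss model on $n$ vertices with parameter $\beta$ is the Ising model on the complete graph $K_n$ at inverse temperature $\beta/n$, i.e. the probability measure $\pi_n$ on $\{-1,1\}^n$ with $\pi_n(\sigma)\propto\exp\left(\frac{\beta}{n}\sum_{1\le i<j\le n}\sigma(i)\sigma(j)\right)$. The continuous-time Glauber dynamics is the continuous-time Markov chain on $\{-1,1\}^n$ with transition rates $Q(\sigma,\tau)=\frac{\pi_n(\tau)}{\pi_n(\sigma)+\pi_n(\tau)}$ if $\sigma,\tau$ differ in exactly one coordinate, and $Q(\sigma,\tau)=0$ if they differ in at least two coordinates; its stationary distribution is $\pi_n$. Its heat kernel is $H_t^{(n)}(\sigma,\tau)=\mathbb{P}(X_t=\tau\mid X_0=\sigma)$, and $\mathrm{d}_n(t)=\sup_{\sigma}\lVert H^{(n)}_t(\sigma,\cdot)-\pi_n\rVert_{\mathrm{TV}}$ (for $t\ge0$; for fixed $\theta$, $t_{n,\theta}\ge 0$ for all large $n$). $\lVert\mu-\nu\rVert_{\mathrm{TV}}=\sup_A|\mu(A)-\nu(A)|$. $N(m,s)$ denotes the Gaussian law on $\mathbb{R}$ with mean $m$ and variance $s$. *)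

theory Defs
  imports "HOL-Probability.Probability"
begin

section \<open>Continuous-time Markov chains on a finite state space\<close>

text \<open>A chain on a finite set \<open>S\<close> is given by its transition rates \<open>q x y\<close> for \<open>x \<noteq> y\<close>;
  the values \<open>q x x\<close> are ignored.\<close>

definition generator :: "'s set \<Rightarrow> ('s \<Rightarrow> 's \<Rightarrow> real) \<Rightarrow> 's \<Rightarrow> 's \<Rightarrow> real" where
  "generator S q x y = (if x = y then - (\<Sum>z\<in>S - {x}. q x z) else q x y)"

fun matrix_pow :: "'s set \<Rightarrow> ('s \<Rightarrow> 's \<Rightarrow> real) \<Rightarrow> nat \<Rightarrow> 's \<Rightarrow> 's \<Rightarrow> real" where
  "matrix_pow S A 0 x y = (if x = y then 1 else 0)"
| "matrix_pow S A (Suc k) x y = (\<Sum>z\<in>S. A x z * matrix_pow S A k z y)"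

text \<open>The heat kernel is the matrix exponential of \<open>t\<close> times the generator. That this is the
  transition probability of the Markov chain with rates \<open>q\<close> is lemma \<open>cond_prob_eq_heat_kernel\<close>
  below.\<close>

definition heat_kernel :: "'s set \<Rightarrow> ('s \<Rightarrow> 's \<Rightarrow> real) \<Rightarrow> real \<Rightarrow> 's \<Rightarrow> 's \<Rightarrow> real" where
  "heat_kernel S q t x y = (\<Sum>k. matrix_pow S (generator S q) k x y / fact k * t ^ k)"

text \<open>A time-homogeneous Markov process with state space \<open>S\<close> and transition rates \<open>q\<close>. The Markov
  property is stated in product form, so that no conditioning on null events occurs.\<close>

definition markov_chain_with_rates ::
    "'s set \<Rightarrow> ('s \<Rightarrow> 's \<Rightarrow> real) \<Rightarrow> 'w measure \<Rightarrow> (real \<Rightarrow> 'w \<Rightarrow> 's) \<Rightarrow> bool" where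
  "markov_chain_with_rates S q M X \<longleftrightarrow>
     prob_space M \<and> finite S \<and> (\<forall>t\<ge>0. X t \<in> M \<rightarrow>\<^sub>M count_space S) \<and>
     (\<exists>P. (\<forall>h>0. \<forall>x\<in>S. (\<forall>y\<in>S. 0 \<le> P h x y) \<and> (\<Sum>y\<in>S. P h x y) = 1) \<and>
          (\<forall>x\<in>S. \<forall>y\<in>S. x \<noteq> y \<longrightarrow> ((\<lambda>h. P h x y / h) \<longlongrightarrow> q x y) (at_right 0)) \<and>
          (\<forall>(k::nat) s x h. \<forall>y\<in>S. 0 \<le> s 0 \<and> (\<forall>i<k. s i \<le> s (Suc i)) \<and> (\<forall>i\<le>k. x i \<in> S) \<and> h > 0 \<longrightarrow>
             \<P>(w in M. (\<forall>i\<le>k. X (s i) w = x i) \<and> X (s k + h) w = y) =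
             \<P>(w in M. \<forall>i\<le>k. X (s i) w = x i) * P h (x k) y))"

lemma matrix_pow_bound:
  assumes "finite S" "x \<in> S"
  shows "\<bar>matrix_pow S A k x y\<bar> \<le> (\<Sum>x\<in>S. \<Sum>z\<in>S. \<bar>A x z\<bar>) ^ k"
  using assms(2)
proof (induction k arbitrary: x)
  case 0
  then show ?case by simp
next
  case (Suc k)
  define B where "B = (\<Sum>x\<in>S. \<Sum>z\<in>S. \<bar>A x z\<bar>)"
  have B0: "B \<ge> 0" unfolding B_def by (intro sum_nonneg) auto
  have "\<bar>matrix_pow S A (Suc k) x y\<bar> \<le> (\<Sum>z\<in>S. \<bar>A x z * matrix_pow S A k z y\<bar>)"
    by (simp add: sum_abs)
  also have "\<dots> \<le> (\<Sum>z\<in>S. \<bar>A x z\<bar> * B ^ k)"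
    unfolding abs_mult using Suc.IH by (intro sum_mono mult_left_mono) (auto simp: B_def)
  also have "\<dots> = (\<Sum>z\<in>S. \<bar>A x z\<bar>) * B ^ k" by (simp add: sum_distrib_right)
  also have "\<dots> \<le> B * B ^ k"
    unfolding B_def using Suc.prems assms(1) B0
    by (intro mult_right_mono member_le_sum[where f = "\<lambda>x. \<Sum>z\<in>S. \<bar>A x z\<bar>"])
       (auto intro!: sum_nonneg simp: B_def)
  finally show ?case by (simp add: B_def)
qed

lemma heat_kernel_summable:
  assumes "finite S" "x \<in> S"
  shows "summable (\<lambda>k. matrix_pow S A k x y / fact k * t ^ k)"
proof (rule summable_comparison_test')
  define B where "B = (\<Sum>x\<in>S. \<Sum>z\<in>S. \<bar>A x z\<bar>)"
  show "summable (\<lambda>k. inverse (fact k) * (B * \<bar>t\<bar>) ^ k)" by (rule summable_exp)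
  show "norm (matrix_pow S A k x y / fact k * t ^ k) \<le> inverse (fact k) * (B * \<bar>t\<bar>) ^ k"
    if "k \<ge> 0" for k
    using mult_right_mono[OF matrix_pow_bound[OF assms, of A k y], of "\<bar>t\<bar> ^ k / fact k"]
    by (simp add: abs_mult power_abs B_def power_mult_distrib field_simps)
qed

lemma heat_kernel_0: "heat_kernel S q 0 x y = (if x = y then 1 else 0)"
  unfolding heat_kernel_def using powser_zero[of "\<lambda>k. matrix_pow S (generator S q) k x y / fact k"]
  by simp

lemma heat_kernel_deriv:
  assumes "finite S" "x \<in> S"
  shows "((\<lambda>t. heat_kernel S q t x y) has_real_derivative
            (\<Sum>z\<in>S. generator S q x z * heat_kernel S q t z y)) (at t)"
proof -
  let ?A = "generator S q"
  let ?c = "\<lambda>k. matrix_pow S ?A k x y / fact k"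
  have "((\<lambda>t. \<Sum>k. ?c k * t ^ k) has_real_derivative (\<Sum>k. diffs ?c k * t ^ k)) (at t)"
    by (rule termdiffs_strong_converges_everywhere) (rule heat_kernel_summable[OF assms])
  moreover have "diffs ?c k * t ^ k =
      (\<Sum>z\<in>S. ?A x z * (matrix_pow S ?A k z y / fact k * t ^ k))" for k
  proof -
    have "diffs ?c k = matrix_pow S ?A (Suc k) x y / fact k"
      unfolding diffs_def by (simp add: divide_simps del: matrix_pow.simps of_nat_Suc)
    then show ?thesis
      by (simp add: sum_distrib_right sum_divide_distrib mult.assoc)
  qed
  moreover have "(\<Sum>k. \<Sum>z\<in>S. ?A x z * (matrix_pow S ?A k z y / fact k * t ^ k)) =
      (\<Sum>z\<in>S. ?A x z * heat_kernel S q t z y)"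
  proof (subst suminf_sum)
    show "summable (\<lambda>k. ?A x z * (matrix_pow S ?A k z y / fact k * t ^ k))" if "z \<in> S" for z
      by (rule summable_mult) (rule heat_kernel_summable[OF assms(1) that])
    show "(\<Sum>z\<in>S. \<Sum>k. ?A x z * (matrix_pow S ?A k z y / fact k * t ^ k)) =
        (\<Sum>z\<in>S. ?A x z * heat_kernel S q t z y)"
      unfolding heat_kernel_def
      by (intro sum.cong refl suminf_mult heat_kernel_summable[OF assms(1)])
  qed
  ultimately show ?thesis unfolding heat_kernel_def by simp
qed

lemma cond_prob_eq_heat_kernel:
  assumes chain: "markov_chain_with_rates S q M X"
    and x: "x \<in> S" and y: "y \<in> S" and t: "t \<ge> 0"
    and pos: "\<P>(w in M. X 0 w = x) > 0"
  shows "\<P>(w in M. X t w = y \<bar> X 0 w = x) = heat_kernel S q t x y"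
proof -
  define G where "G = generator S q"
  define I where "I = (\<lambda>x y :: 'a. if x = y then 1 else 0 :: real)"
  from chain have "prob_space M" and fin: "finite S"
    and X: "\<And>t. t \<ge> 0 \<Longrightarrow> X t \<in> M \<rightarrow>\<^sub>M count_space S"
    unfolding markov_chain_with_rates_def by auto
  interpret prob_space M by fact
  from chain obtain P where
    P: "\<forall>h>0. \<forall>x\<in>S. (\<forall>y\<in>S. 0 \<le> P h x y) \<and> (\<Sum>y\<in>S. P h x y) = 1"
       "\<forall>x\<in>S. \<forall>y\<in>S. x \<noteq> y \<longrightarrow> ((\<lambda>h. P h x y / h) \<longlongrightarrow> q x y) (at_right 0)"
       "\<forall>(k::nat) s x h. \<forall>y\<in>S. 0 \<le> s 0 \<and> (\<forall>i<k. s i \<le> s (Suc i)) \<and> (\<forall>i\<le>k. x i \<in> S) \<and> h > 0 \<longrightarrow>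
             \<P>(w in M. (\<forall>i\<le>k. X (s i) w = x i) \<and> X (s k + h) w = y) =
             \<P>(w in M. \<forall>i\<le>k. X (s i) w = x i) * P h (x k) y"
    unfolding markov_chain_with_rates_def by (elim conjE exE) (rule that)
  have P1: "(\<Sum>y\<in>S. P h x y) = 1" if "h > 0" "x \<in> S" for h x
    using P(1) that by blast
  have Pq: "((\<lambda>h. P h x y / h) \<longlongrightarrow> q x y) (at_right 0)" if "x \<in> S" "y \<in> S" "x \<noteq> y" for x y
    using P(2) that by blast
  have Pm: "\<P>(w in M. (\<forall>i\<le>k. X (r i) w = u i) \<and> X (r k + h) w = v) =
            \<P>(w in M. \<forall>i\<le>k. X (r i) w = u i) * P h (u k) v"
    if "v \<in> S" "0 \<le> r 0" "\<And>i. i < k \<Longrightarrow> r i \<le> r (Suc i)" "\<And>i. i \<le> k \<Longrightarrow> u i \<in> S" "h > 0"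
    for k :: nat and r u h v
    using P(3) that by blast
  define D where "D = (\<lambda>h x y. (P h x y - I x y) / h)"
  have D: "((\<lambda>h. D h x y) \<longlongrightarrow> G x y) (at_right 0)" if "x \<in> S" "y \<in> S" for x y
  proof (cases "x = y")
    case False
    then show ?thesis using Pq[OF that] by (simp add: D_def I_def G_def generator_def)
  next
    case True
    have "((\<lambda>h. - (\<Sum>z\<in>S - {x}. P h x z / h)) \<longlongrightarrow> - (\<Sum>z\<in>S - {x}. q x z)) (at_right 0)"
      using Pq that by (intro tendsto_intros) auto
    moreover have "eventually (\<lambda>h. - (\<Sum>z\<in>S - {x}. P h x z / h) = D h x y) (at_right 0)"
      using eventually_at_right_less
    proof eventually_elim
      case (elim h)
      have "(\<Sum>z\<in>S - {x}. P h x z) = 1 - P h x x"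
        using P1[OF elim that(1)] fin that(1) by (simp add: sum_diff1)
      then show ?case using elim True
        by (simp add: D_def I_def sum_divide_distrib[symmetric] field_simps)
    qed
    ultimately show ?thesis using True
      by (auto simp: G_def generator_def elim: Lim_transform_eventually)
  qed
  have PI: "((\<lambda>h. P h x y - I x y) \<longlongrightarrow> 0) (at_right 0)" if "x \<in> S" "y \<in> S" for x y
  proof -
    have "((\<lambda>h. h * D h x y) \<longlongrightarrow> 0 * G x y) (at_right 0)"
      by (intro tendsto_mult D that tendsto_ident_at)
    moreover have "eventually (\<lambda>h. h * D h x y = P h x y - I x y) (at_right 0)"
      using eventually_at_right_less by eventually_elim (simp add: D_def)
    ultimately show ?thesis by (auto elim: Lim_transform_eventually)
  qed

  define f where "f = (\<lambda>s z. \<P>(w in M. X 0 w = x \<and> X s w = z))"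
  have ev: "{w \<in> space M. X s w = z} \<in> events" if s: "s \<ge> 0" for s z
  proof -
    have "{w \<in> space M. X s w = z} = X s -` ({z} \<inter> S) \<inter> space M"
      using measurable_space[OF X[OF s]] by auto
    then show ?thesis using measurable_sets[OF X[OF s], of "{z} \<inter> S"] by simp
  qed
  have step: "f (s + h) z = (\<Sum>v\<in>S. f s v * P h v z)" if s: "s \<ge> 0" "h > 0" and z: "z \<in> S" for s h z
  proof -
    have "f (s + h) z = (\<Sum>v\<in>S. \<P>(w in M. X 0 w = x \<and> X s w = v \<and> X (s + h) w = z))"
      unfolding f_def
    proof (rule prob_sum[OF fin])
      show "{w \<in> space M. X 0 w = x \<and> X s w = v \<and> X (s + h) w = z} \<in> events" for v
        using s by (intro sets.sets_Collect_conj ev) auto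
      show "{w \<in> space M. X 0 w = x \<and> X (s + h) w = z} \<in> events"
        using s by (intro sets.sets_Collect_conj ev) auto
      show "AE w in M. (\<forall>v\<in>S. X 0 w = x \<and> X s w = v \<and> X (s + h) w = z \<longrightarrow>
          X 0 w = x \<and> X (s + h) w = z) \<and>
          (X 0 w = x \<and> X (s + h) w = z \<longrightarrow> (\<exists>!v\<in>S. X 0 w = x \<and> X s w = v \<and> X (s + h) w = z))"
        using measurable_space[OF X[OF s(1)]] by (intro AE_I2) auto
    qed
    also have "\<dots> = (\<Sum>v\<in>S. f s v * P h v z)"
    proof (rule sum.cong[OF refl])
      fix v assume v: "v \<in> S"
      have "\<P>(w in M. (\<forall>i\<le>1::nat. X (if i = 0 then 0 else s) w = (if i = 0 then x else v)) \<and>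
               X ((if (1::nat) = 0 then 0 else s) + h) w = z) =
            \<P>(w in M. \<forall>i\<le>1::nat. X (if i = 0 then 0 else s) w = (if i = 0 then x else v)) *
              P h (if (1::nat) = 0 then x else v) z"
        by (rule Pm[of z "\<lambda>i. if i = 0 then 0 else s" 1 "\<lambda>i. if i = 0 then x else v" h])
           (use s z v x in auto)
      moreover have "(\<forall>i\<le>1::nat. X (if i = 0 then 0 else s) w = (if i = 0 then x else v)) \<longleftrightarrow>
          X 0 w = x \<and> X s w = v" for w
        by (auto simp: le_Suc_eq)
      ultimately show "\<P>(w in M. X 0 w = x \<and> X s w = v \<and> X (s + h) w = z) = f s v * P h v z"
        by (simp add: f_def conj_assoc)
    qed
    finally show ?thesis .
  qed
  have fI: "f s z = (\<Sum>v\<in>S. f s v * I v z)" if "z \<in> S" for s z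
    using fin that by (simp add: I_def if_distrib[of "(*) _"] sum.delta cong: if_cong)
  have step': "f (s + h) z - f s z = (\<Sum>v\<in>S. f s v * (P h v z - I v z))"
    if "s \<ge> 0" "h > 0" "z \<in> S" for s h z
    using step[OF that] fI[OF that(3), of s] by (simp add: algebra_simps sum_subtractf)
  have right: "((\<lambda>u. (f u z - f s z) / (u - s)) \<longlongrightarrow> (\<Sum>v\<in>S. f s v * G v z)) (at_right s)"
    if s: "s \<ge> 0" and z: "z \<in> S" for s z
  proof -
    have "((\<lambda>h. \<Sum>v\<in>S. f s v * D h v z) \<longlongrightarrow> (\<Sum>v\<in>S. f s v * G v z)) (at_right 0)"
      by (intro tendsto_intros D z)
    moreover have "eventually (\<lambda>h. (\<Sum>v\<in>S. f s v * D h v z) = (f (h + s) z - f s z) / (h + s - s))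
        (at_right 0)"
      using eventually_at_right_less
      by eventually_elim
         (simp add: step'[OF s _ z, unfolded add.commute[of s]] D_def sum_divide_distrib)
    ultimately show ?thesis
      unfolding filterlim_at_right_to_0[of _ _ s] by (rule Lim_transform_eventually)
  qed
  have left: "((\<lambda>u. (f u z - f s z) / (u - s)) \<longlongrightarrow> (\<Sum>v\<in>S. f s v * G v z)) (at_left s)"
    if s: "s > 0" and z: "z \<in> S" for s z
  proof -
    have small: "eventually (\<lambda>h. 0 < h \<and> h < s) (at_right (0::real))"
      using s eventually_at_right[of 0 s] by auto
    have cont: "((\<lambda>h. f (s - h) v) \<longlongrightarrow> f s v) (at_right 0)" if v: "v \<in> S" for v
    proof -
      have "((\<lambda>h. \<Sum>u\<in>S. \<bar>P h u v - I u v\<bar>) \<longlongrightarrow> (\<Sum>u\<in>S. 0)) (at_right 0)"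
        by (intro tendsto_sum tendsto_rabs_zero PI v)
      moreover have "eventually (\<lambda>h. norm (f (s - h) v - f s v) \<le> (\<Sum>u\<in>S. \<bar>P h u v - I u v\<bar>))
          (at_right 0)"
        using small
      proof eventually_elim
        case (elim h)
        have "\<bar>f s v - f (s - h) v\<bar> = \<bar>\<Sum>u\<in>S. f (s - h) u * (P h u v - I u v)\<bar>"
          using step'[of "s - h" h v] elim v by simp
        also have "\<dots> \<le> (\<Sum>u\<in>S. \<bar>f (s - h) u * (P h u v - I u v)\<bar>)" by (rule sum_abs)
        also have "\<dots> \<le> (\<Sum>u\<in>S. \<bar>P h u v - I u v\<bar>)"
          by (intro sum_mono) (auto simp: abs_mult f_def intro!: mult_left_le_one_le)
        finally show ?case by simp
      qed
      ultimately have "((\<lambda>h. f (s - h) v - f s v) \<longlongrightarrow> 0) (at_right 0)"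
        by (auto intro: Lim_null_comparison)
      then show ?thesis by (simp add: LIM_zero_iff)
    qed
    have "((\<lambda>h. \<Sum>v\<in>S. f (s - h) v * D h v z) \<longlongrightarrow> (\<Sum>v\<in>S. f s v * G v z)) (at_right 0)"
      by (intro tendsto_intros cont D z)
    moreover have "eventually (\<lambda>h. (\<Sum>v\<in>S. f (s - h) v * D h v z) =
        (f (s - h) z - f s z) / (s - h - s)) (at_right 0)"
      using small
    proof eventually_elim
      case (elim h)
      have "f s z - f (s - h) z = (\<Sum>v\<in>S. f (s - h) v * (P h v z - I v z))"
        using step'[of "s - h" h z] elim z by simp
      then show ?case using elim
        by (simp add: D_def sum_divide_distrib[symmetric] field_simps)
    qed
    ultimately have "((\<lambda>h. (f (s - h) z - f s z) / (s - h - s)) \<longlongrightarrow> (\<Sum>v\<in>S. f s v * G v z))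
        (at_right 0)"
      by (rule Lim_transform_eventually)
    then show ?thesis
      unfolding filterlim_at_left_to_right filterlim_at_right_to_0[of _ _ "- s"] by simp
  qed
  have df: "((\<lambda>s. f s z) has_real_derivative (\<Sum>v\<in>S. f s v * G v z)) (at s within {0..t})"
    if s: "s \<in> {0..t}" "t > 0" and z: "z \<in> S" for s z
  proof -
    consider "s = 0" | "s > 0" using s by fastforce
    then show ?thesis
    proof cases
      case 1
      then show ?thesis using right[of 0 z] z s
        by (simp add: has_field_derivative_iff at_within_Icc_at_right)
    next
      case 2
      have "((\<lambda>u. (f u z - f s z) / (u - s)) \<longlongrightarrow> (\<Sum>v\<in>S. f s v * G v z)) (at s)"
        using 2 z by (intro filterlim_split_at left right) auto
      then show ?thesis
        by (simp add: has_field_derivative_iff tendsto_within_subset[where S = UNIV])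
    qed
  qed

  define \<phi> where "\<phi> = (\<lambda>s. \<Sum>z\<in>S. f s z * heat_kernel S q (t - s) z y)"
  have "\<phi> t = \<phi> 0"
  proof (cases "t = 0")
    case False
    with t have t: "t > 0" by simp
    have "(\<phi> has_real_derivative 0) (at s within {0..t})" if s: "s \<in> {0..t}" for s
    proof -
      have H: "((\<lambda>s. heat_kernel S q (t - s) z y) has_real_derivative
            - (\<Sum>v\<in>S. G z v * heat_kernel S q (t - s) v y)) (at s within {0..t})"
        if "z \<in> S" for z
      proof -
        have "((\<lambda>s. heat_kernel S q (t - s) z y) has_real_derivative
            (\<Sum>v\<in>S. G z v * heat_kernel S q (t - s) v y) * (- 1)) (at s within {0..t})"
          unfolding G_def
          by (rule DERIV_chain2[where f = "\<lambda>r. heat_kernel S q r z y" and g = "\<lambda>s. t - s"])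
             (auto intro!: heat_kernel_deriv[OF fin that] derivative_eq_intros)
        then show ?thesis by simp
      qed
      have "(\<phi> has_real_derivative
          (\<Sum>z\<in>S. (\<Sum>v\<in>S. f s v * G v z) * heat_kernel S q (t - s) z y +
                  (- (\<Sum>v\<in>S. G z v * heat_kernel S q (t - s) v y)) * f s z)) (at s within {0..t})"
        unfolding \<phi>_def by (intro DERIV_sum DERIV_mult df H s t)
      moreover have "(\<Sum>z\<in>S. (\<Sum>v\<in>S. f s v * G v z) * heat_kernel S q (t - s) z y) =
          (\<Sum>z\<in>S. (\<Sum>v\<in>S. G z v * heat_kernel S q (t - s) v y) * f s z)"
        unfolding sum_distrib_right by (subst sum.swap) (simp add: mult_ac)
      ultimately show ?thesis by (simp add: sum_subtractf)
    qed
    then obtain c where "\<And>s. s \<in> {0..t} \<Longrightarrow> \<phi> s = c"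
      using has_field_derivative_zero_constant[of "{0..t}" \<phi>] by auto
    then show ?thesis using t by auto
  qed auto
  moreover have "\<phi> t = f t y"
    using fin y by (simp add: \<phi>_def heat_kernel_0 if_distrib[of "(*) _"] sum.delta cong: if_cong)
  moreover have "\<phi> 0 = \<P>(w in M. X 0 w = x) * heat_kernel S q t x y"
  proof -
    have "f 0 z = (if x = z then \<P>(w in M. X 0 w = x) else 0)" for z
    proof (cases "x = z")
      case False
      then have "{w \<in> space M. X 0 w = x \<and> X 0 w = z} = {}" by auto
      then show ?thesis using False unfolding f_def by (simp only: measure_empty if_False)
    qed (simp add: f_def)
    then show ?thesis
      using fin x by (simp add: \<phi>_def if_distrib[of "\<lambda>u. u * _"] sum.delta cong: if_cong)
  qed
  ultimately show ?thesis using pos by (simp add: cond_prob_def f_def conj_commute)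
qed

section \<open>Total variation distance\<close>

definition tv_dist :: "'a measure \<Rightarrow> 'a measure \<Rightarrow> real" where
  "tv_dist M N = (SUP A\<in>sets M. \<bar>measure M A - measure N A\<bar>)"

section \<open>Glauber dynamics for the Curie-Weiss model\<close>

definition spin_configs :: "nat \<Rightarrow> (nat \<Rightarrow> int) set" where
  "spin_configs n = {1..n} \<rightarrow>\<^sub>E {-1, 1}"

definition cw_weight :: "real \<Rightarrow> nat \<Rightarrow> (nat \<Rightarrow> int) \<Rightarrow> real" where
  "cw_weight \<beta> n \<sigma> = exp (\<beta> / real n * (\<Sum>i\<in>{1..n}. \<Sum>j\<in>{i<..n}. real_of_int (\<sigma> i * \<sigma> j)))"

definition cw_prob :: "real \<Rightarrow> nat \<Rightarrow> (nat \<Rightarrow> int) \<Rightarrow> real" where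
  "cw_prob \<beta> n \<sigma> = cw_weight \<beta> n \<sigma> / (\<Sum>\<tau>\<in>spin_configs n. cw_weight \<beta> n \<tau>)"

definition glauber_rate :: "real \<Rightarrow> nat \<Rightarrow> (nat \<Rightarrow> int) \<Rightarrow> (nat \<Rightarrow> int) \<Rightarrow> real" where
  "glauber_rate \<beta> n \<sigma> \<tau> =
     (if card {i\<in>{1..n}. \<sigma> i \<noteq> \<tau> i} = 1
      then cw_prob \<beta> n \<tau> / (cw_prob \<beta> n \<sigma> + cw_prob \<beta> n \<tau>) else 0)"

definition glauber_law :: "real \<Rightarrow> nat \<Rightarrow> real \<Rightarrow> (nat \<Rightarrow> int) \<Rightarrow> (nat \<Rightarrow> int) measure" where
  "glauber_law \<beta> n t \<sigma> =
     point_measure (spin_configs n) (\<lambda>\<tau>. ennreal (heat_kernel (spin_configs n) (glauber_rate \<beta> n) t \<sigma> \<tau>))"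

definition cw_measure :: "real \<Rightarrow> nat \<Rightarrow> (nat \<Rightarrow> int) measure" where
  "cw_measure \<beta> n = point_measure (spin_configs n) (\<lambda>\<sigma>. ennreal (cw_prob \<beta> n \<sigma>))"

text \<open>For \<open>t < 0\<close> the value is meaningless, since the heat kernel then need not be nonnegative.\<close>

definition glauber_dist :: "real \<Rightarrow> nat \<Rightarrow> real \<Rightarrow> real" where
  "glauber_dist \<beta> n t = (SUP \<sigma>\<in>spin_configs n. tv_dist (glauber_law \<beta> n t \<sigma>) (cw_measure \<beta> n))"

section \<open>The limit profile\<close>

text \<open>The second argument is the variance, whereas \<^const>\<open>normal_density\<close> takes the standard
  deviation.\<close>

definition gaussian :: "real \<Rightarrow> real \<Rightarrow> real measure" where
  "gaussian m s = density lborel (\<lambda>x. ennreal (normal_density m (sqrt s) x))"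

text \<open>At the single point \<open>t = 0\<close> the integrand is \<open>0\<close> by the convention \<open>a / 0 = 0\<close>.\<close>

definition c_integrand :: "real \<Rightarrow> real \<Rightarrow> real" where
  "c_integrand \<beta> t = ((\<beta> * t - tanh (\<beta> * t)) / t\<^sup>2) / (1 - tanh (\<beta> * t) / t)"

definition c_const :: "real \<Rightarrow> real" where
  "c_const \<beta> = - (LBINT t:{0..1}. c_integrand \<beta> t)"

definition limit_profile :: "real \<Rightarrow> real \<Rightarrow> real" where
  "limit_profile \<beta> \<theta> =
     tv_dist (gaussian (exp (- (1 - \<beta>) * \<theta> + c_const \<beta>)) (1 / (1 - \<beta>))) (gaussian 0 (1 / (1 - \<beta>)))"

end

theory Submission
  imports Defs
begin

text \<open>
  Write \<open>tilt h\<close> for the Curie-Weiss measure with an additional external field \<open>h\<close>. If \<open>h\<close> is of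
  order \<open>n\<^sup>-\<^sup>1\<^sup>/\<^sup>2\<close> and follows the linearized mean-field equation, then \<open>tilt h\<close> solves the forward
  equation of the dynamics up to an error of order \<open>n\<^sup>-\<^sup>1\<^sup>/\<^sup>2\<close> in total variation, because the logarithm of
  its density with respect to the stationary measure is linear in the spins.

  Start the dynamics at \<open>\<xi>\<close> and run it until a time \<open>K\<close> before the time of interest. The magnetizations of
  the two classes of sites, those with \<open>\<xi> i = 1\<close> and those with \<open>\<xi> i = -1\<close>, are then within
  \<open>O(\<surd>n)\<close>, uniformly in \<open>K\<close>, of the solution of the mean-field equations, and so are those of a
  suitable \<open>tilt h\<close>. A Bernstein-type gradient bound for the semigroup at time \<open>K\<close> shows that this
  remaining difference costs only \<open>O(K\<^sup>-\<^sup>1\<^sup>/\<^sup>2)\<close>. Hence the law of the dynamics is close to \<open>tilt h\<close>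
  with an explicit \<open>h\<close>, uniformly in \<open>\<xi>\<close>.

  The density of \<open>tilt h\<close> is an exponential of a linear statistic, which is asymptotically
  Gaussian. The distance of \<open>tilt h\<close> to stationarity therefore converges to an increasing function of the
  limiting variance of this statistic, which asymptotically is largest for the all-plus configuration.
\<close>

section \<open>Semigroups of finite Markov chains\<close>

text \<open>A tilted measure cannot follow the dynamics from time 0 on: the initial fields are of
  order 1, and the residual of the forward equation is small only for fields of order
  \<open>n^(-1/2)\<close>. When that order is reached, knowing the magnetizations up to
  \<open>O(sqrt n)\<close> says nothing about total variation, since this is the very scale on which
  the laws live. The last K units of time therefore serve two purposes: the semigroup forgets the
  discrepancy, and the tilted family meanwhile moves along with the dynamics, with an error that
  vanishes as n grows with K fixed. So K is chosen first and n afterwards; second moment constants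
  that grow with K could ruin the choice of K. Two magnetizations suffice because the law is
  invariant under exchanging sites of equal initial spin. The constant \<open>c(\<beta>)\<close> is
  what remains of the mean-field hitting time of small magnetizations once its logarithmic part is
  removed. The case \<open>\<beta> = 0\<close> is special: deviations of single sites then decay no
  faster than the mean, but the variance is the same for every start.\<close>

lemma gronwall_linear:
  fixes \<phi> :: "real \<Rightarrow> real"
  assumes a: "a \<noteq> 0" and T: "0 \<le> T"
    and der: "\<And>t. 0 \<le> t \<Longrightarrow> t \<le> T \<Longrightarrow> (\<phi> has_real_derivative \<phi>' t) (at t)"
    and le: "\<And>t. 0 \<le> t \<Longrightarrow> t \<le> T \<Longrightarrow> \<phi>' t \<le> - a * \<phi> t + b"
  shows "\<phi> T \<le> b / a + exp (- a * T) * (\<phi> 0 - b / a)"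
proof -
  define g where "g = (\<lambda>t. exp (a * t) * (\<phi> t - b / a))"
  have "g T \<le> g 0"
  proof (rule DERIV_nonpos_imp_nonincreasing[OF T])
    fix t assume t: "0 \<le> t" "t \<le> T"
    have "(g has_real_derivative exp (a * t) * (a * \<phi> t - b + \<phi>' t)) (at t)"
      unfolding g_def using a
      by (auto intro!: derivative_eq_intros der t simp: field_simps)
    moreover have "exp (a * t) * (a * \<phi> t - b + \<phi>' t) \<le> 0"
      using le[OF t] by (intro mult_nonneg_nonpos) auto
    ultimately show "\<exists>y. (g has_real_derivative y) (at t) \<and> y \<le> 0" by blast
  qed
  then have "exp (- a * T) * (exp (a * T) * (\<phi> T - b / a)) \<le> exp (- a * T) * (\<phi> 0 - b / a)"
    unfolding g_def by (intro mult_left_mono) auto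
  then show ?thesis by (simp add: mult.assoc[symmetric] exp_add[symmetric])
qed

text \<open>The positive part has a kink at 0 but its square has none, which makes an energy
  argument for the maximum principle possible.\<close>

lemma DERIV_pos_part_square:
  "((\<lambda>x::real. (max 0 x)\<^sup>2) has_real_derivative 2 * max 0 x) (at x)"
proof -
  consider "x > 0" | "x < 0" | "x = 0" by linarith
  then show ?thesis
  proof cases
    case 1
    have "((\<lambda>x::real. x\<^sup>2) has_real_derivative 2 * max 0 x) (at x)"
      using 1 by (auto intro!: derivative_eq_intros)
    then show ?thesis
      by (rule has_field_derivative_transform_within_open[where S = "{0<..}"]) (use 1 in auto)
  next
    case 2
    have "((\<lambda>x::real. 0) has_real_derivative 2 * max 0 x) (at x)"
      using 2 by auto
    then show ?thesis
      by (rule has_field_derivative_transform_within_open[where S = "{..<0}"]) (use 2 in auto)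
  next
    case 3
    have "((\<lambda>y. (max 0 y)\<^sup>2 / y) \<longlongrightarrow> 0) (at (0::real))"
    proof (rule Lim_null_comparison)
      show "eventually (\<lambda>y. norm ((max 0 y)\<^sup>2 / y) \<le> \<bar>y\<bar>) (at (0::real))"
        by (auto simp: eventually_at_filter max_def power2_eq_square)
      show "((\<lambda>y::real. \<bar>y\<bar>) \<longlongrightarrow> 0) (at 0)" by (intro tendsto_rabs_zero tendsto_ident_at)
    qed
    then show ?thesis using 3 by (simp add: has_field_derivative_iff)
  qed
qed

lemma generator_sum:
  assumes "finite S" "x \<in> S"
  shows "(\<Sum>y\<in>S. generator S q x y * f y) = (\<Sum>y\<in>S - {x}. q x y * (f y - f x))"
proof -
  have "(\<Sum>y\<in>S. generator S q x y * f y) =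
      generator S q x x * f x + (\<Sum>y\<in>S-{x}. generator S q x y * f y)"
    using assms by (simp add: sum.remove)
  also have "(\<Sum>y\<in>S-{x}. generator S q x y * f y) = (\<Sum>y\<in>S-{x}. q x y * f y)"
    by (intro sum.cong) (auto simp: generator_def)
  finally show ?thesis
    by (simp add: generator_def sum_distrib_right right_diff_distrib sum_subtractf)
qed

text \<open>The sum of the squared positive parts of \<open>w - c\<close> satisfies a linear differential inequality.\<close>

lemma max_principle:
  fixes w w' :: "real \<Rightarrow> 's \<Rightarrow> real"
  assumes fin: "finite S"
    and q: "\<And>x y. x \<in> S \<Longrightarrow> y \<in> S \<Longrightarrow> x \<noteq> y \<Longrightarrow> 0 \<le> q x y"
    and der: "\<And>t x. 0 \<le> t \<Longrightarrow> t \<le> T \<Longrightarrow> x \<in> S \<Longrightarrow> ((\<lambda>t. w t x) has_real_derivative w' t x) (at t)"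
    and le: "\<And>t x. 0 \<le> t \<Longrightarrow> t \<le> T \<Longrightarrow> x \<in> S \<Longrightarrow> w' t x \<le> (\<Sum>y\<in>S. generator S q x y * w t y)"
    and init: "\<And>x. x \<in> S \<Longrightarrow> w 0 x \<le> c"
    and T: "0 \<le> T" and x: "x \<in> S"
  shows "w T x \<le> c"
proof -
  define p where "p = (\<lambda>t x. max 0 (w t x - c))"
  define \<psi> where "\<psi> = (\<lambda>t. \<Sum>x\<in>S. (p t x)\<^sup>2)"
  define Q where "Q = (\<Sum>x\<in>S. \<Sum>y\<in>S - {x}. q x y)"
  have Q0: "Q \<ge> 0" unfolding Q_def using q by (auto intro!: sum_nonneg)
  have p0: "p t x \<ge> 0" for t x by (simp add: p_def)
  have pp: "p t x * p t y \<le> \<psi> t" if "x \<in> S" "y \<in> S" for t x y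
  proof -
    have "(p t x)\<^sup>2 \<le> \<psi> t" "(p t y)\<^sup>2 \<le> \<psi> t"
      unfolding \<psi>_def using that fin by (auto intro!: member_le_sum)
    moreover have "2 * (p t x * p t y) \<le> (p t x)\<^sup>2 + (p t y)\<^sup>2"
      using sum_squares_bound[of "p t x" "p t y"] by simp
    ultimately show ?thesis by linarith
  qed
  \<comment> \<open>Gronwall with \<open>b = 0\<close> and the negative rate
    \<open>- (2 * Q + 1)\<close>; the added 1 keeps it nonzero even if all jump rates
    vanish.\<close>
  have "\<psi> T \<le> 0 / (- (2 * Q + 1)) + exp (- (- (2 * Q + 1)) * T) * (\<psi> 0 - 0 / (- (2 * Q + 1)))"
  proof (rule gronwall_linear[OF _ T])
    fix t assume t: "0 \<le> t" "t \<le> T"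
    have "((\<lambda>t. (p t x)\<^sup>2) has_real_derivative 2 * p t x * w' t x) (at t)" if "x \<in> S" for x
      unfolding p_def
      by (rule DERIV_chain2[OF DERIV_pos_part_square])
         (auto intro!: derivative_eq_intros der[OF t that])
    then show "(\<psi> has_real_derivative (\<Sum>x\<in>S. 2 * p t x * w' t x)) (at t)"
      unfolding \<psi>_def by (intro DERIV_sum) auto
    have "(\<Sum>x\<in>S. 2 * p t x * w' t x) \<le> (\<Sum>x\<in>S. \<Sum>y\<in>S-{x}. 2 * (q x y * \<psi> t))"
    proof (rule sum_mono)
      fix x assume x: "x \<in> S"
      have "2 * p t x * w' t x \<le> 2 * p t x * (\<Sum>y\<in>S - {x}. q x y * (w t y - w t x))"
        using le[OF t x] p0[of t x] unfolding generator_sum[OF fin x] by (intro mult_left_mono) auto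
      also have "\<dots> = (\<Sum>y\<in>S - {x}. 2 * (q x y * (p t x * (w t y - w t x))))"
        by (simp add: sum_distrib_left algebra_simps)
      also have "\<dots> \<le> (\<Sum>y\<in>S-{x}. 2 * (q x y * \<psi> t))"
      proof (intro sum_mono mult_left_mono)
        fix y assume y: "y \<in> S - {x}"
        \<comment> \<open>Either \<open>p t x = 0\<close>, or \<open>w t x > c\<close> and then
          \<open>w t y - w t x\<close> lies below \<open>w t y - c\<close>.\<close>
        have "p t x * (w t y - w t x) \<le> p t x * p t y"
        proof (cases "w t x \<le> c")
          case False
          then show ?thesis using p0[of t x] by (intro mult_left_mono) (auto simp: p_def)
        qed (simp add: p_def)
        also have "\<dots> \<le> \<psi> t" using pp x y by auto
        finally show "p t x * (w t y - w t x) \<le> \<psi> t" .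
      qed (use q x in auto)
      finally show "2 * p t x * w' t x \<le> (\<Sum>y\<in>S-{x}. 2 * (q x y * \<psi> t))" .
    qed
    also have "\<dots> = 2 * Q * \<psi> t"
      by (simp add: Q_def sum_distrib_left sum_distrib_right mult_ac)
    also have "\<dots> \<le> (2 * Q + 1) * \<psi> t"
      unfolding \<psi>_def by (intro mult_right_mono sum_nonneg) auto
    finally show "(\<Sum>x\<in>S. 2 * p t x * w' t x) \<le> - (- (2 * Q + 1)) * \<psi> t + 0" by (simp add: add.commute)
  qed (use Q0 in auto)
  moreover have "p 0 x = 0" if "x \<in> S" for x using init[OF that] by (simp add: p_def)
  then have "\<psi> 0 = 0" by (simp add: \<psi>_def)
  ultimately have "\<psi> T \<le> 0" by simp
  then have "p T x * p T x \<le> 0" using pp[OF x x, of T] by linarith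
  then have "p T x = 0" using p0[of T x] by (simp add: mult_le_0_iff)
  then show ?thesis by (simp add: p_def max_def split: if_splits)
qed

text \<open>The difference of two solutions is a solution with initial value 0; the maximum
  principle bounds it and its negative by 0.\<close>

lemma backward_equation_unique:
  fixes u v :: "real \<Rightarrow> 's \<Rightarrow> real"
  assumes fin: "finite S"
    and q: "\<And>x y. x \<in> S \<Longrightarrow> y \<in> S \<Longrightarrow> x \<noteq> y \<Longrightarrow> 0 \<le> q x y"
    and u: "\<And>t x. x \<in> S \<Longrightarrow> ((\<lambda>t. u t x) has_real_derivative (\<Sum>y\<in>S. generator S q x y * u t y)) (at t)"
    and v: "\<And>t x. x \<in> S \<Longrightarrow> ((\<lambda>t. v t x) has_real_derivative (\<Sum>y\<in>S. generator S q x y * v t y)) (at t)"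
    and init: "\<And>x. x \<in> S \<Longrightarrow> u 0 x = v 0 x"
    and T: "0 \<le> T" and x: "x \<in> S"
  shows "u T x = v T x"
proof -
  have "a T x - b T x \<le> 0"
    if a: "\<And>t x. x \<in> S \<Longrightarrow> ((\<lambda>t. a t x) has_real_derivative (\<Sum>y\<in>S. generator S q x y * a t y)) (at t)"
      and b: "\<And>t x. x \<in> S \<Longrightarrow> ((\<lambda>t. b t x) has_real_derivative (\<Sum>y\<in>S. generator S q x y * b t y)) (at t)"
      and i: "\<And>x. x \<in> S \<Longrightarrow> a 0 x = b 0 x" for a b :: "real \<Rightarrow> 's \<Rightarrow> real"
    by (rule max_principle[where w = "\<lambda>t x. a t x - b t x", OF fin q _ _ _ T x])
       (auto intro!: DERIV_diff a b simp: i sum_subtractf right_diff_distrib)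
  from this[of u v] this[of v u] show ?thesis using u v init by fastforce
qed

locale finite_chain =
  fixes S :: "'s set" and q :: "'s \<Rightarrow> 's \<Rightarrow> real"
  assumes fin: "finite S"
    and q_nonneg: "\<And>x y. x \<in> S \<Longrightarrow> y \<in> S \<Longrightarrow> x \<noteq> y \<Longrightarrow> 0 \<le> q x y"
begin

abbreviation "G \<equiv> generator S q"
abbreviation "H \<equiv> heat_kernel S q"

definition sg :: "real \<Rightarrow> ('s \<Rightarrow> real) \<Rightarrow> 's \<Rightarrow> real" where
  "sg t f x = (\<Sum>y\<in>S. H t x y * f y)"

lemma sg_deriv:
  assumes "x \<in> S"
  shows "((\<lambda>t. sg t f x) has_real_derivative (\<Sum>z\<in>S. G x z * sg t f z)) (at t)"
proof -
  have "((\<lambda>t. sg t f x) has_real_derivative (\<Sum>y\<in>S. (\<Sum>z\<in>S. G x z * H t z y) * f y)) (at t)"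
    unfolding sg_def by (auto intro!: derivative_eq_intros heat_kernel_deriv fin assms)
  also have "(\<Sum>y\<in>S. (\<Sum>z\<in>S. G x z * H t z y) * f y) = (\<Sum>z\<in>S. G x z * sg t f z)"
    unfolding sg_def sum_distrib_left sum_distrib_right by (subst sum.swap) (simp add: mult_ac)
  finally show ?thesis .
qed

lemma sg_0: "x \<in> S \<Longrightarrow> sg 0 f x = f x"
  using fin by (simp add: sg_def heat_kernel_0 if_distrib[of "\<lambda>u. u * _"] cong: if_cong)

text \<open>The main tool for the kernel: total mass, semigroup property, commutation with the
  generator and symmetry under swaps are all proved by checking that the other side solves the
  backward equation with the same initial value.\<close>

lemma sg_unique:
  assumes "\<And>t x. x \<in> S \<Longrightarrow> ((\<lambda>t. u t x) has_real_derivative (\<Sum>y\<in>S. G x y * u t y)) (at t)"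
    and "\<And>x. x \<in> S \<Longrightarrow> u 0 x = f x" "0 \<le> t" "x \<in> S"
  shows "u t x = sg t f x"
  by (rule backward_equation_unique[where u = u and v = "\<lambda>t. sg t f", OF fin q_nonneg assms(1) sg_deriv _ assms(3,4)])
     (auto simp: sg_0 assms(2))

lemma H_nonneg:
  assumes "0 \<le> t" "x \<in> S" "y \<in> S"
  shows "0 \<le> H t x y"
proof -
  have "- H t x y \<le> 0"
    by (rule max_principle[where w = "\<lambda>t x. - H t x y", OF fin q_nonneg _ _ _ assms(1,2)])
       (auto intro!: derivative_eq_intros heat_kernel_deriv fin simp: sum_negf heat_kernel_0)
  then show ?thesis by simp
qed

lemma H_sum:
  assumes "0 \<le> t" "x \<in> S"
  shows "(\<Sum>y\<in>S. H t x y) = 1"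
proof -
  have "1 = sg t (\<lambda>_. 1) x"
    by (rule sg_unique[where u = "\<lambda>_ _. 1", OF _ _ assms])
       (auto simp: generator_sum[OF fin, of _ q "\<lambda>_. 1", simplified])
  then show ?thesis by (simp add: sg_def)
qed

lemma H_semigroup:
  assumes "0 \<le> t" "x \<in> S"
  shows "H (t + s) x y = (\<Sum>z\<in>S. H t x z * H s z y)"
proof -
  have "H (t + s) x y = sg t (\<lambda>z. H s z y) x"
  proof (rule sg_unique[where u = "\<lambda>t x. H (t + s) x y", OF _ _ assms])
    show "((\<lambda>t. H (t + s) x y) has_real_derivative (\<Sum>z\<in>S. G x z * H (t + s) z y)) (at t)"
      if "x \<in> S" for x t
    proof -
      have "((\<lambda>t. H (t + s) x y) has_real_derivative (\<Sum>z\<in>S. G x z * H (t + s) z y) * 1) (at t)"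
        by (rule DERIV_chain2[OF heat_kernel_deriv[OF fin that]]) (auto intro!: derivative_eq_intros)
      then show ?thesis by simp
    qed
  qed auto
  then show ?thesis by (simp add: sg_def)
qed

text \<open>Both sides solve the backward equation in \<open>x\<close> with initial value
  \<open>G x y\<close>. The definition of the kernel gives the backward equation directly; this
  lemma turns it into the forward equation.\<close>

lemma H_commute:
  assumes "0 \<le> t" "x \<in> S" "y \<in> S"
  shows "(\<Sum>z\<in>S. H t x z * G z y) = (\<Sum>z\<in>S. G x z * H t z y)"
proof -
  have "(\<Sum>z\<in>S. G x z * H t z y) = sg t (\<lambda>z. G z y) x"
  proof (rule sg_unique[where u = "\<lambda>t x. \<Sum>z\<in>S. G x z * H t z y", OF _ _ assms(1,2)])
    show "((\<lambda>t. \<Sum>z\<in>S. G x z * H t z y) has_real_derivative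
        (\<Sum>y'\<in>S. G x y' * (\<Sum>z\<in>S. G y' z * H t z y))) (at t)" for x t
      by (auto intro!: derivative_eq_intros heat_kernel_deriv fin simp: mult.commute)
    show "(\<Sum>z\<in>S. G x z * H 0 z y) = G x y" if "x \<in> S" for x
      using that fin assms(3)
      by (simp add: sg_0 heat_kernel_0 if_distrib[of "\<lambda>u. _ * u"] cong: if_cong)
  qed
  then show ?thesis by (simp add: sg_def)
qed

text \<open>Dynkin's formula for a time-dependent observable; below, the observable is a squared
  deviation from a moving centre.\<close>

lemma sg_forward_deriv:
  assumes t: "0 \<le> t" and x: "x \<in> S"
    and der: "\<And>z. z \<in> S \<Longrightarrow> ((\<lambda>t. F t z) has_real_derivative F' z) (at t)"
  shows "((\<lambda>t. sg t (F t) x) has_real_derivative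
      sg t (\<lambda>z. F' z + (\<Sum>y\<in>S. G z y * F t y)) x) (at t)"
proof -
  have "((\<lambda>t. sg t (F t) x) has_real_derivative
      (\<Sum>y\<in>S. (\<Sum>z\<in>S. G x z * H t z y) * F t y + F' y * H t x y)) (at t)"
    unfolding sg_def by (auto intro!: DERIV_sum DERIV_mult heat_kernel_deriv fin x der)
  also have "(\<Sum>y\<in>S. (\<Sum>z\<in>S. G x z * H t z y) * F t y + F' y * H t x y) =
      (\<Sum>y\<in>S. (\<Sum>z\<in>S. H t x z * G z y) * F t y + F' y * H t x y)"
    by (intro sum.cong refl) (simp add: H_commute t x)
  also have "\<dots> = sg t (\<lambda>z. F' z + (\<Sum>y\<in>S. G z y * F t y)) x"
    unfolding sg_def sum.distrib distrib_left sum_distrib_left sum_distrib_right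
    by (subst sum.swap) (simp add: mult_ac add.commute)
  finally show ?thesis .
qed

lemma sg_mono:
  assumes "0 \<le> t" "x \<in> S" "\<And>z. z \<in> S \<Longrightarrow> f z \<le> g z"
  shows "sg t f x \<le> sg t g x"
  unfolding sg_def using assms by (intro sum_mono mult_left_mono H_nonneg) auto

lemma sg_const: "0 \<le> t \<Longrightarrow> x \<in> S \<Longrightarrow> sg t (\<lambda>_. c) x = c"
  by (simp add: sg_def sum_distrib_right[symmetric] H_sum)

lemma sg_abs_le:
  assumes "0 \<le> t" "x \<in> S" "\<And>z. z \<in> S \<Longrightarrow> \<bar>f z\<bar> \<le> c"
  shows "\<bar>sg t f x\<bar> \<le> c"
proof -
  have "sg t f x \<le> sg t (\<lambda>_. c) x" "sg t (\<lambda>_. - c) x \<le> sg t f x"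
    using assms by (intro sg_mono; fastforce simp: abs_le_iff)+
  then show ?thesis using assms by (simp add: sg_const)
qed

end

section \<open>Flips, fields and tilted Curie-Weiss measures\<close>

text \<open>Since spins have square 1, this makes the interaction energy a function of the total
  magnetization.\<close>

lemma square_sum_pairs:
  fixes a :: "nat \<Rightarrow> real"
  shows "(\<Sum>i\<in>{1..n}. a i)\<^sup>2 = (\<Sum>i\<in>{1..n}. (a i)\<^sup>2) + 2 * (\<Sum>i\<in>{1..n}. \<Sum>j\<in>{i<..n}. a i * a j)"
proof (induction n)
  case (Suc n)
  have "(\<Sum>i\<in>{1..Suc n}. \<Sum>j\<in>{i<..Suc n}. a i * a j) = (\<Sum>i\<in>{1..n}. \<Sum>j\<in>{i<..Suc n}. a i * a j)"
    by simp
  also have "\<dots> = (\<Sum>i\<in>{1..n}. (\<Sum>j\<in>{i<..n}. a i * a j) + a i * a (Suc n))"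
  proof (intro sum.cong refl)
    fix i assume "i \<in> {1..n}"
    then have "{i<..Suc n} = insert (Suc n) {i<..n}" by auto
    then show "(\<Sum>j\<in>{i<..Suc n}. a i * a j) = (\<Sum>j\<in>{i<..n}. a i * a j) + a i * a (Suc n)"
      by simp
  qed
  also have "\<dots> = (\<Sum>i\<in>{1..n}. \<Sum>j\<in>{i<..n}. a i * a j) + (\<Sum>i\<in>{1..n}. a i) * a (Suc n)"
    by (simp add: sum.distrib sum_distrib_right)
  finally show ?case using Suc.IH by (simp add: power2_eq_square algebra_simps)
qed simp

definition flip :: "nat \<Rightarrow> (nat \<Rightarrow> int) \<Rightarrow> nat \<Rightarrow> int" where
  "flip i \<sigma> = \<sigma>(i := - \<sigma> i)"

definition mag :: "nat set \<Rightarrow> (nat \<Rightarrow> int) \<Rightarrow> real" where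
  "mag C \<sigma> = (\<Sum>i\<in>C. real_of_int (\<sigma> i))"

lemma flip_flip [simp]: "flip i (flip i \<sigma>) = \<sigma>"
  by (simp add: flip_def)

lemma flip_commute: "flip i (flip j \<sigma>) = flip j (flip i \<sigma>)"
  by (auto simp: flip_def fun_eq_iff)

lemma flip_same [simp]: "flip i \<sigma> i = - \<sigma> i" and flip_other [simp]: "j \<noteq> i \<Longrightarrow> flip i \<sigma> j = \<sigma> j"
  by (auto simp: flip_def)

lemma mag_flip: "finite C \<Longrightarrow> i \<in> C \<Longrightarrow> mag C (flip i \<sigma>) = mag C \<sigma> - 2 * real_of_int (\<sigma> i)"
  and mag_flip_outside: "i \<notin> C \<Longrightarrow> mag C (flip i \<sigma>) = mag C \<sigma>"
proof -
  assume "finite C" "i \<in> C"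
  then show "mag C (flip i \<sigma>) = mag C \<sigma> - 2 * real_of_int (\<sigma> i)"
    by (simp add: mag_def sum.remove[of C i] flip_def)
next
  assume "i \<notin> C"
  then show "mag C (flip i \<sigma>) = mag C \<sigma>"
    unfolding mag_def flip_def by (intro sum.cong) auto
qed

lemma finite_spin_configs [simp]: "finite (spin_configs n)"
  by (simp add: spin_configs_def finite_PiE)

section \<open>Lipschitz and linearization bounds for the hyperbolic tangent\<close>

lemma abs_tanh_less_1: "\<bar>tanh (x::real)\<bar> < 1"
  using tanh_real_lt_1[of x] tanh_real_gt_neg1[of x] by linarith

lemma tanh_diff_le: "\<bar>tanh x - tanh y\<bar> \<le> \<bar>x - (y::real)\<bar>"
proof -
  have *: "\<bar>tanh x - tanh y\<bar> \<le> \<bar>x - y\<bar>" if "y < x" for x y :: real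
  proof -
    have "(tanh has_real_derivative 1 - (tanh z)\<^sup>2) (at z)" for z :: real
      by (auto intro!: derivative_eq_intros)
    from MVT2[OF that, of tanh "\<lambda>z. 1 - (tanh z)\<^sup>2", OF this] obtain z where
      z: "tanh x - tanh y = (x - y) * (1 - (tanh z)\<^sup>2)" by auto
    have "(tanh z)\<^sup>2 \<le> 1" using abs_tanh_less_1[of z] by (simp add: abs_square_le_1)
    then have "\<bar>1 - (tanh z)\<^sup>2\<bar> \<le> 1" by simp
    then show ?thesis unfolding z abs_mult using mult_left_le by fastforce
  qed
  show ?thesis using *[of x y] *[of y x] by (cases x y rule: linorder_cases) auto
qed

lemma tanh_abs_le: "\<bar>tanh x\<bar> \<le> \<bar>x::real\<bar>"
  using tanh_diff_le[of x 0] by simp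

text \<open>The derivative of \<open>x - tanh x\<close> is the square of \<open>tanh\<close>, of
  which one factor is bounded by the argument and the other by 1. At fields of order
  \<open>n^(-1/2)\<close> the error is \<open>O(1/n)\<close> per site, which is enough after
  summation over n sites.\<close>

lemma tanh_approx: "\<bar>tanh x - x\<bar> \<le> (x::real)\<^sup>2"
proof -
  have "\<bar>tanh x - x\<bar> \<le> x\<^sup>2" if "0 < x" for x :: real
  proof -
    have "((\<lambda>x. x - tanh x) has_real_derivative (tanh z)\<^sup>2) (at z)" for z :: real
      by (auto intro!: derivative_eq_intros)
    from MVT2[OF that, of "\<lambda>x. x - tanh x" "\<lambda>z. (tanh z)\<^sup>2", OF this] obtain z where
      z: "0 < z" "z < x" "x - tanh x = x * (tanh z)\<^sup>2" by auto
    have "\<bar>tanh z\<bar> * \<bar>tanh z\<bar> \<le> x * 1"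
      using tanh_abs_le[of z] abs_tanh_less_1[of z] z by (intro mult_mono) auto
    then have "x * (tanh z)\<^sup>2 \<le> x * x" using that
      by (intro mult_left_mono) (auto simp: power2_eq_square)
    moreover have "x * (tanh z)\<^sup>2 \<ge> 0" using that by simp
    ultimately show ?thesis unfolding power2_eq_square[of x] using z(3) by linarith
  qed
  from this[of x] this[of "-x"] show ?thesis by (cases x "0::real" rule: linorder_cases) auto
qed

locale curie_weiss =
  fixes \<beta> :: real and n :: nat
  assumes beta_nonneg: "0 \<le> \<beta>" and beta_less: "\<beta> < 1" and n_pos: "0 < n"
begin

abbreviation "\<Omega> \<equiv> spin_configs n"
definition I :: "nat set" where "I = {1..n}"

lemma finite_I [simp]: "finite I" and card_I [simp]: "card I = n"
  by (auto simp: I_def)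

lemma spin_cases:
  assumes "\<sigma> \<in> \<Omega>" "i \<in> I"
  obtains "\<sigma> i = 1" | "\<sigma> i = -1"
  using PiE_mem[OF assms(1)[unfolded spin_configs_def] assms(2)[unfolded I_def]] that by blast

lemma spin_sq: "\<sigma> \<in> \<Omega> \<Longrightarrow> i \<in> I \<Longrightarrow> (real_of_int (\<sigma> i))\<^sup>2 = 1"
  by (erule (1) spin_cases) auto

lemma spin_abs: "\<sigma> \<in> \<Omega> \<Longrightarrow> i \<in> I \<Longrightarrow> \<bar>real_of_int (\<sigma> i)\<bar> = 1"
  by (erule (1) spin_cases) auto

lemma flip_in: "\<sigma> \<in> \<Omega> \<Longrightarrow> i \<in> I \<Longrightarrow> flip i \<sigma> \<in> \<Omega>"
  unfolding spin_configs_def I_def by (auto simp: flip_def PiE_iff extensional_def)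

lemma flip_neq: "\<sigma> \<in> \<Omega> \<Longrightarrow> i \<in> I \<Longrightarrow> flip i \<sigma> \<noteq> \<sigma>"
  by (erule (1) spin_cases) (auto simp: flip_def fun_eq_iff)

lemma mag_abs_le: "\<sigma> \<in> \<Omega> \<Longrightarrow> C \<subseteq> I \<Longrightarrow> \<bar>mag C \<sigma>\<bar> \<le> real (card C)"
  unfolding mag_def
  by (rule order_trans[OF sum_abs]) (simp add: spin_abs subset_iff)

lemma sum_flip_involution:
  assumes i: "i \<in> I"
  shows "(\<Sum>\<sigma>\<in>\<Omega>. F (flip i \<sigma>)) = (\<Sum>\<sigma>\<in>\<Omega>. F \<sigma>)"
  by (rule sum.reindex_bij_witness[where i = "flip i" and j = "flip i"]) (simp_all add: flip_in i)


definition fld :: "nat \<Rightarrow> (nat \<Rightarrow> int) \<Rightarrow> real" where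
  "fld i \<sigma> = \<beta> / real n * (mag I \<sigma> - real_of_int (\<sigma> i))"

text \<open>The heat-bath rate of flipping site \<open>i\<close> in closed form;
  \<open>rate_flip\<close> identifies it with \<open>glauber_rate\<close>.\<close>

definition rt :: "nat \<Rightarrow> (nat \<Rightarrow> int) \<Rightarrow> real" where
  "rt i \<sigma> = (1 - real_of_int (\<sigma> i) * tanh (fld i \<sigma>)) / 2"

text \<open>The full square of the magnetization replaces the sum over pairs. Its n diagonal terms
  equal 1, so for \<open>h = 0\<close> this differs from \<open>cw_weight\<close> by a constant
  factor, which cancels in \<open>tilt\<close>.\<close>

definition wt :: "(nat \<Rightarrow> real) \<Rightarrow> (nat \<Rightarrow> int) \<Rightarrow> real" where
  "wt h \<sigma> = exp (\<beta> / (2 * real n) * (mag I \<sigma>)\<^sup>2 + (\<Sum>i\<in>I. h i * real_of_int (\<sigma> i)))"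

definition pf :: "(nat \<Rightarrow> real) \<Rightarrow> real" where "pf h = (\<Sum>\<sigma>\<in>\<Omega>. wt h \<sigma>)"

definition tilt :: "(nat \<Rightarrow> real) \<Rightarrow> (nat \<Rightarrow> int) \<Rightarrow> real" where "tilt h \<sigma> = wt h \<sigma> / pf h"

lemma fld_flip_same [simp]: "i \<in> I \<Longrightarrow> fld i (flip i \<sigma>) = fld i \<sigma>"
  by (simp add: fld_def mag_flip)

lemma fld_flip_other:
  "j \<in> I \<Longrightarrow> i \<noteq> j \<Longrightarrow> fld i (flip j \<sigma>) = fld i \<sigma> - 2 * \<beta> / real n * real_of_int (\<sigma> j)"
  by (simp add: fld_def mag_flip algebra_simps)

lemma fld_bound: "\<sigma> \<in> \<Omega> \<Longrightarrow> i \<in> I \<Longrightarrow> \<bar>fld i \<sigma> - \<beta> * mag I \<sigma> / real n\<bar> \<le> \<beta> / real n"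
  using spin_abs[of \<sigma> i] beta_nonneg n_pos
  by (simp add: fld_def right_diff_distrib abs_mult)

lemma fld_abs_le:
  assumes "\<sigma> \<in> \<Omega>" "i \<in> I" shows "\<bar>fld i \<sigma>\<bar> \<le> \<beta>"
proof -
  have "mag I \<sigma> - real_of_int (\<sigma> i) = mag (I - {i}) \<sigma>"
    using assms by (simp add: mag_def sum_diff1)
  then have "\<bar>mag I \<sigma> - real_of_int (\<sigma> i)\<bar> \<le> real n"
    using mag_abs_le[OF assms(1), of "I - {i}"] assms(2) by auto
  then have "\<beta> / real n * \<bar>mag I \<sigma> - real_of_int (\<sigma> i)\<bar> \<le> \<beta> / real n * real n"
    using beta_nonneg by (intro mult_left_mono) auto
  then show ?thesis using beta_nonneg n_pos by (simp add: fld_def abs_mult)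
qed

lemma rt_flip_same: "i \<in> I \<Longrightarrow> rt i (flip i \<sigma>) = 1 - rt i \<sigma>"
  by (simp add: rt_def field_simps)

lemma rt_bounds:
  assumes "\<sigma> \<in> \<Omega>" "i \<in> I" shows "(1 - tanh \<beta>) / 2 \<le> rt i \<sigma>" "rt i \<sigma> \<le> 1"
proof -
  have "\<bar>tanh (fld i \<sigma>)\<bar> \<le> tanh \<beta>"
    using fld_abs_le[OF assms] by (metis tanh_real_abs tanh_real_le_iff)
  moreover have "\<bar>real_of_int (\<sigma> i) * tanh (fld i \<sigma>)\<bar> = \<bar>tanh (fld i \<sigma>)\<bar>"
    using spin_abs[OF assms] by (simp add: abs_mult)
  ultimately have b: "\<bar>real_of_int (\<sigma> i) * tanh (fld i \<sigma>)\<bar> \<le> tanh \<beta>" by simp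
  show "(1 - tanh \<beta>) / 2 \<le> rt i \<sigma>" using abs_le_D1[OF b] unfolding rt_def by simp
  show "rt i \<sigma> \<le> 1" using abs_le_D2[OF b] tanh_real_lt_1[of \<beta>] unfolding rt_def by simp
qed

lemma rt_nonneg:
  assumes "\<sigma> \<in> \<Omega>" "i \<in> I" shows "0 \<le> rt i \<sigma>"
  using rt_bounds(1)[OF assms] tanh_real_lt_1[of \<beta>] by (auto intro: order_trans[rotated])

lemma rt_flip_other:
  assumes "\<sigma> \<in> \<Omega>" "i \<in> I" "j \<in> I" "i \<noteq> j"
  shows "\<bar>rt j (flip i \<sigma>) - rt j \<sigma>\<bar> \<le> \<beta> / real n"
proof -
  have "\<bar>rt j (flip i \<sigma>) - rt j \<sigma>\<bar> = \<bar>real_of_int (\<sigma> j)\<bar> * \<bar>tanh (fld j (flip i \<sigma>)) - tanh (fld j \<sigma>)\<bar> / 2"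
    using assms(4) by (simp add: rt_def abs_mult[symmetric] algebra_simps diff_divide_distrib[symmetric] abs_minus_commute)
  also have "\<dots> \<le> \<bar>fld j (flip i \<sigma>) - fld j \<sigma>\<bar> / 2"
    using tanh_diff_le[of "fld j (flip i \<sigma>)" "fld j \<sigma>"] spin_abs[OF assms(1,3)] by simp
  also have "\<dots> = \<beta> / real n"
    using fld_flip_other[of i j \<sigma>] assms spin_abs[OF assms(1,2)] beta_nonneg by (simp add: abs_mult)
  finally show ?thesis .
qed

lemma wt_pos: "0 < wt h \<sigma>" by (simp add: wt_def)

lemma spin_configs_nonempty: "\<Omega> \<noteq> {}"
  by (auto simp: spin_configs_def PiE_eq_empty_iff)

lemma pf_pos: "0 < pf h"
  unfolding pf_def by (intro sum_pos wt_pos spin_configs_nonempty) simp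

lemma tilt_pos: "0 < tilt h \<sigma>"
  by (simp add: tilt_def wt_pos pf_pos)

lemma tilt_sum: "(\<Sum>\<sigma>\<in>\<Omega>. tilt h \<sigma>) = 1"
  using pf_pos[of h] by (simp add: tilt_def sum_divide_distrib[symmetric] pf_def)

lemma wt_flip:
  assumes "\<sigma> \<in> \<Omega>" "i \<in> I"
  shows "wt h (flip i \<sigma>) = wt h \<sigma> * exp (- 2 * real_of_int (\<sigma> i) * (fld i \<sigma> + h i))"
proof -
  let ?s = "real_of_int (\<sigma> i)"
  have s: "?s * ?s = 1" using spin_sq[OF assms] by (simp add: power2_eq_square)
  have "(\<Sum>j\<in>I. h j * real_of_int (flip i \<sigma> j)) = (\<Sum>j\<in>I. h j * real_of_int (\<sigma> j)) - 2 * h i * ?s"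
    using assms(2) by (simp add: sum.remove[of I i] algebra_simps)
  moreover have "\<beta> / (2 * real n) * (mag I \<sigma> - 2 * ?s)\<^sup>2 =
      \<beta> / (2 * real n) * (mag I \<sigma>)\<^sup>2 - 2 * ?s * fld i \<sigma>"
    using n_pos s by (simp add: fld_def power2_eq_square field_simps)
  ultimately show ?thesis
    using assms by (simp add: wt_def mag_flip exp_add[symmetric] algebra_simps)
qed

lemma cw_prob_tilt:
  assumes "\<sigma> \<in> \<Omega>"
  shows "cw_prob \<beta> n \<sigma> = tilt (\<lambda>_. 0) \<sigma>"
proof -
  have w: "cw_weight \<beta> n \<sigma> = exp (- \<beta> / 2) * wt (\<lambda>_. 0) \<sigma>" if "\<sigma> \<in> \<Omega>" for \<sigma>
  proof -
    have "(mag I \<sigma>)\<^sup>2 = real n + 2 * (\<Sum>i\<in>I. \<Sum>j\<in>{i<..n}. real_of_int (\<sigma> i * \<sigma> j))"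
      using square_sum_pairs[of "\<lambda>i. real_of_int (\<sigma> i)" n, folded I_def] that by (simp add: mag_def spin_sq)
    then have p: "(\<Sum>i\<in>I. \<Sum>j\<in>{i<..n}. real_of_int (\<sigma> i * \<sigma> j)) = ((mag I \<sigma>)\<^sup>2 - real n) / 2" by simp
    show ?thesis unfolding cw_weight_def wt_def exp_add[symmetric] I_def[symmetric] p
      using n_pos by (simp add: field_simps)
  qed
  have "cw_prob \<beta> n \<sigma> = exp (- \<beta> / 2) * wt (\<lambda>_. 0) \<sigma> / (\<Sum>\<tau>\<in>\<Omega>. exp (- \<beta> / 2) * wt (\<lambda>_. 0) \<tau>)"
    unfolding cw_prob_def using assms by (simp add: w)
  also have "\<dots> = tilt (\<lambda>_. 0) \<sigma>"
    by (simp add: tilt_def pf_def sum_distrib_left[symmetric])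
  finally show ?thesis .
qed

lemma rate_flip:
  assumes "\<sigma> \<in> \<Omega>" "i \<in> I"
  shows "glauber_rate \<beta> n \<sigma> (flip i \<sigma>) = rt i \<sigma>"
proof -
  have "\<sigma> i \<noteq> - \<sigma> i" by (rule spin_cases[OF assms]) auto
  then have "{j\<in>I. \<sigma> j \<noteq> flip i \<sigma> j} = {i}"
    using assms by (auto simp: flip_def)
  then have "glauber_rate \<beta> n \<sigma> (flip i \<sigma>) =
      tilt (\<lambda>_. 0) (flip i \<sigma>) / (tilt (\<lambda>_. 0) \<sigma> + tilt (\<lambda>_. 0) (flip i \<sigma>))"
    unfolding glauber_rate_def I_def[symmetric] using assms by (simp add: cw_prob_tilt flip_in)
  also have "\<dots> = wt (\<lambda>_. 0) (flip i \<sigma>) / (wt (\<lambda>_. 0) \<sigma> + wt (\<lambda>_. 0) (flip i \<sigma>))"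
    using pf_pos[of "\<lambda>_. 0"] by (simp add: tilt_def add_divide_distrib[symmetric])
  also have "\<dots> = exp (- 2 * real_of_int (\<sigma> i) * fld i \<sigma>) / (1 + exp (- 2 * real_of_int (\<sigma> i) * fld i \<sigma>))"
  proof -
    have *: "w * e / (w + w * e) = e / (1 + e)" if "w > 0" for w e :: real
      using that by (metis distrib_left mult.right_neutral mult_divide_mult_cancel_left order_less_irrefl)
    show ?thesis unfolding wt_flip[OF assms] using *[OF wt_pos] by simp
  qed
  also have "\<dots> = rt i \<sigma>"
  proof -
    have *: "exp (- 2 * x) / (1 + exp (- 2 * x)) = (1 - tanh x) / 2" for x :: real
    proof -
      have "1 + exp (- 2 * x) > 0" by (simp add: add_pos_pos)
      then show ?thesis by (simp add: tanh_real_altdef divide_simps)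
    qed
    have "real_of_int (\<sigma> i) * tanh (fld i \<sigma>) = tanh (real_of_int (\<sigma> i) * fld i \<sigma>)"
      by (rule spin_cases[OF assms]) auto
    then show ?thesis using *[of "real_of_int (\<sigma> i) * fld i \<sigma>"] by (simp add: rt_def mult.assoc)
  qed
  finally show ?thesis .
qed

lemma rate_nonneg: "\<sigma> \<in> \<Omega> \<Longrightarrow> \<tau> \<in> \<Omega> \<Longrightarrow> 0 \<le> glauber_rate \<beta> n \<sigma> \<tau>"
  using tilt_pos[of "\<lambda>_. 0" \<sigma>] tilt_pos[of "\<lambda>_. 0" \<tau>] by (simp add: glauber_rate_def cw_prob_tilt)

lemma neighbour_flip:
  assumes "\<sigma> \<in> \<Omega>" "\<tau> \<in> \<Omega>" "card {i\<in>I. \<sigma> i \<noteq> \<tau> i} = 1"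
  shows "\<exists>i\<in>I. \<tau> = flip i \<sigma>"
proof -
  from assms(3) obtain i where i: "{i\<in>I. \<sigma> i \<noteq> \<tau> i} = {i}" by (meson card_1_singletonE)
  have iff: "j \<in> I \<and> \<sigma> j \<noteq> \<tau> j \<longleftrightarrow> j = i" for j
    using i by (metis (mono_tags, lifting) mem_Collect_eq singleton_iff)
  have iI: "i \<in> I" "\<sigma> i \<noteq> \<tau> i" using iff[of i] by simp_all
  have o: "\<tau> j = \<sigma> j" if "j \<in> I" "j \<noteq> i" for j using iff[of j] that by metis
  have "\<tau> i = - \<sigma> i"
    by (rule spin_cases[OF assms(1) iI(1)]; rule spin_cases[OF assms(2) iI(1)]; use iI(2) in simp)
  moreover have "\<tau> j = \<sigma> j" if "j \<notin> I" for j
    using assms that by (auto simp: spin_configs_def I_def PiE_iff extensional_def)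
  ultimately have "\<tau> = flip i \<sigma>" using o by (auto simp: flip_def fun_eq_iff)
  then show ?thesis using iI by auto
qed

sublocale finite_chain \<Omega> "glauber_rate \<beta> n"
  by unfold_locales (auto simp: rate_nonneg)

text \<open>Only single flips have a nonzero rate, and different sites give different flips, so the
  sum over configurations collapses to one over sites.\<close>

lemma generator_flip:
  assumes \<sigma>: "\<sigma> \<in> \<Omega>"
  shows "(\<Sum>\<tau>\<in>\<Omega>. G \<sigma> \<tau> * f \<tau>) = (\<Sum>i\<in>I. rt i \<sigma> * (f (flip i \<sigma>) - f \<sigma>))"
proof -
  have inj: "inj_on (\<lambda>i. flip i \<sigma>) I"
  proof (rule inj_onI)
    fix i j assume ij: "i \<in> I" "j \<in> I" "flip i \<sigma> = flip j \<sigma>"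
    then have "flip i \<sigma> i = flip j \<sigma> i" by simp
    then show "i = j" using spin_abs[OF \<sigma> ij(1)] by (cases "i = j") auto
  qed
  have "(\<Sum>\<tau>\<in>\<Omega>. G \<sigma> \<tau> * f \<tau>) = (\<Sum>\<tau>\<in>\<Omega> - {\<sigma>}. glauber_rate \<beta> n \<sigma> \<tau> * (f \<tau> - f \<sigma>))"
    by (rule generator_sum) (use \<sigma> in auto)
  also have "\<dots> = (\<Sum>\<tau>\<in>(\<lambda>i. flip i \<sigma>) ` I. glauber_rate \<beta> n \<sigma> \<tau> * (f \<tau> - f \<sigma>))"
  proof (rule sum.mono_neutral_right)
    show "(\<lambda>i. flip i \<sigma>) ` I \<subseteq> \<Omega> - {\<sigma>}" using \<sigma> flip_in flip_neq by auto
    show "\<forall>\<tau>\<in>\<Omega> - {\<sigma>} - (\<lambda>i. flip i \<sigma>) ` I. glauber_rate \<beta> n \<sigma> \<tau> * (f \<tau> - f \<sigma>) = 0"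
      using neighbour_flip[OF \<sigma>] by (auto simp: glauber_rate_def I_def)
  qed simp
  also have "\<dots> = (\<Sum>i\<in>I. rt i \<sigma> * (f (flip i \<sigma>) - f \<sigma>))"
    by (subst sum.reindex[OF inj]) (simp add: rate_flip \<sigma>)
  finally show ?thesis .
qed

lemma detailed_balance:
  assumes "\<sigma> \<in> \<Omega>" "\<tau> \<in> \<Omega>"
  shows "tilt (\<lambda>_. 0) \<sigma> * G \<sigma> \<tau> = tilt (\<lambda>_. 0) \<tau> * G \<tau> \<sigma>"
proof (cases "\<sigma> = \<tau>")
  case False
  have "{i\<in>{1..n}. \<sigma> i \<noteq> \<tau> i} = {i\<in>{1..n}. \<tau> i \<noteq> \<sigma> i}" by auto
  then show ?thesis using False assms
    unfolding generator_def glauber_rate_def by (simp add: cw_prob_tilt add.commute)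
qed simp

text \<open>Given the other spins, spin \<open>i\<close> has mean \<open>tanh (fld i \<sigma> + h i)\<close>.\<close>

lemma spin_conditional_mean:
  fixes \<phi> :: "(nat \<Rightarrow> int) \<Rightarrow> 'b::real_vector"
  assumes i: "i \<in> I" and \<phi>: "\<And>\<sigma>. \<sigma> \<in> \<Omega> \<Longrightarrow> \<phi> (flip i \<sigma>) = \<phi> \<sigma>"
  shows "(\<Sum>\<sigma>\<in>\<Omega>. (tilt h \<sigma> * (real_of_int (\<sigma> i) - tanh (fld i \<sigma> + h i))) *\<^sub>R \<phi> \<sigma>) = 0"
proof -
  define F where "F = (\<lambda>\<sigma>. (tilt h \<sigma> * (real_of_int (\<sigma> i) - tanh (fld i \<sigma> + h i))) *\<^sub>R \<phi> \<sigma>)"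
  \<comment> \<open>The flip reverses the sign of the summand, its weight included; as it permutes
    the configurations, the whole sum equals its own negative.\<close>
  have "F (flip i \<sigma>) = - F \<sigma>" if \<sigma>: "\<sigma> \<in> \<Omega>" for \<sigma>
  proof -
    define z where "z = fld i \<sigma> + h i"
    have 1: "exp (- 2 * z) * (- 1 - tanh z) = - (1 - tanh z)"
    proof -
      have "1 + exp (- 2 * z) > 0" by (simp add: add_pos_pos)
      then show ?thesis by (simp add: tanh_real_altdef divide_simps)
    qed
    have 2: "exp (2 * z) * (1 - tanh z) = - (- 1 - tanh z)"
      using 1 by (simp add: exp_minus field_simps)
    have e1: "exp (- 2 * real_of_int (\<sigma> i) * z) * (- real_of_int (\<sigma> i) - tanh z) =
        - (real_of_int (\<sigma> i) - tanh z)"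
      by (rule spin_cases[OF \<sigma> i]; use 1 2 in simp)
    have e2: "tilt h (flip i \<sigma>) * (- real_of_int (\<sigma> i) - tanh z) = tilt h \<sigma> *
        (exp (- 2 * real_of_int (\<sigma> i) * z) * (- real_of_int (\<sigma> i) - tanh z))"
      unfolding tilt_def wt_flip[OF \<sigma> i] z_def[symmetric] by simp
    have "tilt h (flip i \<sigma>) * (- real_of_int (\<sigma> i) - tanh z) =
        - (tilt h \<sigma> * (real_of_int (\<sigma> i) - tanh z))"
      unfolding e2 e1 by (rule mult_minus_right)
    then show ?thesis
      using i \<sigma> by (simp add: F_def \<phi> z_def)
  qed
  then have "(\<Sum>\<sigma>\<in>\<Omega>. F (flip i \<sigma>)) = - (\<Sum>\<sigma>\<in>\<Omega>. F \<sigma>)"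
    unfolding sum_negf[symmetric] by (rule sum.cong[OF refl])
  then have "(\<Sum>\<sigma>\<in>\<Omega>. F \<sigma>) = - (\<Sum>\<sigma>\<in>\<Omega>. F \<sigma>)"
    using sum_flip_involution[OF i, of F] by simp
  then have "2 *\<^sub>R (\<Sum>\<sigma>\<in>\<Omega>. F \<sigma>) = 0" unfolding scaleR_2 by (metis add.right_inverse)
  then show ?thesis by (simp add: F_def)
qed

end

section \<open>A gradient bound for the semigroup\<close>

context curie_weiss
begin

definition L :: "((nat \<Rightarrow> int) \<Rightarrow> real) \<Rightarrow> (nat \<Rightarrow> int) \<Rightarrow> real" where
  "L f \<sigma> = (\<Sum>i\<in>I. rt i \<sigma> * (f (flip i \<sigma>) - f \<sigma>))"

definition grad2 :: "((nat \<Rightarrow> int) \<Rightarrow> real) \<Rightarrow> (nat \<Rightarrow> int) \<Rightarrow> real" where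
  "grad2 f \<sigma> = (\<Sum>i\<in>I. (f (flip i \<sigma>) - f \<sigma>)\<^sup>2)"

text \<open>By \<open>rt_bounds\<close> this is a lower bound for all flip rates, and it does not
  depend on \<open>n\<close>.\<close>

definition \<rho> :: real where "\<rho> = (1 - tanh \<beta>) / 2"

lemma rho_pos: "0 < \<rho>"
  using tanh_real_lt_1[of \<beta>] by (simp add: \<rho>_def)

text \<open>Nonnegative curvature in the sense of Bakry and Emery: with the first differences \<open>d i\<close> and the
  second differences \<open>g i j\<close>, the two sides differ by a sum of \<open>- 2 * (d i)\<^sup>2\<close> and of terms
  \<open>2 * \<delta> * d i * (d j + g i j) - r j * (g i j)\<^sup>2\<close>, where \<open>\<delta>\<close> is the change of a rate under a flip.\<close>

lemma grad2_curvature: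
  assumes large: "\<beta>\<^sup>2 / (real n * \<rho>) \<le> 2 * (1 - \<beta>)" and \<sigma>: "\<sigma> \<in> \<Omega>"
  shows "(\<Sum>i\<in>I. 2 * (f (flip i \<sigma>) - f \<sigma>) * (L f (flip i \<sigma>) - L f \<sigma>)) \<le> L (grad2 f) \<sigma>"
proof -
  define a where "a = f \<sigma>"
  define b where "b = (\<lambda>i. f (flip i \<sigma>))"
  define c where "c = (\<lambda>i j. f (flip j (flip i \<sigma>)))"
  define d where "d = (\<lambda>i. b i - a)"
  define r where "r = (\<lambda>j. rt j \<sigma>)"
  define r' where "r' = (\<lambda>i j. rt j (flip i \<sigma>))"
  \<comment> \<open>\<open>T i j\<close> is the contribution of the pair \<open>(i, j)\<close> to
    the difference of the two sides. For \<open>i = j\<close> the rates before and after the flip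
    add up to 1, which yields exactly \<open>- 2 * (d i)\<^sup>2\<close>.\<close>
  define T where "T = (\<lambda>i j. 2 * d i * (r' i j * (c i j - b i) - r j * d j) - r j * ((c i j - b j)\<^sup>2 - (d i)\<^sup>2))"
  define B where "B = (\<lambda>i j. \<beta> / real n * ((d i)\<^sup>2 + (d j)\<^sup>2) + \<beta>\<^sup>2 / ((real n)\<^sup>2 * \<rho>) * (d i)\<^sup>2)"
  have c_sym: "c i j = c j i" for i j by (simp add: c_def flip_commute)
  have B0: "0 \<le> B i j" for i j using beta_nonneg rho_pos by (simp add: B_def)
  have T: "T i j \<le> (if i = j then - 2 * (d i)\<^sup>2 else 0) + B i j" if ij: "i \<in> I" "j \<in> I" for i j
  proof (cases "i = j")
    case True
    have "T i i = 2 * d i * ((1 - r i) * (- d i) - r i * d i) - r i * ((- d i)\<^sup>2 - (d i)\<^sup>2)"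
      using ij by (simp add: T_def r'_def r_def c_def b_def d_def a_def rt_flip_same)
    also have "\<dots> = - 2 * (d i)\<^sup>2" by (simp add: power2_eq_square algebra_simps)
    finally show ?thesis using True B0[of i j] by simp
  next
    case False
    define \<delta> where "\<delta> = r' i j - r j"
    define g where "g = c i j - b i - b j + a"
    have \<delta>: "\<bar>\<delta>\<bar> \<le> \<beta> / real n" unfolding \<delta>_def r'_def r_def by (rule rt_flip_other[OF \<sigma> ij False])
    have rj: "\<rho> \<le> r j" unfolding r_def \<rho>_def by (rule rt_bounds(1)[OF \<sigma> ij(2)])
    have e: "c i j - b i = d j + g" "c i j - b j = d i + g" "r' i j = r j + \<delta>"
      by (auto simp: d_def g_def \<delta>_def)
    have "T i j = 2 * \<delta> * (d i * d j) + 2 * \<delta> * d i * g - r j * g\<^sup>2"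
      unfolding T_def e by (simp add: power2_eq_square algebra_simps)
    moreover have "2 * \<delta> * (d i * d j) \<le> \<beta> / real n * ((d i)\<^sup>2 + (d j)\<^sup>2)"
    proof -
      have "2 * \<delta> * (d i * d j) \<le> \<bar>\<delta>\<bar> * \<bar>2 * (d i * d j)\<bar>"
        using abs_ge_self[of "\<delta> * (2 * (d i * d j))"] by (simp add: abs_mult mult_ac)
      also have "\<bar>2 * (d i * d j)\<bar> \<le> (d i)\<^sup>2 + (d j)\<^sup>2"
        using sum_squares_bound[of "\<bar>d i\<bar>" "\<bar>d j\<bar>"] by (simp add: abs_mult mult_ac)
      finally have "2 * \<delta> * (d i * d j) \<le> \<bar>\<delta>\<bar> * ((d i)\<^sup>2 + (d j)\<^sup>2)"
        by (simp add: mult_left_mono)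
      also have "\<dots> \<le> \<beta> / real n * ((d i)\<^sup>2 + (d j)\<^sup>2)"
        using \<delta> by (intro mult_right_mono) auto
      finally show ?thesis .
    qed
    \<comment> \<open>Completing the square in \<open>g\<close>: as no rate is below
      \<open>\<rho>\<close>, the second differences absorb the mixed term at a cost of order
      \<open>1 / n^2\<close> per pair.\<close>
    moreover have "2 * \<delta> * d i * g - r j * g\<^sup>2 \<le> \<beta>\<^sup>2 / ((real n)\<^sup>2 * \<rho>) * (d i)\<^sup>2"
    proof -
      have "0 \<le> (\<rho> * g - \<delta> * d i)\<^sup>2 / \<rho>" using rho_pos by simp
      also have "(\<rho> * g - \<delta> * d i)\<^sup>2 / \<rho> = \<rho> * g\<^sup>2 - 2 * \<delta> * d i * g + \<delta>\<^sup>2 / \<rho> * (d i)\<^sup>2"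
        using rho_pos by (simp add: power2_eq_square field_simps)
      finally have "2 * \<delta> * d i * g - \<rho> * g\<^sup>2 \<le> \<delta>\<^sup>2 / \<rho> * (d i)\<^sup>2" by simp
      moreover have "\<rho> * g\<^sup>2 \<le> r j * g\<^sup>2" using rj by (intro mult_right_mono) auto
      moreover have "\<delta>\<^sup>2 / \<rho> * (d i)\<^sup>2 \<le> \<beta>\<^sup>2 / ((real n)\<^sup>2 * \<rho>) * (d i)\<^sup>2"
      proof -
        have "\<delta>\<^sup>2 \<le> (\<beta> / real n)\<^sup>2" using \<delta> by (metis abs_ge_zero power2_abs power_mono)
        then have "\<delta>\<^sup>2 / \<rho> \<le> (\<beta> / real n)\<^sup>2 / \<rho>" using rho_pos by (intro divide_right_mono) auto
        then show ?thesis by (intro mult_right_mono) (auto simp: power_divide)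
      qed
      ultimately show ?thesis by linarith
    qed
    ultimately show ?thesis using False by (simp add: B_def)
  qed
  have "(\<Sum>i\<in>I. 2 * (f (flip i \<sigma>) - f \<sigma>) * (L f (flip i \<sigma>) - L f \<sigma>)) - L (grad2 f) \<sigma> =
      (\<Sum>i\<in>I. \<Sum>j\<in>I. T i j)"
  proof -
    have "L (grad2 f) \<sigma> = (\<Sum>j\<in>I. \<Sum>i\<in>I. r j * ((c j i - b j)\<^sup>2 - (d i)\<^sup>2))"
      unfolding L_def grad2_def sum_subtractf[symmetric] sum_distrib_left
      by (simp add: r_def c_def b_def d_def a_def)
    also have "\<dots> = (\<Sum>i\<in>I. \<Sum>j\<in>I. r j * ((c i j - b j)\<^sup>2 - (d i)\<^sup>2))"
      by (subst sum.swap) (simp add: c_sym)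
    finally have 1: "L (grad2 f) \<sigma> = (\<Sum>i\<in>I. \<Sum>j\<in>I. r j * ((c i j - b j)\<^sup>2 - (d i)\<^sup>2))" .
    have "2 * (f (flip i \<sigma>) - f \<sigma>) * (L f (flip i \<sigma>) - L f \<sigma>) =
        (\<Sum>j\<in>I. 2 * d i * (r' i j * (c i j - b i) - r j * d j))" for i
      unfolding L_def sum_subtractf[symmetric] sum_distrib_left
      by (intro sum.cong refl) (simp add: r_def r'_def c_def b_def d_def a_def)
    then show ?thesis unfolding 1 by (simp add: T_def sum_subtractf)
  qed
  also have "\<dots> \<le> (\<Sum>i\<in>I. \<Sum>j\<in>I. (if i = j then - 2 * (d i)\<^sup>2 else 0) + B i j)"
    by (intro sum_mono T)
  also have "\<dots> = - 2 * (\<Sum>i\<in>I. (d i)\<^sup>2) + (\<Sum>i\<in>I. \<Sum>j\<in>I. B i j)"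
    by (simp add: sum.distrib sum.delta sum_distrib_left sum_negf sum_subtractf)
  also have "(\<Sum>i\<in>I. \<Sum>j\<in>I. B i j) = (2 * \<beta> + \<beta>\<^sup>2 / (real n * \<rho>)) * (\<Sum>i\<in>I. (d i)\<^sup>2)"
  proof -
    have *: "(\<Sum>i\<in>I. \<Sum>j\<in>I. x * (D i + D j) + y * D i) = real n * (2 * x + y) * sum D I"
      for x y :: real and D
    proof -
      have "(\<Sum>j\<in>I. x * (D i + D j) + y * D i) = real n * (x + y) * D i + x * sum D I" for i
        by (simp add: sum.distrib sum_distrib_left distrib_left algebra_simps)
      then have "(\<Sum>i\<in>I. \<Sum>j\<in>I. x * (D i + D j) + y * D i) = (\<Sum>i\<in>I. real n * (x + y) * D i + x * sum D I)"
        by simp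
      also have "\<dots> = real n * (x + y) * sum D I + real n * (x * sum D I)"
        by (simp add: sum.distrib sum_distrib_left)
      finally show ?thesis by (simp add: algebra_simps)
    qed
    have "(\<Sum>i\<in>I. \<Sum>j\<in>I. B i j) =
        real n * (2 * (\<beta> / real n) + \<beta>\<^sup>2 / ((real n)\<^sup>2 * \<rho>)) * (\<Sum>i\<in>I. (d i)\<^sup>2)"
      unfolding B_def by (rule *)
    also have "real n * (2 * (\<beta> / real n) + \<beta>\<^sup>2 / ((real n)\<^sup>2 * \<rho>)) = 2 * \<beta> + \<beta>\<^sup>2 / (real n * \<rho>)"
      using n_pos by (simp add: power2_eq_square field_simps)
    finally show ?thesis .
  qed
  also have "- 2 * (\<Sum>i\<in>I. (d i)\<^sup>2) + (2 * \<beta> + \<beta>\<^sup>2 / (real n * \<rho>)) * (\<Sum>i\<in>I. (d i)\<^sup>2) =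
      (\<beta>\<^sup>2 / (real n * \<rho>) - 2 * (1 - \<beta>)) * (\<Sum>i\<in>I. (d i)\<^sup>2)"
    by (simp add: algebra_simps)
  \<comment> \<open>The diagonal contributes \<open>-2\<close> and the change of the rates
    \<open>2 * \<beta>\<close>, so \<open>\<beta> < 1\<close> leaves room for the lower-order term
    as soon as \<open>large\<close> holds.\<close>
  also have "\<dots> \<le> 0"
    using large by (intro mult_nonpos_nonneg sum_nonneg) auto
  finally show ?thesis by simp
qed

lemma sg_deriv_L:
  "\<sigma> \<in> \<Omega> \<Longrightarrow> ((\<lambda>t. sg t f \<sigma>) has_real_derivative L (sg t f) \<sigma>) (at t)"
  using sg_deriv[of \<sigma> f t] generator_flip[of \<sigma> "sg t f"] by (simp add: L_def)

text \<open>The excess of \<open>L\<close> applied to the square is the carre du champ, which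
  dominates \<open>\<rho> * grad2 f\<close>. It is the dissipation that Bernstein's method
  spends.\<close>

lemma L_square:
  assumes "\<sigma> \<in> \<Omega>"
  shows "2 * f \<sigma> * L f \<sigma> + \<rho> * grad2 f \<sigma> \<le> L (\<lambda>\<sigma>. (f \<sigma>)\<^sup>2) \<sigma>"
proof -
  have "L (\<lambda>\<sigma>. (f \<sigma>)\<^sup>2) \<sigma> = 2 * f \<sigma> * L f \<sigma> + (\<Sum>i\<in>I. rt i \<sigma> * (f (flip i \<sigma>) - f \<sigma>)\<^sup>2)"
    unfolding L_def sum_distrib_left sum.distrib[symmetric]
    by (intro sum.cong refl) (simp add: power2_eq_square algebra_simps)
  moreover have "\<rho> * grad2 f \<sigma> \<le> (\<Sum>i\<in>I. rt i \<sigma> * (f (flip i \<sigma>) - f \<sigma>)\<^sup>2)"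
    unfolding grad2_def sum_distrib_left \<rho>_def
    by (intro sum_mono mult_right_mono rt_bounds assms) auto
  ultimately show ?thesis by linarith
qed

text \<open>Bernstein's method: \<open>\<rho> * t * grad2 (sg t f) + (sg t f)\<^sup>2\<close> is a subsolution of the backward equation.\<close>

lemma sg_gradient_bound:
  assumes large: "\<beta>\<^sup>2 / (real n * \<rho>) \<le> 2 * (1 - \<beta>)"
    and f: "\<And>\<sigma>. \<sigma> \<in> \<Omega> \<Longrightarrow> \<bar>f \<sigma>\<bar> \<le> 1" and t: "0 \<le> t" and \<sigma>: "\<sigma> \<in> \<Omega>"
  shows "\<rho> * t * grad2 (sg t f) \<sigma> \<le> 1"
proof -
  define u where "u = (\<lambda>t. sg t f)"
  define w where "w = (\<lambda>t \<sigma>. \<rho> * t * grad2 (u t) \<sigma> + (u t \<sigma>)\<^sup>2)"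
  define w' where "w' = (\<lambda>t \<sigma>. \<rho> * grad2 (u t) \<sigma> +
      \<rho> * t * (\<Sum>i\<in>I. 2 * (u t (flip i \<sigma>) - u t \<sigma>) * (L (u t) (flip i \<sigma>) - L (u t) \<sigma>)) +
      2 * u t \<sigma> * L (u t) \<sigma>)"
  have "w t \<sigma> \<le> 1"
  proof (rule max_principle[where w = w and w' = w', OF fin q_nonneg _ _ _ t \<sigma>])
    fix s :: real and \<sigma> assume \<sigma>: "\<sigma> \<in> \<Omega>" and s: "0 \<le> s"
    have du: "((\<lambda>t. u t \<tau>) has_real_derivative L (u s) \<tau>) (at s)" if "\<tau> \<in> \<Omega>" for \<tau>
      unfolding u_def by (rule sg_deriv_L[OF that])
    have dg: "((\<lambda>t. grad2 (u t) \<sigma>) has_real_derivative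
       (\<Sum>i\<in>I. 2 * (u s (flip i \<sigma>) - u s \<sigma>) * (L (u s) (flip i \<sigma>) - L (u s) \<sigma>))) (at s)"
      unfolding grad2_def
      by (auto intro!: derivative_eq_intros du \<sigma> flip_in sum.cong simp: algebra_simps)
    show "((\<lambda>t. w t \<sigma>) has_real_derivative w' s \<sigma>) (at s)"
      unfolding w_def w'_def
      by (auto intro!: derivative_eq_intros du dg \<sigma> simp: algebra_simps)
    \<comment> \<open>Differentiating the factor \<open>t\<close> creates the term
      \<open>\<rho> * grad2\<close>, which the dissipation in \<open>L_square\<close> pays for; the
      derivative of \<open>grad2\<close> itself is handled by the curvature bound.\<close>
    have "(\<Sum>\<tau>\<in>\<Omega>. G \<sigma> \<tau> * w s \<tau>) = \<rho> * s * L (grad2 (u s)) \<sigma> + L (\<lambda>\<sigma>. (u s \<sigma>)\<^sup>2) \<sigma>"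
      unfolding generator_flip[OF \<sigma>] unfolding L_def w_def sum_distrib_left sum.distrib[symmetric]
      by (intro sum.cong refl) (simp add: algebra_simps)
    moreover have "\<rho> * s * (\<Sum>i\<in>I. 2 * (u s (flip i \<sigma>) - u s \<sigma>) * (L (u s) (flip i \<sigma>) - L (u s) \<sigma>))
        \<le> \<rho> * s * L (grad2 (u s)) \<sigma>"
      using rho_pos s by (intro mult_left_mono grad2_curvature large \<sigma>) auto
    ultimately show "w' s \<sigma> \<le> (\<Sum>\<tau>\<in>\<Omega>. G \<sigma> \<tau> * w s \<tau>)"
      using L_square[OF \<sigma>, of "u s"] by (simp add: w'_def)
  next
    fix \<sigma> assume "\<sigma> \<in> \<Omega>"
    then show "w 0 \<sigma> \<le> 1" using f[of \<sigma>] by (simp add: w_def u_def sg_0 abs_square_le_1)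
  qed auto
  moreover have "0 \<le> (u t \<sigma>)\<^sup>2" by simp
  ultimately show ?thesis unfolding w_def u_def by linarith
qed

end

section \<open>Second moments of magnetizations\<close>

lemma weighted_amgm:
  fixes x y c :: real
  assumes "0 < c"
  shows "x * y \<le> c / 2 * x\<^sup>2 + y\<^sup>2 / (2 * c)"
proof -
  have "0 \<le> (c * x - y)\<^sup>2 / (2 * c)" using assms by simp
  also have "(c * x - y)\<^sup>2 / (2 * c) = c / 2 * x\<^sup>2 - x * y + y\<^sup>2 / (2 * c)"
    using assms by (simp add: power2_eq_square field_simps)
  finally show ?thesis by simp
qed

lemma mult_le_abs_mult:
  fixes x y z :: real
  assumes "\<bar>y\<bar> \<le> z"
  shows "x * y \<le> \<bar>x\<bar> * z"
proof -
  have "x * y \<le> \<bar>x\<bar> * \<bar>y\<bar>" by (metis abs_ge_self abs_mult)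
  also have "\<dots> \<le> \<bar>x\<bar> * z" using assms by (intro mult_left_mono) auto
  finally show ?thesis .
qed

context finite_chain
begin

lemma sg_add: "sg t (\<lambda>y. f y + g y) x = sg t f x + sg t g x"
  by (simp add: sg_def distrib_left sum.distrib)

lemma sg_cmult: "sg t (\<lambda>y. c * f y) x = c * sg t f x"
  by (simp add: sg_def sum_distrib_left mult_ac)

end

context curie_weiss
begin

definition ex :: "(nat \<Rightarrow> real) \<Rightarrow> ((nat \<Rightarrow> int) \<Rightarrow> real) \<Rightarrow> real" where
  "ex h f = (\<Sum>\<sigma>\<in>\<Omega>. tilt h \<sigma> * f \<sigma>)"

lemma ex_mono: "(\<And>\<sigma>. \<sigma> \<in> \<Omega> \<Longrightarrow> f \<sigma> \<le> g \<sigma>) \<Longrightarrow> ex h f \<le> ex h g"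
  unfolding ex_def by (intro sum_mono mult_left_mono) (auto simp: less_imp_le[OF tilt_pos])

lemma ex_cong: "(\<And>\<sigma>. \<sigma> \<in> \<Omega> \<Longrightarrow> f \<sigma> = g \<sigma>) \<Longrightarrow> ex h f = ex h g"
  unfolding ex_def by (intro sum.cong) auto

lemma ex_const [simp]: "ex h (\<lambda>_. c) = c"
  by (simp add: ex_def sum_distrib_right[symmetric] tilt_sum)

lemma ex_add: "ex h (\<lambda>\<sigma>. f \<sigma> + g \<sigma>) = ex h f + ex h g"
  by (simp add: ex_def distrib_left sum.distrib)

lemma ex_diff: "ex h (\<lambda>\<sigma>. f \<sigma> - g \<sigma>) = ex h f - ex h g"
  by (simp add: ex_def right_diff_distrib sum_subtractf)

lemma ex_cmult: "ex h (\<lambda>\<sigma>. c * f \<sigma>) = c * ex h f"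
  by (simp add: ex_def sum_distrib_left mult_ac)

lemma ex_divide: "ex h (\<lambda>\<sigma>. f \<sigma> / c) = ex h f / c"
  using ex_cmult[of h "1 / c" f] by simp

lemma ex_sum: "ex h (\<lambda>\<sigma>. \<Sum>i\<in>A. f i \<sigma>) = (\<Sum>i\<in>A. ex h (f i))"
  unfolding ex_def sum_distrib_left by (rule sum.swap)

lemma ex_abs: "\<bar>ex h f\<bar> \<le> ex h (\<lambda>\<sigma>. \<bar>f \<sigma>\<bar>)"
  unfolding ex_def by (rule order_trans[OF sum_abs]) (simp add: abs_mult less_imp_le[OF tilt_pos])

text \<open>Remove spin \<open>i\<close> from the factor \<open>mag C \<sigma> - a\<close>: the rest
  is invariant under \<open>flip i\<close>, hence uncorrelated with the centred spin. Only the
  product of spin \<open>i\<close> with its own centred value survives. Thus n dependent spins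
  fluctuate like independent ones.\<close>

lemma fluctuation_identity:
  assumes C: "C \<subseteq> I"
  shows "ex h (\<lambda>\<sigma>. (mag C \<sigma> - a) * (\<Sum>i\<in>C. real_of_int (\<sigma> i) - tanh (fld i \<sigma> + h i))) =
    (\<Sum>i\<in>C. ex h (\<lambda>\<sigma>. 1 - real_of_int (\<sigma> i) * tanh (fld i \<sigma> + h i)))"
proof -
  have fC: "finite C" using C finite_I finite_subset by blast
  have "ex h (\<lambda>\<sigma>. (mag C \<sigma> - a) * (real_of_int (\<sigma> i) - tanh (fld i \<sigma> + h i))) =
      ex h (\<lambda>\<sigma>. 1 - real_of_int (\<sigma> i) * tanh (fld i \<sigma> + h i))" if i: "i \<in> C" for i
  proof -
    define \<phi> where "\<phi> = (\<lambda>\<sigma>. mag C \<sigma> - real_of_int (\<sigma> i) - a)"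
    have "ex h (\<lambda>\<sigma>. (real_of_int (\<sigma> i) - tanh (fld i \<sigma> + h i)) * \<phi> \<sigma>) = 0"
      using spin_conditional_mean[of i \<phi> h] i C fC
      by (auto simp: ex_def \<phi>_def mag_flip mult.assoc)
    moreover have "ex h (\<lambda>\<sigma>. (mag C \<sigma> - a) * (real_of_int (\<sigma> i) - tanh (fld i \<sigma> + h i))) =
      ex h (\<lambda>\<sigma>. (real_of_int (\<sigma> i) - tanh (fld i \<sigma> + h i)) * \<phi> \<sigma> +
                  (1 - real_of_int (\<sigma> i) * tanh (fld i \<sigma> + h i)))"
    proof (rule ex_cong)
      fix \<sigma> assume "\<sigma> \<in> \<Omega>"
      then have "real_of_int (\<sigma> i) * real_of_int (\<sigma> i) = 1"
        using spin_sq[of \<sigma> i] i C by (auto simp: power2_eq_square)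
      then show "(mag C \<sigma> - a) * (real_of_int (\<sigma> i) - tanh (fld i \<sigma> + h i)) =
          (real_of_int (\<sigma> i) - tanh (fld i \<sigma> + h i)) * \<phi> \<sigma> +
                  (1 - real_of_int (\<sigma> i) * tanh (fld i \<sigma> + h i))"
        by (simp add: \<phi>_def algebra_simps)
    qed
    ultimately show ?thesis by (simp add: ex_add)
  qed
  then show ?thesis by (simp add: sum_distrib_left ex_sum)
qed

lemma spin_tanh_le: "\<sigma> \<in> \<Omega> \<Longrightarrow> i \<in> I \<Longrightarrow> \<bar>real_of_int (\<sigma> i) * tanh x\<bar> \<le> 1"
  using spin_abs[of \<sigma> i] abs_tanh_less_1[of x] by (simp add: abs_mult)

lemma fluctuation_bound:
  assumes C: "C \<subseteq> I"
  shows "ex h (\<lambda>\<sigma>. (mag C \<sigma> - a) * (\<Sum>i\<in>C. real_of_int (\<sigma> i) - tanh (fld i \<sigma> + h i))) \<le> 2 * real (card C)"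
  unfolding fluctuation_identity[OF C]
proof (rule order_trans[OF sum_mono])
  fix i assume "i \<in> C"
  then have i: "i \<in> I" using C by auto
  have "ex h (\<lambda>\<sigma>. 1 - real_of_int (\<sigma> i) * tanh (fld i \<sigma> + h i)) \<le> ex h (\<lambda>_. 2)"
  proof (rule ex_mono)
    fix \<sigma> assume "\<sigma> \<in> \<Omega>"
    from abs_le_D2[OF spin_tanh_le[OF this i, of "fld i \<sigma> + h i"]]
    show "1 - real_of_int (\<sigma> i) * tanh (fld i \<sigma> + h i) \<le> 2" by simp
  qed
  then show "ex h (\<lambda>\<sigma>. 1 - real_of_int (\<sigma> i) * tanh (fld i \<sigma> + h i)) \<le> 2" by simp
qed simp

text \<open>In the proof of \<open>second_moment_bound\<close> the leading 2 is the fluctuation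
  bound per site, \<open>A\<close> comes from the external field, the 2 added to it from the
  \<open>+ 1\<close> in \<open>\<bar>mag I \<sigma>\<bar> + 1\<close>, and
  \<open>2 / (1 - \<beta>)\<close> from solving the self-bounding inequality.\<close>

definition M0 :: "real \<Rightarrow> real" where
  "M0 A = 2 / (1 - \<beta>) * (2 + (A + 2)\<^sup>2 / (2 * (1 - \<beta>)))"

lemma fld_abs_le_mag:
  assumes "\<sigma> \<in> \<Omega>" "i \<in> I"
  shows "\<bar>fld i \<sigma>\<bar> \<le> \<beta> * (\<bar>mag I \<sigma>\<bar> + 1) / real n"
proof -
  have "\<bar>fld i \<sigma>\<bar> \<le> \<bar>\<beta> * mag I \<sigma> / real n\<bar> + \<beta> / real n" using fld_bound[OF assms] by linarith
  also have "\<dots> = \<beta> * (\<bar>mag I \<sigma>\<bar> + 1) / real n"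
    using beta_nonneg n_pos by (simp add: abs_mult field_simps)
  finally show ?thesis .
qed

text \<open>The magnetization is a centred part plus the sum of conditional means, and the latter is
  at most \<open>\<beta>\<close> times the magnetization plus \<open>O(sqrt n)\<close>. Because
  \<open>\<beta> < 1\<close>, the second moment can be absorbed into the left-hand side.\<close>

lemma second_moment_bound:
  assumes A: "0 \<le> A" and h: "\<And>i. i \<in> I \<Longrightarrow> \<bar>h i\<bar> \<le> A / sqrt (real n)"
  shows "ex h (\<lambda>\<sigma>. (\<bar>mag I \<sigma>\<bar> + 1)\<^sup>2) \<le> M0 A * real n"
proof -
  define X where "X = (\<lambda>\<sigma>. \<bar>mag I \<sigma>\<bar> + 1)"
  define s where "s = sqrt (real n)"
  have s: "s > 0" "s * s = real n" "1 \<le> s" using n_pos by (auto simp: s_def)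
  have pt: "(X \<sigma>)\<^sup>2 \<le> mag I \<sigma> * (\<Sum>i\<in>I. real_of_int (\<sigma> i) - tanh (fld i \<sigma> + h i)) +
      ((1 + \<beta>) / 2 * (X \<sigma>)\<^sup>2 + (A + 2)\<^sup>2 / (2 * (1 - \<beta>)) * real n)" if \<sigma>: "\<sigma> \<in> \<Omega>" for \<sigma>
  proof -
    have X1: "X \<sigma> \<ge> 1" by (simp add: X_def)
    have "\<bar>\<Sum>i\<in>I. tanh (fld i \<sigma> + h i)\<bar> \<le> (\<Sum>i\<in>I. \<beta> * X \<sigma> / real n + A / s)"
    proof (rule order_trans[OF sum_abs sum_mono])
      fix i assume i: "i \<in> I"
      show "\<bar>tanh (fld i \<sigma> + h i)\<bar> \<le> \<beta> * X \<sigma> / real n + A / s"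
        using tanh_abs_le[of "fld i \<sigma> + h i"] fld_abs_le_mag[OF \<sigma> i] h[OF i] by (simp add: X_def s_def)
    qed
    also have "\<dots> = \<beta> * X \<sigma> + A * s"
      using n_pos s by (simp add: distrib_left) (simp flip: s(2))
    finally have T: "\<bar>\<Sum>i\<in>I. tanh (fld i \<sigma> + h i)\<bar> \<le> \<beta> * X \<sigma> + A * s" .
    have "mag I \<sigma> * (\<Sum>i\<in>I. tanh (fld i \<sigma> + h i)) \<le> X \<sigma> * (\<beta> * X \<sigma> + A * s)"
    proof (rule order_trans[OF abs_ge_self])
      show "\<bar>mag I \<sigma> * (\<Sum>i\<in>I. tanh (fld i \<sigma> + h i))\<bar> \<le> X \<sigma> * (\<beta> * X \<sigma> + A * s)"
        unfolding abs_mult by (intro mult_mono T) (auto simp: X_def)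
    qed
    moreover have "(\<Sum>i\<in>I. real_of_int (\<sigma> i) - tanh (fld i \<sigma> + h i)) = mag I \<sigma> - (\<Sum>i\<in>I. tanh (fld i \<sigma> + h i))"
      by (simp add: mag_def sum_subtractf)
    ultimately have "mag I \<sigma> * mag I \<sigma> \<le> mag I \<sigma> * (\<Sum>i\<in>I. real_of_int (\<sigma> i) - tanh (fld i \<sigma> + h i)) + X \<sigma> * (\<beta> * X \<sigma> + A * s)"
      by (simp add: right_diff_distrib)
    moreover have "(X \<sigma>)\<^sup>2 \<le> mag I \<sigma> * mag I \<sigma> + 2 * X \<sigma> * s"
    proof -
      have "(X \<sigma>)\<^sup>2 = mag I \<sigma> * mag I \<sigma> + 2 * X \<sigma> - 1"
        by (simp add: X_def power2_eq_square algebra_simps flip: abs_mult)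
      moreover have "X \<sigma> * 1 \<le> X \<sigma> * s" using X1 s by (intro mult_left_mono) auto
      ultimately show ?thesis by linarith
    qed
    moreover have "X \<sigma> * ((A + 2) * s) \<le> (1 - \<beta>) / 2 * (X \<sigma>)\<^sup>2 + (A + 2)\<^sup>2 / (2 * (1 - \<beta>)) * real n"
      using weighted_amgm[of "1 - \<beta>" "X \<sigma>" "(A + 2) * s"] beta_less s(2)
      by (simp add: power_mult_distrib power2_eq_square[of s])
    moreover have "X \<sigma> * (\<beta> * X \<sigma> + A * s) + 2 * X \<sigma> * s = \<beta> * (X \<sigma>)\<^sup>2 + X \<sigma> * ((A + 2) * s)"
      by (simp add: power2_eq_square algebra_simps)
    moreover have "\<beta> * (X \<sigma>)\<^sup>2 + (1 - \<beta>) / 2 * (X \<sigma>)\<^sup>2 = (1 + \<beta>) / 2 * (X \<sigma>)\<^sup>2"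
      by (simp add: field_simps)
    ultimately show ?thesis by linarith
  qed
  define Q where "Q = ex h (\<lambda>\<sigma>. (X \<sigma>)\<^sup>2)"
  have "Q \<le> ex h (\<lambda>\<sigma>. mag I \<sigma> * (\<Sum>i\<in>I. real_of_int (\<sigma> i) - tanh (fld i \<sigma> + h i)) +
      ((1 + \<beta>) / 2 * (X \<sigma>)\<^sup>2 + (A + 2)\<^sup>2 / (2 * (1 - \<beta>)) * real n))"
    unfolding Q_def by (rule ex_mono) (rule pt)
  also have "\<dots> = ex h (\<lambda>\<sigma>. mag I \<sigma> * (\<Sum>i\<in>I. real_of_int (\<sigma> i) - tanh (fld i \<sigma> + h i))) +
      ((1 + \<beta>) / 2 * Q + (A + 2)\<^sup>2 / (2 * (1 - \<beta>)) * real n)"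
    by (simp add: ex_add ex_cmult ex_divide Q_def)
  also have "ex h (\<lambda>\<sigma>. mag I \<sigma> * (\<Sum>i\<in>I. real_of_int (\<sigma> i) - tanh (fld i \<sigma> + h i))) \<le> 2 * real n"
    using fluctuation_bound[of I h 0] by simp
  finally have "(1 - \<beta>) / 2 * Q \<le> (2 + (A + 2)\<^sup>2 / (2 * (1 - \<beta>))) * real n"
    by (simp add: field_simps)
  then have "2 / (1 - \<beta>) * ((1 - \<beta>) / 2 * Q) \<le> 2 / (1 - \<beta>) * ((2 + (A + 2)\<^sup>2 / (2 * (1 - \<beta>))) * real n)"
    using beta_less by (intro mult_left_mono) auto
  moreover have "2 / (1 - \<beta>) * ((1 - \<beta>) / 2 * Q) = Q" using beta_less by simp
  ultimately have "Q \<le> M0 A * real n" unfolding M0_def by (simp only: mult.assoc)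
  then show ?thesis by (simp add: Q_def X_def)
qed

text \<open>The static and the dynamic estimates lead to the same constants, \<open>M1\<close> for
  the total magnetization and \<open>M2\<close> for a class. The bound for a class is relative to
  its own size, so small classes cause no loss.\<close>

definition M1 :: real where "M1 = (4 + 1 / (1 - \<beta>)) / (1 - \<beta>)"
definition M2 :: real where "M2 = 6 + 2 * M1"

lemma M1_pos: "0 < M1" and M2_pos: "0 < M2"
proof -
  show "0 < M1" using beta_less by (simp add: M1_def add_pos_pos)
  then show "0 < M2" by (simp add: M2_def)
qed

lemma fld_deviation:
  assumes "\<sigma> \<in> \<Omega>" "i \<in> I"
  shows "\<bar>fld i \<sigma> - \<beta> * m\<bar> \<le> \<beta> * (\<bar>mag I \<sigma> - real n * m\<bar> + 1) / real n"
proof -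
  have "\<bar>fld i \<sigma> - \<beta> * m\<bar> \<le> \<bar>\<beta> * mag I \<sigma> / real n - \<beta> * m\<bar> + \<beta> / real n"
    using fld_bound[OF assms] by linarith
  also have "\<beta> * mag I \<sigma> / real n - \<beta> * m = \<beta> * (mag I \<sigma> - real n * m) / real n"
    using n_pos by (simp add: field_simps)
  also have "\<bar>\<dots>\<bar> + \<beta> / real n = \<beta> * (\<bar>mag I \<sigma> - real n * m\<bar> + 1) / real n"
    unfolding abs_mult abs_divide using beta_nonneg n_pos by (simp add: distrib_left add_divide_distrib)
  finally show ?thesis .
qed

lemma card_le_n: "C \<subseteq> I \<Longrightarrow> card C \<le> n"
  using card_mono[of I C] by simp

text \<open>The total magnetization, of variance order \<open>n\<close>, acts on a class of k sites
  with weight \<open>k / n\<close>; this bounds the resulting contribution by k.\<close>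

lemma card_ratio: "C \<subseteq> I \<Longrightarrow> (real (card C) / real n)\<^sup>2 * real n \<le> real (card C)"
proof -
  assume "C \<subseteq> I"
  then have "real (card C) / real n \<le> 1" using card_le_n[of C] n_pos by simp
  then have "real (card C) / real n * real (card C) \<le> 1 * real (card C)" by (intro mult_right_mono) auto
  then show ?thesis using n_pos by (simp add: power2_eq_square field_simps)
qed

text \<open>The constants do not depend on \<open>U\<close>, hence not on the smoothing time \<open>K\<close> below.\<close>

lemma tilt_concentration:
  assumes m: "real n * m = (\<Sum>i\<in>I. u i)" and u: "\<And>i. i \<in> I \<Longrightarrow> u i = h i + \<beta> * m"
    and U: "\<And>i. i \<in> I \<Longrightarrow> \<bar>u i\<bar> \<le> U / sqrt (real n)" and large: "\<beta> + U\<^sup>2 \<le> sqrt (real n)"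
    and C: "C \<subseteq> I"
  shows "ex h (\<lambda>\<sigma>. (mag I \<sigma> - real n * m)\<^sup>2) \<le> M1 * real n" (is "?A")
    and "ex h (\<lambda>\<sigma>. (mag C \<sigma> - (\<Sum>i\<in>C. u i))\<^sup>2) \<le> M2 * real (card C)" (is "?B")
proof -
  define s where "s = sqrt (real n)"
  have s: "s > 0" "s\<^sup>2 = real n" using n_pos by (auto simp: s_def)
  define Y where "Y = (\<lambda>\<sigma>. mag I \<sigma> - real n * m)"
  define T where "T = (\<lambda>C \<sigma>. \<Sum>i\<in>C. real_of_int (\<sigma> i) - tanh (fld i \<sigma> + h i))"
  \<comment> \<open>The deviation splits into centred spins, left to
    \<open>fluctuation_bound\<close>, and the linearization error of their conditional
    means.\<close>
  have pt: "(mag C \<sigma> - (\<Sum>i\<in>C. u i))\<^sup>2 \<le> (mag C \<sigma> - (\<Sum>i\<in>C. u i)) * T C \<sigma> +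
      \<bar>mag C \<sigma> - (\<Sum>i\<in>C. u i)\<bar> * (real (card C) / real n * (\<beta> * \<bar>Y \<sigma>\<bar> + s))"
    if C: "C \<subseteq> I" and \<sigma>: "\<sigma> \<in> \<Omega>" for C \<sigma>
  proof -
    have "\<bar>\<Sum>i\<in>C. tanh (fld i \<sigma> + h i) - u i\<bar> \<le> (\<Sum>i\<in>C. (\<beta> * \<bar>Y \<sigma>\<bar> + s) / real n)"
    proof (rule order_trans[OF sum_abs sum_mono])
      fix i assume "i \<in> C"
      then have i: "i \<in> I" using C by auto
      have "\<bar>tanh (fld i \<sigma> + h i) - tanh (u i)\<bar> \<le> \<bar>fld i \<sigma> - \<beta> * m\<bar>"
        using tanh_diff_le[of "fld i \<sigma> + h i" "u i"] u[OF i] by (simp add: algebra_simps)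
      moreover have "\<bar>tanh (u i) - u i\<bar> \<le> U\<^sup>2 / real n"
      proof -
        have "\<bar>u i\<bar>\<^sup>2 \<le> (U / s)\<^sup>2" using U[OF i] by (intro power_mono) (auto simp: s_def)
        then show ?thesis using tanh_approx[of "u i"] s by (simp add: power_divide)
      qed
      ultimately have "\<bar>tanh (fld i \<sigma> + h i) - u i\<bar> \<le> \<beta> * (\<bar>Y \<sigma>\<bar> + 1) / real n + U\<^sup>2 / real n"
        using fld_deviation[OF \<sigma> i, of m] by (simp add: Y_def)
      also have "\<dots> = (\<beta> * \<bar>Y \<sigma>\<bar> + (\<beta> + U\<^sup>2)) / real n"
        by (simp add: distrib_left add_divide_distrib)
      \<comment> \<open>Here \<open>large\<close> trades \<open>\<beta> + U\<^sup>2\<close> for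
        \<open>sqrt n\<close>, and \<open>U\<close> disappears from the estimate.\<close>
      also have "\<dots> \<le> (\<beta> * \<bar>Y \<sigma>\<bar> + s) / real n"
        using large by (intro divide_right_mono) (auto simp: s_def)
      finally show "\<bar>tanh (fld i \<sigma> + h i) - u i\<bar> \<le> (\<beta> * \<bar>Y \<sigma>\<bar> + s) / real n" .
    qed
    then have "\<bar>\<Sum>i\<in>C. tanh (fld i \<sigma> + h i) - u i\<bar> \<le> real (card C) / real n * (\<beta> * \<bar>Y \<sigma>\<bar> + s)"
      by simp
    then have "(mag C \<sigma> - (\<Sum>i\<in>C. u i)) * (\<Sum>i\<in>C. tanh (fld i \<sigma> + h i) - u i) \<le>
       \<bar>mag C \<sigma> - (\<Sum>i\<in>C. u i)\<bar> * (real (card C) / real n * (\<beta> * \<bar>Y \<sigma>\<bar> + s))"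
      by (rule mult_le_abs_mult)
    moreover have "mag C \<sigma> - (\<Sum>i\<in>C. u i) = T C \<sigma> + (\<Sum>i\<in>C. tanh (fld i \<sigma> + h i) - u i)"
      by (simp add: T_def mag_def sum_subtractf)
    then have "(mag C \<sigma> - (\<Sum>i\<in>C. u i))\<^sup>2 = (mag C \<sigma> - (\<Sum>i\<in>C. u i)) * T C \<sigma> +
       (mag C \<sigma> - (\<Sum>i\<in>C. u i)) * (\<Sum>i\<in>C. tanh (fld i \<sigma> + h i) - u i)"
      unfolding power2_eq_square distrib_left[symmetric] by simp
    ultimately show ?thesis by linarith
  qed
  have fl: "ex h (\<lambda>\<sigma>. (mag C \<sigma> - (\<Sum>i\<in>C. u i)) * T C \<sigma>) \<le> 2 * real (card C)" if "C \<subseteq> I" for C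
    unfolding T_def by (rule fluctuation_bound[OF that])
  show A: ?A
  proof -
    define Q where "Q = ex h (\<lambda>\<sigma>. (Y \<sigma>)\<^sup>2)"
    have "Q \<le> ex h (\<lambda>\<sigma>. Y \<sigma> * T I \<sigma> + ((1 + \<beta>) / 2 * (Y \<sigma>)\<^sup>2 + real n / (2 * (1 - \<beta>))))"
      unfolding Q_def
    proof (rule ex_mono)
      fix \<sigma> assume \<sigma>: "\<sigma> \<in> \<Omega>"
      have "(Y \<sigma>)\<^sup>2 \<le> Y \<sigma> * T I \<sigma> + \<bar>Y \<sigma>\<bar> * (\<beta> * \<bar>Y \<sigma>\<bar> + s)"
        using pt[OF order_refl \<sigma>] n_pos by (simp add: Y_def m)
      moreover have "\<bar>Y \<sigma>\<bar> * s \<le> (1 - \<beta>) / 2 * (Y \<sigma>)\<^sup>2 + real n / (2 * (1 - \<beta>))"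
        using weighted_amgm[of "1 - \<beta>" "\<bar>Y \<sigma>\<bar>" s] beta_less by (simp add: s)
      moreover have "\<bar>Y \<sigma>\<bar> * (\<beta> * \<bar>Y \<sigma>\<bar> + s) = \<beta> * (Y \<sigma>)\<^sup>2 + \<bar>Y \<sigma>\<bar> * s"
        by (simp add: power2_eq_square algebra_simps)
      moreover have "(1 + \<beta>) / 2 * (Y \<sigma>)\<^sup>2 = \<beta> * (Y \<sigma>)\<^sup>2 + (1 - \<beta>) / 2 * (Y \<sigma>)\<^sup>2"
        by (simp add: field_simps)
      ultimately show "(Y \<sigma>)\<^sup>2 \<le> Y \<sigma> * T I \<sigma> + ((1 + \<beta>) / 2 * (Y \<sigma>)\<^sup>2 + real n / (2 * (1 - \<beta>)))"
        by linarith
    qed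
    also have "\<dots> = ex h (\<lambda>\<sigma>. Y \<sigma> * T I \<sigma>) + ((1 + \<beta>) / 2 * Q + real n / (2 * (1 - \<beta>)))"
      by (simp add: ex_add ex_cmult ex_divide Q_def)
    also have "\<dots> \<le> 2 * real n + ((1 + \<beta>) / 2 * Q + real n / (2 * (1 - \<beta>)))"
      using fl[of I] by (simp add: Y_def m)
    finally have "(1 - \<beta>) / 2 * Q \<le> (2 + 1 / (2 * (1 - \<beta>))) * real n"
      by (simp add: field_simps)
    then have "2 / (1 - \<beta>) * ((1 - \<beta>) / 2 * Q) \<le> 2 / (1 - \<beta>) * ((2 + 1 / (2 * (1 - \<beta>))) * real n)"
      using beta_less by (intro mult_left_mono) auto
    also have "\<dots> = M1 * real n"
    proof -
      have "2 / x * ((2 + 1 / (2 * x)) * y) = (4 + 1 / x) / x * y" if "x > 0" for x y :: real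
        using that by (simp add: field_simps)
      moreover have "1 - \<beta> > 0" using beta_less by simp
      ultimately show ?thesis unfolding M1_def by blast
    qed
    finally show ?thesis using beta_less by (simp add: Q_def Y_def)
  qed
  show ?B
  proof -
    define Z where "Z = (\<lambda>\<sigma>. mag C \<sigma> - (\<Sum>i\<in>C. u i))"
    define k where "k = real (card C)"
    define Q where "Q = ex h (\<lambda>\<sigma>. (Z \<sigma>)\<^sup>2)"
    have "Q \<le> ex h (\<lambda>\<sigma>. Z \<sigma> * T C \<sigma> + (1 / 2 * (Z \<sigma>)\<^sup>2 + ((k / real n)\<^sup>2 * (Y \<sigma>)\<^sup>2 + (k / real n)\<^sup>2 * real n)))"
      unfolding Q_def
    proof (rule ex_mono)
      fix \<sigma> assume \<sigma>: "\<sigma> \<in> \<Omega>"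
      have "(Z \<sigma>)\<^sup>2 \<le> Z \<sigma> * T C \<sigma> + \<bar>Z \<sigma>\<bar> * (k / real n * (\<beta> * \<bar>Y \<sigma>\<bar> + s))"
        using pt[OF C \<sigma>] by (simp add: Z_def k_def)
      also have "\<bar>Z \<sigma>\<bar> * (k / real n * (\<beta> * \<bar>Y \<sigma>\<bar> + s)) \<le> \<bar>Z \<sigma>\<bar> * (k / real n * (\<bar>Y \<sigma>\<bar> + s))"
        using beta_less beta_nonneg
        by (intro mult_left_mono add_right_mono) (auto simp: k_def mult_left_le_one_le)
      also have "\<bar>Z \<sigma>\<bar> * (k / real n * (\<bar>Y \<sigma>\<bar> + s)) \<le> 1 / 2 * (Z \<sigma>)\<^sup>2 + (k / real n * (\<bar>Y \<sigma>\<bar> + s))\<^sup>2 / 2"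
        using weighted_amgm[of 1 "\<bar>Z \<sigma>\<bar>" "k / real n * (\<bar>Y \<sigma>\<bar> + s)"] by simp
      also have "(k / real n * (\<bar>Y \<sigma>\<bar> + s))\<^sup>2 / 2 \<le> (k / real n)\<^sup>2 * ((Y \<sigma>)\<^sup>2 + real n)"
      proof -
        have "(\<bar>Y \<sigma>\<bar> + s)\<^sup>2 \<le> 2 * ((Y \<sigma>)\<^sup>2 + s\<^sup>2)"
          using sum_squares_bound[of "\<bar>Y \<sigma>\<bar>" s] by (simp add: power2_sum)
        then have "(k / real n)\<^sup>2 * (\<bar>Y \<sigma>\<bar> + s)\<^sup>2 \<le> (k / real n)\<^sup>2 * (2 * ((Y \<sigma>)\<^sup>2 + s\<^sup>2))"
          by (intro mult_left_mono) auto
        then show ?thesis unfolding power_mult_distrib s(2) by (simp add: algebra_simps)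
      qed
      finally show "(Z \<sigma>)\<^sup>2 \<le> Z \<sigma> * T C \<sigma> + (1 / 2 * (Z \<sigma>)\<^sup>2 + ((k / real n)\<^sup>2 * (Y \<sigma>)\<^sup>2 + (k / real n)\<^sup>2 * real n))"
        by (simp add: distrib_left)
    qed
    also have "\<dots> = ex h (\<lambda>\<sigma>. Z \<sigma> * T C \<sigma>) + (1 / 2 * Q + ((k / real n)\<^sup>2 * ex h (\<lambda>\<sigma>. (Y \<sigma>)\<^sup>2) + (k / real n)\<^sup>2 * real n))"
      unfolding Q_def by (simp add: ex_add ex_cmult ex_divide)
    also have "\<dots> \<le> 2 * k + (1 / 2 * Q + ((k / real n)\<^sup>2 * (M1 * real n) + (k / real n)\<^sup>2 * real n))"
      using fl[OF C] A by (intro add_mono mult_left_mono) (auto simp: Z_def k_def Y_def)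
    also have "\<dots> = 2 * k + 1 / 2 * Q + (M1 + 1) * ((k / real n)\<^sup>2 * real n)" by (simp add: algebra_simps)
    also have "\<dots> \<le> 2 * k + 1 / 2 * Q + (M1 + 1) * k"
      using card_ratio[OF C] M1_pos by (intro add_left_mono mult_left_mono) (auto simp: k_def)
    finally show ?thesis by (simp add: Q_def Z_def k_def M2_def algebra_simps)
  qed
qed

text \<open>The means may be of order 1 here, so the drift is compared with
  \<open>tanh (\<beta> * m t)\<close> itself and not with its linearization. For
  \<open>C = I\<close> the differential inequality for the mean square deviation is closed and has
  decay rate \<open>1 - \<beta>\<close>; its solution is then a bounded source in the inequality for
  a general class.\<close>

lemma dynamics_concentration:
  assumes \<xi>: "\<xi> \<in> \<Omega>"
    and m: "\<And>t. 0 \<le> t \<Longrightarrow> real n * m t = (\<Sum>i\<in>I. u t i)"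
    and u: "\<And>t i. 0 \<le> t \<Longrightarrow> i \<in> I \<Longrightarrow> ((\<lambda>t. u t i) has_real_derivative - u t i + tanh (\<beta> * m t)) (at t)"
    and u0: "\<And>i. i \<in> I \<Longrightarrow> u 0 i = real_of_int (\<xi> i)"
    and C: "C \<subseteq> I" and t: "0 \<le> t"
  shows "sg t (\<lambda>\<sigma>. (mag I \<sigma> - real n * m t)\<^sup>2) \<xi> \<le> M1 * real n" (is "?A t")
    and "sg t (\<lambda>\<sigma>. (mag C \<sigma> - (\<Sum>i\<in>C. u t i))\<^sup>2) \<xi> \<le> M2 * real (card C)" (is "?B")
proof -
  define Y where "Y = (\<lambda>t \<sigma>. mag I \<sigma> - real n * m t)"
  define Z where "Z = (\<lambda>C t \<sigma>. mag C \<sigma> - (\<Sum>i\<in>C. u t i))"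
  define F' where "F' = (\<lambda>C t \<sigma>. - 2 * Z C t \<sigma> * (\<Sum>i\<in>C. - u t i + tanh (\<beta> * m t)) + L (\<lambda>\<sigma>. (Z C t \<sigma>)\<^sup>2) \<sigma>)"
  have der: "((\<lambda>t. sg t (\<lambda>\<sigma>. (Z C t \<sigma>)\<^sup>2) \<xi>) has_real_derivative sg t (F' C t) \<xi>) (at t)"
    if C: "C \<subseteq> I" and t: "0 \<le> t" for C t
  proof -
    have "((\<lambda>t. sg t (\<lambda>\<sigma>. (Z C t \<sigma>)\<^sup>2) \<xi>) has_real_derivative
      sg t (\<lambda>\<sigma>. - 2 * Z C t \<sigma> * (\<Sum>i\<in>C. - u t i + tanh (\<beta> * m t)) + (\<Sum>\<tau>\<in>\<Omega>. G \<sigma> \<tau> * (Z C t \<tau>)\<^sup>2)) \<xi>) (at t)"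
    proof (rule sg_forward_deriv[OF t \<xi>])
      fix \<sigma>
      define D where "D = (\<Sum>i\<in>C. - u t i + tanh (\<beta> * m t))"
      have "((\<lambda>t. \<Sum>i\<in>C. u t i) has_real_derivative D) (at t)"
        unfolding D_def using C by (intro DERIV_sum u t) auto
      from DERIV_power[OF DERIV_diff[OF DERIV_const[of "mag C \<sigma>"] this], of 2]
      show "((\<lambda>t. (Z C t \<sigma>)\<^sup>2) has_real_derivative - 2 * Z C t \<sigma> * (\<Sum>i\<in>C. - u t i + tanh (\<beta> * m t))) (at t)"
        unfolding Z_def D_def[symmetric] by (simp add: algebra_simps)
    qed
    moreover have "sg t (\<lambda>\<sigma>. - 2 * Z C t \<sigma> * (\<Sum>i\<in>C. - u t i + tanh (\<beta> * m t)) + (\<Sum>\<tau>\<in>\<Omega>. G \<sigma> \<tau> * (Z C t \<tau>)\<^sup>2)) \<xi> =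
        sg t (F' C t) \<xi>"
      unfolding sg_def by (intro sum.cong refl) (simp add: F'_def generator_flip L_def)
    ultimately show ?thesis by simp
  qed
  have F'_le: "F' C t \<sigma> \<le> - 2 * (Z C t \<sigma>)\<^sup>2 + 2 * (\<bar>Z C t \<sigma>\<bar> * (real (card C) / real n * (\<beta> * \<bar>Y t \<sigma>\<bar> + 1))) + 4 * real (card C)"
    if C: "C \<subseteq> I" and t: "0 \<le> t" and \<sigma>: "\<sigma> \<in> \<Omega>" for C t \<sigma>
  proof -
    have fC: "finite C" using C finite_I finite_subset by blast
    define z where "z = Z C t \<sigma>"
    have "L (\<lambda>\<sigma>. (Z C t \<sigma>)\<^sup>2) \<sigma> = (\<Sum>i\<in>I. if i \<in> C then rt i \<sigma> * (4 - 4 * real_of_int (\<sigma> i) * z) else 0)"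
      unfolding L_def
    proof (rule sum.cong[OF refl])
      fix i assume i: "i \<in> I"
      have s: "real_of_int (\<sigma> i) * real_of_int (\<sigma> i) = 1"
        using spin_sq[OF \<sigma> i] by (simp add: power2_eq_square)
      have "(Z C t (flip i \<sigma>))\<^sup>2 - (Z C t \<sigma>)\<^sup>2 = 4 * (real_of_int (\<sigma> i) * real_of_int (\<sigma> i)) - 4 * real_of_int (\<sigma> i) * z" if "i \<in> C"
        using that fC by (simp add: Z_def z_def mag_flip power2_eq_square algebra_simps)
      moreover have "(Z C t (flip i \<sigma>))\<^sup>2 - (Z C t \<sigma>)\<^sup>2 = 0" if "i \<notin> C"
        using that by (simp add: Z_def mag_flip_outside)
      ultimately show "rt i \<sigma> * ((Z C t (flip i \<sigma>))\<^sup>2 - (Z C t \<sigma>)\<^sup>2) = (if i \<in> C then rt i \<sigma> * (4 - 4 * real_of_int (\<sigma> i) * z) else 0)"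
        unfolding s by auto
    qed
    also have "\<dots> = (\<Sum>i\<in>C. rt i \<sigma> * (4 - 4 * real_of_int (\<sigma> i) * z))"
      using C by (simp add: sum.inter_restrict[symmetric] Int_absorb1)
    also have "\<dots> = (\<Sum>i\<in>C. 2 * (1 - real_of_int (\<sigma> i) * tanh (fld i \<sigma>)) - 2 * z * (real_of_int (\<sigma> i) - tanh (fld i \<sigma>)))"
    proof (rule sum.cong[OF refl])
      fix i assume "i \<in> C"
      then have s: "real_of_int (\<sigma> i) * real_of_int (\<sigma> i) = 1"
        using spin_sq[OF \<sigma>, of i] C by (auto simp: power2_eq_square)
      have "rt i \<sigma> * (4 - 4 * real_of_int (\<sigma> i) * z) = 2 * (1 - real_of_int (\<sigma> i) * tanh (fld i \<sigma>)) -
          2 * z * (real_of_int (\<sigma> i) - (real_of_int (\<sigma> i) * real_of_int (\<sigma> i)) * tanh (fld i \<sigma>))"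
        by (simp add: rt_def field_simps)
      then show "rt i \<sigma> * (4 - 4 * real_of_int (\<sigma> i) * z) = 2 * (1 - real_of_int (\<sigma> i) * tanh (fld i \<sigma>)) -
          2 * z * (real_of_int (\<sigma> i) - tanh (fld i \<sigma>))" unfolding s by simp
    qed
    also have "\<dots> \<le> (\<Sum>i\<in>C. 4 - 2 * z * (real_of_int (\<sigma> i) - tanh (fld i \<sigma>)))"
    proof (intro sum_mono diff_right_mono)
      fix i assume "i \<in> C"
      then have i: "i \<in> I" using C by auto
      show "2 * (1 - real_of_int (\<sigma> i) * tanh (fld i \<sigma>)) \<le> 4"
        using abs_le_D2[OF spin_tanh_le[OF \<sigma> i, of "fld i \<sigma>"]] by simp
    qed
    also have "\<dots> = 4 * real (card C) - 2 * z * (\<Sum>i\<in>C. real_of_int (\<sigma> i) - tanh (fld i \<sigma>))"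
      by (subst sum_subtractf) (simp add: sum_distrib_left)
    finally have "F' C t \<sigma> \<le> - 2 * z * ((\<Sum>i\<in>C. - u t i + tanh (\<beta> * m t)) + (\<Sum>i\<in>C. real_of_int (\<sigma> i) - tanh (fld i \<sigma>))) + 4 * real (card C)"
      unfolding F'_def z_def[symmetric] by (simp add: distrib_left)
    \<comment> \<open>The drifts of the centre and of the spins combine to a restoring force
      \<open>z\<close>, up to the difference of \<open>tanh\<close> at the empirical and at the
      mean-field value of the field.\<close>
    also have "(\<Sum>i\<in>C. - u t i + tanh (\<beta> * m t)) + (\<Sum>i\<in>C. real_of_int (\<sigma> i) - tanh (fld i \<sigma>)) =
        z - (\<Sum>i\<in>C. tanh (fld i \<sigma>) - tanh (\<beta> * m t))"
      by (simp add: z_def Z_def mag_def sum_subtractf sum.distrib sum_negf)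
    also have "- 2 * z * (z - (\<Sum>i\<in>C. tanh (fld i \<sigma>) - tanh (\<beta> * m t))) + 4 * real (card C) =
        - 2 * z\<^sup>2 + 2 * (z * (\<Sum>i\<in>C. tanh (fld i \<sigma>) - tanh (\<beta> * m t))) + 4 * real (card C)"
      by (simp add: power2_eq_square algebra_simps)
    also have "z * (\<Sum>i\<in>C. tanh (fld i \<sigma>) - tanh (\<beta> * m t)) \<le> \<bar>z\<bar> * (real (card C) / real n * (\<beta> * \<bar>Y t \<sigma>\<bar> + 1))"
    proof -
      have "\<bar>\<Sum>i\<in>C. tanh (fld i \<sigma>) - tanh (\<beta> * m t)\<bar> \<le> (\<Sum>i\<in>C. (\<beta> * \<bar>Y t \<sigma>\<bar> + 1) / real n)"
      proof (rule order_trans[OF sum_abs sum_mono])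
        fix i assume "i \<in> C"
        then have i: "i \<in> I" using C by auto
        have "\<bar>tanh (fld i \<sigma>) - tanh (\<beta> * m t)\<bar> \<le> \<beta> * (\<bar>Y t \<sigma>\<bar> + 1) / real n"
          using tanh_diff_le[of "fld i \<sigma>" "\<beta> * m t"] fld_deviation[OF \<sigma> i, of "m t"] by (simp add: Y_def)
        also have "\<dots> \<le> (\<beta> * \<bar>Y t \<sigma>\<bar> + 1) / real n"
          using beta_less by (intro divide_right_mono) (auto simp: distrib_left)
        finally show "\<bar>tanh (fld i \<sigma>) - tanh (\<beta> * m t)\<bar> \<le> (\<beta> * \<bar>Y t \<sigma>\<bar> + 1) / real n" .
      qed
      then have "\<bar>\<Sum>i\<in>C. tanh (fld i \<sigma>) - tanh (\<beta> * m t)\<bar> \<le> real (card C) / real n * (\<beta> * \<bar>Y t \<sigma>\<bar> + 1)"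
        by simp
      then show ?thesis by (rule mult_le_abs_mult)
    qed
    finally show ?thesis by (simp add: z_def)
  qed
  have Z0: "sg 0 (\<lambda>\<sigma>. (Z C 0 \<sigma>)\<^sup>2) \<xi> = 0" if "C \<subseteq> I" for C
    using that \<xi> u0 by (subst sg_0[OF \<xi>]) (simp add: Z_def mag_def subset_iff)
  have ZI: "Z I t \<sigma> = Y t \<sigma>" if "0 \<le> t" for t \<sigma> using m[OF that] by (simp add: Z_def Y_def)
  have A: "?A t" if t: "0 \<le> t" for t
  proof -
    define \<phi> where "\<phi> = (\<lambda>t. sg t (\<lambda>\<sigma>. (Z I t \<sigma>)\<^sup>2) \<xi>)"
    define b where "b = 1 / (1 - \<beta>) + 4 * real n"
    have "\<phi> t \<le> b / (1 - \<beta>) + exp (- (1 - \<beta>) * t) * (\<phi> 0 - b / (1 - \<beta>))"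
    proof (rule gronwall_linear[OF _ t])
      fix s :: real assume s: "0 \<le> s"
      show "(\<phi> has_real_derivative sg s (F' I s) \<xi>) (at s)"
        unfolding \<phi>_def by (rule der[OF order_refl s])
      have "sg s (F' I s) \<xi> \<le> sg s (\<lambda>\<sigma>. - (1 - \<beta>) * (Z I s \<sigma>)\<^sup>2 + b) \<xi>"
      proof (rule sg_mono[OF s \<xi>])
        fix \<sigma> assume \<sigma>: "\<sigma> \<in> \<Omega>"
        have "F' I s \<sigma> \<le> - 2 * (Y s \<sigma>)\<^sup>2 + 2 * (\<bar>Y s \<sigma>\<bar> * (\<beta> * \<bar>Y s \<sigma>\<bar> + 1)) + 4 * real n"
          using F'_le[OF order_refl s \<sigma>] n_pos by (simp add: ZI[OF s])
        moreover have "\<bar>Y s \<sigma>\<bar> * 1 \<le> (1 - \<beta>) / 2 * (Y s \<sigma>)\<^sup>2 + 1 / (2 * (1 - \<beta>))"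
          using weighted_amgm[of "1 - \<beta>" "\<bar>Y s \<sigma>\<bar>" 1] beta_less by simp
        moreover have "\<bar>Y s \<sigma>\<bar> * (\<beta> * \<bar>Y s \<sigma>\<bar> + 1) = \<beta> * (Y s \<sigma>)\<^sup>2 + \<bar>Y s \<sigma>\<bar> * 1"
          by (simp add: power2_eq_square algebra_simps)
        moreover have "- (1 - \<beta>) * (Y s \<sigma>)\<^sup>2 = - 2 * (Y s \<sigma>)\<^sup>2 + 2 * (\<beta> * (Y s \<sigma>)\<^sup>2) + 2 * ((1 - \<beta>) / 2 * (Y s \<sigma>)\<^sup>2)"
          by (simp add: field_simps)
        moreover have "b = 2 * (1 / (2 * (1 - \<beta>))) + 4 * real n"
        proof -
          have "2 * (1 / (2 * x)) = 1 / x" for x :: real by simp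
          then show ?thesis unfolding b_def by (simp only:)
        qed
        ultimately show "F' I s \<sigma> \<le> - (1 - \<beta>) * (Z I s \<sigma>)\<^sup>2 + b"
          unfolding ZI[OF s] by linarith
      qed
      also have "\<dots> = - (1 - \<beta>) * \<phi> s + b"
      proof -
        have "sg s (\<lambda>\<sigma>. c * f \<sigma> + b) \<xi> = c * sg s f \<xi> + b" for c f
          unfolding sg_add sg_cmult sg_const[OF s \<xi>] ..
        then show ?thesis by (simp add: \<phi>_def)
      qed
      finally show "sg s (F' I s) \<xi> \<le> - (1 - \<beta>) * \<phi> s + b" .
    qed (use beta_less in auto)
    also have "\<dots> \<le> b / (1 - \<beta>)"
      using Z0[of I] beta_less by (simp add: \<phi>_def b_def mult_le_0_iff)
    also have "\<dots> \<le> M1 * real n"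
    proof -
      have "1 / (1 - \<beta>) * 1 \<le> 1 / (1 - \<beta>) * real n"
        using beta_less n_pos by (intro mult_left_mono) auto
      then have "b \<le> (4 + 1 / (1 - \<beta>)) * real n" by (simp add: b_def algebra_simps)
      then have "b / (1 - \<beta>) \<le> (4 + 1 / (1 - \<beta>)) * real n / (1 - \<beta>)"
        using beta_less by (intro divide_right_mono) auto
      then show ?thesis by (simp add: M1_def)
    qed
    finally show ?thesis using ZI[OF t] by (simp add: \<phi>_def Y_def)
  qed
  show "?A t" by (rule A[OF t])
  show ?B
  proof -
    define k where "k = real (card C)"
    define \<phi> where "\<phi> = (\<lambda>t. sg t (\<lambda>\<sigma>. (Z C t \<sigma>)\<^sup>2) \<xi>)"
    \<comment> \<open>Of the decay rate 2 of the squared class deviation one half is spent on the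
      mixed term, so Gronwall is applied with rate 1.\<close>
    have "\<phi> t \<le> M2 * k / 1 + exp (- 1 * t) * (\<phi> 0 - M2 * k / 1)"
    proof (rule gronwall_linear[OF _ t])
      fix s :: real assume s: "0 \<le> s"
      show "(\<phi> has_real_derivative sg s (F' C s) \<xi>) (at s)"
        unfolding \<phi>_def by (rule der[OF C s])
      have "sg s (F' C s) \<xi> \<le> sg s (\<lambda>\<sigma>. - 1 * (Z C s \<sigma>)\<^sup>2 + (k / real n)\<^sup>2 * (2 * (Y s \<sigma>)\<^sup>2) + (2 * (k / real n)\<^sup>2 + 4 * k)) \<xi>"
      proof (rule sg_mono[OF s \<xi>])
        fix \<sigma> assume \<sigma>: "\<sigma> \<in> \<Omega>"
        have "F' C s \<sigma> \<le> - 2 * (Z C s \<sigma>)\<^sup>2 + 2 * (\<bar>Z C s \<sigma>\<bar> * (k / real n * (\<beta> * \<bar>Y s \<sigma>\<bar> + 1))) + 4 * k"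
          using F'_le[OF C s \<sigma>] by (simp add: k_def)
        also have "\<bar>Z C s \<sigma>\<bar> * (k / real n * (\<beta> * \<bar>Y s \<sigma>\<bar> + 1)) \<le> \<bar>Z C s \<sigma>\<bar> * (k / real n * (\<bar>Y s \<sigma>\<bar> + 1))"
          using beta_less beta_nonneg
          by (intro mult_left_mono add_right_mono) (auto simp: k_def mult_left_le_one_le)
        also have "\<bar>Z C s \<sigma>\<bar> * (k / real n * (\<bar>Y s \<sigma>\<bar> + 1)) \<le> 1 / 2 * (Z C s \<sigma>)\<^sup>2 + (k / real n * (\<bar>Y s \<sigma>\<bar> + 1))\<^sup>2 / 2"
          using weighted_amgm[of 1 "\<bar>Z C s \<sigma>\<bar>" "k / real n * (\<bar>Y s \<sigma>\<bar> + 1)"] by simp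
        also have "(k / real n * (\<bar>Y s \<sigma>\<bar> + 1))\<^sup>2 / 2 \<le> (k / real n)\<^sup>2 * ((Y s \<sigma>)\<^sup>2 + 1)"
        proof -
          have "(\<bar>Y s \<sigma>\<bar> + 1)\<^sup>2 \<le> 2 * ((Y s \<sigma>)\<^sup>2 + 1)"
            using sum_squares_bound[of "\<bar>Y s \<sigma>\<bar>" 1] by (simp add: power2_sum)
          then have "(k / real n)\<^sup>2 * (\<bar>Y s \<sigma>\<bar> + 1)\<^sup>2 \<le> (k / real n)\<^sup>2 * (2 * ((Y s \<sigma>)\<^sup>2 + 1))"
            by (intro mult_left_mono) auto
          then show ?thesis unfolding power_mult_distrib by (simp add: algebra_simps)
        qed
        finally show "F' C s \<sigma> \<le> - 1 * (Z C s \<sigma>)\<^sup>2 + (k / real n)\<^sup>2 * (2 * (Y s \<sigma>)\<^sup>2) + (2 * (k / real n)\<^sup>2 + 4 * k)"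
          by (simp add: algebra_simps)
      qed
      also have "\<dots> = - 1 * \<phi> s + 2 * (k / real n)\<^sup>2 * sg s (\<lambda>\<sigma>. (Y s \<sigma>)\<^sup>2) \<xi> + (2 * (k / real n)\<^sup>2 + 4 * k)"
      proof -
        have "sg s (\<lambda>\<sigma>. - 1 * f \<sigma> + c * (2 * g \<sigma>) + b) \<xi> = - 1 * sg s f \<xi> + 2 * c * sg s g \<xi> + b" for b c f g
          unfolding sg_add sg_cmult sg_const[OF s \<xi>] by simp
        then show ?thesis by (simp add: \<phi>_def)
      qed
      also have "\<dots> \<le> - 1 * \<phi> s + 2 * (k / real n)\<^sup>2 * (M1 * real n) + (2 * k + 4 * k)"
      proof -
        have "sg s (\<lambda>\<sigma>. (Y s \<sigma>)\<^sup>2) \<xi> \<le> M1 * real n" unfolding Y_def by (rule A[OF s])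
        then have "2 * (k / real n)\<^sup>2 * sg s (\<lambda>\<sigma>. (Y s \<sigma>)\<^sup>2) \<xi> \<le> 2 * (k / real n)\<^sup>2 * (M1 * real n)"
          by (rule mult_left_mono) simp
        moreover have "(k / real n)\<^sup>2 * 1 \<le> (k / real n)\<^sup>2 * real n" using n_pos by (intro mult_left_mono) auto
        then have "2 * (k / real n)\<^sup>2 \<le> 2 * k" using card_ratio[OF C] by (simp add: k_def)
        ultimately show ?thesis by linarith
      qed
      also have "\<dots> = - 1 * \<phi> s + 2 * M1 * ((k / real n)\<^sup>2 * real n) + 6 * k" by simp
      also have "\<dots> \<le> - 1 * \<phi> s + 2 * M1 * k + 6 * k"
        using card_ratio[OF C] M1_pos by (intro add_right_mono add_left_mono mult_left_mono) (auto simp: k_def)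
      finally show "sg s (F' C s) \<xi> \<le> - 1 * \<phi> s + M2 * k" by (simp add: M2_def algebra_simps)
    qed auto
    also have "\<dots> \<le> M2 * k"
      using Z0[OF C] M2_pos by (simp add: \<phi>_def k_def)
    finally show ?thesis by (simp add: \<phi>_def Z_def k_def)
  qed
qed

end

section \<open>Symmetry of the semigroup\<close>

context curie_weiss
begin

definition sw :: "nat \<Rightarrow> nat \<Rightarrow> (nat \<Rightarrow> int) \<Rightarrow> nat \<Rightarrow> int" where
  "sw i j \<sigma> = \<sigma>(i := \<sigma> j, j := \<sigma> i)"

lemma sw_sw [simp]: "sw i j (sw i j \<sigma>) = \<sigma>"
  by (auto simp: sw_def fun_eq_iff)

lemma sw_in: "i \<in> I \<Longrightarrow> j \<in> I \<Longrightarrow> \<sigma> \<in> \<Omega> \<Longrightarrow> sw i j \<sigma> \<in> \<Omega>"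
  unfolding spin_configs_def I_def by (auto simp: sw_def PiE_iff extensional_def)

definition tr :: "nat \<Rightarrow> nat \<Rightarrow> nat \<Rightarrow> nat" where
  "tr i j k = (if k = i then j else if k = j then i else k)"

lemma tr_tr [simp]: "tr i j (tr i j k) = k"
  by (simp add: tr_def)

lemma tr_in: "(i \<in> C \<longleftrightarrow> j \<in> C) \<Longrightarrow> k \<in> C \<Longrightarrow> tr i j k \<in> C"
  by (metis tr_def)

lemma sw_tr: "sw i j \<sigma> k = \<sigma> (tr i j k)"
  by (simp add: sw_def tr_def)

lemma sum_tr:
  fixes F :: "nat \<Rightarrow> real"
  assumes "i \<in> C \<longleftrightarrow> j \<in> C"
  shows "(\<Sum>k\<in>C. F (tr i j k)) = (\<Sum>k\<in>C. F k)"
  by (rule sum.reindex_bij_witness[where i = "tr i j" and j = "tr i j"]) (simp_all add: tr_in[OF assms])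

lemma mag_sw: "(i \<in> C \<longleftrightarrow> j \<in> C) \<Longrightarrow> mag C (sw i j \<sigma>) = mag C \<sigma>"
  unfolding mag_def sw_tr by (rule sum_tr)

lemma flip_sw: "flip k (sw i j \<sigma>) = sw i j (flip (tr i j k) \<sigma>)"
  by (auto simp: flip_def sw_def tr_def fun_eq_iff)

lemma rt_sw: "i \<in> I \<Longrightarrow> j \<in> I \<Longrightarrow> rt k (sw i j \<sigma>) = rt (tr i j k) \<sigma>"
  unfolding rt_def fld_def by (simp add: mag_sw sw_tr)

lemma L_sw:
  assumes "i \<in> I" "j \<in> I"
  shows "L f (sw i j \<sigma>) = L (\<lambda>\<sigma>. f (sw i j \<sigma>)) \<sigma>"
  unfolding L_def rt_sw[OF assms] flip_sw
  using sum_tr[of i I j "\<lambda>k. rt k \<sigma> * (f (sw i j (flip k \<sigma>)) - f (sw i j \<sigma>))"] assms by simp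

text \<open>The rate at a site depends only on its spin and on the total magnetization, so
  exchanging sites commutes with \<open>L\<close>, and by uniqueness with the semigroup.\<close>

lemma sg_sw:
  assumes ij: "i \<in> I" "j \<in> I" and t: "0 \<le> t" and \<sigma>: "\<sigma> \<in> \<Omega>"
  shows "sg t f (sw i j \<sigma>) = sg t (\<lambda>\<sigma>. f (sw i j \<sigma>)) \<sigma>"
proof (rule sg_unique[where u = "\<lambda>t \<sigma>. sg t f (sw i j \<sigma>)", OF _ _ t \<sigma>])
  fix t \<sigma> assume \<sigma>: "\<sigma> \<in> \<Omega>"
  have "((\<lambda>t. sg t f (sw i j \<sigma>)) has_real_derivative L (sg t f) (sw i j \<sigma>)) (at t)"
    by (intro sg_deriv_L sw_in ij \<sigma>)
  then show "((\<lambda>t. sg t f (sw i j \<sigma>)) has_real_derivative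
      (\<Sum>\<tau>\<in>\<Omega>. G \<sigma> \<tau> * sg t f (sw i j \<tau>))) (at t)"
    unfolding generator_flip[OF \<sigma>] L_sw[OF ij] by (simp add: L_def)
qed (auto intro!: sg_0 sw_in ij)

text \<open>Apply \<open>sg_sw\<close> to the indicator of one configuration. The law from a start
  that the swap fixes is itself invariant, and so is the set on which it exceeds an invariant
  measure.\<close>

lemma H_sw:
  assumes ij: "i \<in> I" "j \<in> I" and t: "0 \<le> t" and \<sigma>: "\<sigma> \<in> \<Omega>" "\<tau> \<in> \<Omega>" and inv: "sw i j \<sigma> = \<sigma>"
  shows "H t \<sigma> (sw i j \<tau>) = H t \<sigma> \<tau>"
proof -
  have H: "H t \<sigma> \<tau> = sg t (\<lambda>z. if z = \<tau> then 1 else 0) \<sigma>" if "\<tau> \<in> \<Omega>" for \<tau>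
    using that by (simp add: sg_def if_distrib[of "\<lambda>u. _ * u"] cong: if_cong)
  have "(\<lambda>z. if sw i j z = \<tau> then 1 else 0) = (\<lambda>z. if z = sw i j \<tau> then 1 else (0::real))"
    by (metis sw_sw)
  then show ?thesis
    using sg_sw[OF ij t \<sigma>(1), of "\<lambda>z. if z = \<tau> then 1 else 0"] inv
    by (simp add: H \<sigma> sw_in ij)
qed

section \<open>Swap-invariant functions are Lipschitz in the two class magnetizations\<close>

definition cls :: "(nat \<Rightarrow> int) \<Rightarrow> int \<Rightarrow> nat set" where
  "cls \<xi> c = {i\<in>I. \<xi> i = c}"

lemma cls_subset: "cls \<xi> c \<subseteq> I" and finite_cls [simp]: "finite (cls \<xi> c)"
  by (auto simp: cls_def)

definition swap_invariant :: "(nat \<Rightarrow> int) \<Rightarrow> ((nat \<Rightarrow> int) \<Rightarrow> real) \<Rightarrow> bool" where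
  "swap_invariant \<xi> g \<longleftrightarrow> (\<forall>i\<in>I. \<forall>j\<in>I. \<xi> i = \<xi> j \<longrightarrow> (\<forall>\<sigma>\<in>\<Omega>. g (sw i j \<sigma>) = g \<sigma>))"

lemma swap_invariantD:
  "swap_invariant \<xi> g \<Longrightarrow> i \<in> I \<Longrightarrow> j \<in> I \<Longrightarrow> \<xi> i = \<xi> j \<Longrightarrow> \<sigma> \<in> \<Omega> \<Longrightarrow> g (sw i j \<sigma>) = g \<sigma>"
  by (auto simp: swap_invariant_def)

text \<open>All flips of equal spins in the same class change \<open>g\<close> by the same amount, so that a single
  difference is at most the gradient divided by the square root of their number.\<close>

lemma one_flip_bound:
  assumes inv: "swap_invariant \<xi> g" and e: "\<And>\<sigma>. \<sigma> \<in> \<Omega> \<Longrightarrow> grad2 g \<sigma> \<le> e\<^sup>2" and e0: "0 \<le> e"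
    and \<sigma>: "\<sigma> \<in> \<Omega>" and i: "i \<in> cls \<xi> c"
  shows "\<bar>g (flip i \<sigma>) - g \<sigma>\<bar> \<le> e * sqrt (2 / real (card (cls \<xi> c)))"
proof -
  define C where "C = cls \<xi> c"
  define d where "d = g (flip i \<sigma>) - g \<sigma>"
  define P where "P = (\<lambda>\<sigma> :: nat \<Rightarrow> int. {j\<in>C. \<sigma> j = \<sigma> i})"
  have iI: "i \<in> I" using i by (simp add: cls_def)
  have fC: "finite C" by (simp add: C_def)
  have *: "real (card (P \<sigma>)) * (g (flip i \<sigma>) - g \<sigma>)\<^sup>2 \<le> e\<^sup>2" if \<sigma>: "\<sigma> \<in> \<Omega>" for \<sigma> :: "nat \<Rightarrow> int"
  proof -
    have "g (flip j \<sigma>) = g (flip i \<sigma>)" if j: "j \<in> P \<sigma>" for j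
    proof -
      have jI: "j \<in> I" "\<xi> i = \<xi> j" "\<sigma> j = \<sigma> i" using j i by (auto simp: P_def C_def cls_def)
      have "flip j \<sigma> = sw i j (flip i \<sigma>)"
        using jI(3) by (auto simp: flip_def sw_def fun_eq_iff)
      then show ?thesis using swap_invariantD[OF inv iI jI(1,2) flip_in[OF \<sigma> iI]] by simp
    qed
    then have "real (card (P \<sigma>)) * (g (flip i \<sigma>) - g \<sigma>)\<^sup>2 = (\<Sum>j\<in>P \<sigma>. (g (flip j \<sigma>) - g \<sigma>)\<^sup>2)"
      by simp
    also have "\<dots> \<le> grad2 g \<sigma>"
      unfolding grad2_def by (rule sum_mono2) (auto simp: P_def C_def cls_def)
    finally show ?thesis using e[OF \<sigma>] by simp
  qed
  \<comment> \<open>Few sites may share the spin of \<open>i\<close> in \<open>\<sigma>\<close>, but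
    after the flip the remaining sites of the class do. Using the gradient at both configurations
    covers the class and explains the factor 2.\<close>
  have "C \<subseteq> P \<sigma> \<union> P (flip i \<sigma>)"
  proof
    fix j assume j: "j \<in> C"
    then have jI: "j \<in> I" by (simp add: C_def cls_def)
    have "\<sigma> j = \<sigma> i \<or> flip i \<sigma> j = flip i \<sigma> i"
    proof (cases "j = i")
      case False
      then show ?thesis by (rule_tac spin_cases[OF \<sigma> iI]; rule_tac spin_cases[OF \<sigma> jI]; simp)
    qed simp
    then show "j \<in> P \<sigma> \<union> P (flip i \<sigma>)" using j by (auto simp: P_def)
  qed
  then have "card C \<le> card (P \<sigma> \<union> P (flip i \<sigma>))"
    by (intro card_mono) (auto simp: P_def fC)
  also have "\<dots> \<le> card (P \<sigma>) + card (P (flip i \<sigma>))" by (rule card_Un_le)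
  finally have "real (card C) \<le> real (card (P \<sigma>)) + real (card (P (flip i \<sigma>)))" by linarith
  then have "real (card C) * d\<^sup>2 \<le> real (card (P \<sigma>)) * d\<^sup>2 + real (card (P (flip i \<sigma>))) * d\<^sup>2"
    unfolding distrib_right[symmetric] by (intro mult_right_mono) auto
  also have "\<dots> \<le> e\<^sup>2 + e\<^sup>2"
    using *[OF \<sigma>] *[OF flip_in[OF \<sigma> iI]] by (intro add_mono) (auto simp: d_def power2_commute)
  finally have "real (card C) * d\<^sup>2 \<le> 2 * e\<^sup>2" by simp
  moreover have c0: "real (card C) > 0" using i fC by (auto simp: C_def card_gt_0_iff)
  ultimately have "d\<^sup>2 \<le> e\<^sup>2 * (2 / real (card C))" by (simp add: field_simps)
  then have "\<bar>d\<bar> \<le> sqrt (e\<^sup>2 * (2 / real (card C)))" by (metis real_sqrt_abs real_sqrt_le_iff)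
  then show ?thesis using e0 by (simp only: real_sqrt_mult real_sqrt_abs abs_of_nonneg d_def C_def)
qed

text \<open>Half of the bound for one flip, because a flip moves the magnetization by 2. For an
  empty class the value is 0, by the convention for division by 0.\<close>

definition lip :: "(nat \<Rightarrow> int) \<Rightarrow> int \<Rightarrow> real" where
  "lip \<xi> c = sqrt (2 / real (card (cls \<xi> c))) / 2"

text \<open>Induction on the number of disagreements. If two disagreements in one class have
  opposite spins, a swap reduces the number without changing \<open>g\<close> or the magnetizations.
  Otherwise all disagreements in the class point the same way, and flipping one brings its
  magnetization closer by 2, which matches the cost of the flip.\<close>

lemma swap_invariant_lipschitz:
  assumes inv: "swap_invariant \<xi> g" and e: "\<And>\<sigma>. \<sigma> \<in> \<Omega> \<Longrightarrow> grad2 g \<sigma> \<le> e\<^sup>2" and e0: "0 \<le> e"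
    and \<xi>: "\<xi> \<in> \<Omega>" and \<sigma>: "\<sigma> \<in> \<Omega>" and \<tau>: "\<tau> \<in> \<Omega>"
  shows "\<bar>g \<sigma> - g \<tau>\<bar> \<le> e * (\<Sum>c\<in>{-1, 1}. lip \<xi> c * \<bar>mag (cls \<xi> c) \<sigma> - mag (cls \<xi> c) \<tau>\<bar>)"
  using \<sigma>
proof (induction "card {i\<in>I. \<sigma> i \<noteq> \<tau> i}" arbitrary: \<sigma> rule: less_induct)
  case less
  define D where "D = (\<lambda>\<sigma>. {i\<in>I. \<sigma> i \<noteq> \<tau> i})"
  have fD: "finite (D \<sigma>)" for \<sigma> by (simp add: D_def)
  note \<sigma> = less.prems
  have opp: "\<tau> i = - \<sigma> i" if "i \<in> D \<sigma>" for i
  proof -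
    have i: "i \<in> I" "\<sigma> i \<noteq> \<tau> i" using that by (auto simp: D_def)
    show ?thesis
      by (rule spin_cases[OF \<sigma> i(1)]; rule spin_cases[OF \<tau> i(1)]; use i(2) in simp)
  qed
  show ?case
  proof (cases "D \<sigma> = {}")
    case True
    have "\<sigma> i = \<tau> i" for i
      using True \<sigma> \<tau> by (cases "i \<in> I") (auto simp: D_def spin_configs_def I_def PiE_iff extensional_def)
    then have "\<sigma> = \<tau>" by auto
    then show ?thesis by simp
  next
    case False
    then obtain i where i: "i \<in> D \<sigma>" by auto
    then have iI: "i \<in> I" by (simp add: D_def)
    define C where "C = cls \<xi> (\<xi> i)"
    have iC: "i \<in> C" using iI by (simp add: C_def cls_def)
    show ?thesis
    proof (cases "\<exists>j\<in>C \<inter> D \<sigma>. \<sigma> j \<noteq> \<sigma> i")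
      case True
      then obtain j where j: "j \<in> C" "j \<in> D \<sigma>" "\<sigma> j \<noteq> \<sigma> i" by auto
      have jI: "j \<in> I" "\<xi> j = \<xi> i" using j(1) by (auto simp: C_def cls_def)
      have sj: "\<sigma> j = - \<sigma> i"
        by (rule spin_cases[OF \<sigma> iI]; rule spin_cases[OF \<sigma> jI(1)]; use j(3) in simp)
      have "i \<noteq> j" using j(3) by auto
      then have "sw i j \<sigma> i = \<tau> i" "sw i j \<sigma> j = \<tau> j"
        unfolding opp[OF i] opp[OF j(2)] by (simp_all add: sw_def sj)
      moreover have "sw i j \<sigma> k = \<sigma> k" if "k \<noteq> i" "k \<noteq> j" for k using that by (simp add: sw_def)
      ultimately have "k \<in> D \<sigma> \<and> k \<noteq> i" if "k \<in> D (sw i j \<sigma>)" for k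
        using that unfolding D_def by (cases "k = i"; cases "k = j") simp_all
      with i have "D (sw i j \<sigma>) \<subset> D \<sigma>" by blast
      then have "card (D (sw i j \<sigma>)) < card (D \<sigma>)" by (rule psubset_card_mono[OF fD])
      from less.hyps[OF this[unfolded D_def] sw_in[OF iI jI(1) \<sigma>]]
      show ?thesis
        using swap_invariantD[OF inv iI jI(1) _ \<sigma>] jI iI
        by (simp add: mag_sw cls_def)
    next
      case False
      then have eq: "\<sigma> j = \<sigma> i" if "j \<in> C \<inter> D \<sigma>" for j using that by auto
      have "k \<in> D \<sigma> \<and> k \<noteq> i" if "k \<in> D (flip i \<sigma>)" for k
        using that opp[OF i] unfolding D_def by (cases "k = i") simp_all
      with i have "D (flip i \<sigma>) \<subset> D \<sigma>" by blast
      then have "card (D (flip i \<sigma>)) < card (D \<sigma>)" by (rule psubset_card_mono[OF fD])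
      from less.hyps[OF this[unfolded D_def] flip_in[OF \<sigma> iI]]
      have IH: "\<bar>g (flip i \<sigma>) - g \<tau>\<bar> \<le> e * (\<Sum>c\<in>{-1, 1}. lip \<xi> c * \<bar>mag (cls \<xi> c) (flip i \<sigma>) - mag (cls \<xi> c) \<tau>\<bar>)" .
      have one: "\<bar>g (flip i \<sigma>) - g \<sigma>\<bar> \<le> e * (2 * lip \<xi> (\<xi> i))"
        using one_flip_bound[OF inv e e0 \<sigma> iC[unfolded C_def]] by (simp add: lip_def)
      have fC: "finite C" by (simp add: C_def)
      have "mag C \<sigma> - mag C \<tau> = (\<Sum>j\<in>C. if j \<in> D \<sigma> then 2 * real_of_int (\<sigma> i) else 0)"
        unfolding mag_def sum_subtractf[symmetric]
      proof (rule sum.cong[OF refl])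
        fix j assume "j \<in> C"
        then have jI: "j \<in> I" by (simp add: C_def cls_def)
        show "real_of_int (\<sigma> j) - real_of_int (\<tau> j) = (if j \<in> D \<sigma> then 2 * real_of_int (\<sigma> i) else 0)"
          using opp[of j] eq[of j] \<open>j \<in> C\<close> jI by (auto simp: D_def)
      qed
      also have "\<dots> = 2 * real_of_int (\<sigma> i) * real (card (C \<inter> D \<sigma>))"
        using fC by (simp add: sum.inter_restrict[symmetric] mult.commute)
      finally have m: "mag C \<sigma> - mag C \<tau> = 2 * real_of_int (\<sigma> i) * real (card (C \<inter> D \<sigma>))" .
      have k: "real (card (C \<inter> D \<sigma>)) \<ge> 1"
        using i iC fC by (simp add: Suc_le_eq card_gt_0_iff) blast
      have "mag C (flip i \<sigma>) - mag C \<tau> = 2 * real_of_int (\<sigma> i) * (real (card (C \<inter> D \<sigma>)) - 1)"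
        using m mag_flip[OF fC iC, of \<sigma>] by (simp add: algebra_simps)
      then have mC: "\<bar>mag C (flip i \<sigma>) - mag C \<tau>\<bar> = \<bar>mag C \<sigma> - mag C \<tau>\<bar> - 2"
        using m k spin_abs[OF \<sigma> iI] by (simp add: abs_mult)
      have mo: "mag (cls \<xi> c) (flip i \<sigma>) = mag (cls \<xi> c) \<sigma>" if "c \<noteq> \<xi> i" for c
        using that by (intro mag_flip_outside) (auto simp: cls_def)
      have "(\<Sum>c\<in>{-1, 1}. lip \<xi> c * \<bar>mag (cls \<xi> c) (flip i \<sigma>) - mag (cls \<xi> c) \<tau>\<bar>) =
         (\<Sum>c\<in>{-1, 1}. lip \<xi> c * \<bar>mag (cls \<xi> c) \<sigma> - mag (cls \<xi> c) \<tau>\<bar>) - 2 * lip \<xi> (\<xi> i)"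
      proof -
        have mC': "lip \<xi> (\<xi> i) * \<bar>mag (cls \<xi> (\<xi> i)) (flip i \<sigma>) - mag (cls \<xi> (\<xi> i)) \<tau>\<bar> =
            lip \<xi> (\<xi> i) * \<bar>mag (cls \<xi> (\<xi> i)) \<sigma> - mag (cls \<xi> (\<xi> i)) \<tau>\<bar> - 2 * lip \<xi> (\<xi> i)"
          unfolding mC[unfolded C_def] by (simp add: algebra_simps)
        show ?thesis
          by (rule spin_cases[OF \<xi> iI]; use mC' mo[of 1] mo[of "-1"] in simp)
      qed
      then have "e * (\<Sum>c\<in>{-1, 1}. lip \<xi> c * \<bar>mag (cls \<xi> c) (flip i \<sigma>) - mag (cls \<xi> c) \<tau>\<bar>) =
         e * (\<Sum>c\<in>{-1, 1}. lip \<xi> c * \<bar>mag (cls \<xi> c) \<sigma> - mag (cls \<xi> c) \<tau>\<bar>) - e * (2 * lip \<xi> (\<xi> i))"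
        by (simp only: right_diff_distrib)
      then show ?thesis using IH one by linarith
    qed
  qed
qed

end

section \<open>Tilted measures under the dynamics\<close>

text \<open>Interpolate by \<open>\<phi> s\<close>, the integral of \<open>sg (K - s) g\<close>
  against \<open>\<nu> s\<close>. Its derivative is the residual of the forward equation tested
  against a function bounded by 1.\<close>

lemma (in finite_chain) duhamel:
  assumes K: "0 \<le> K"
    and der: "\<And>s x. 0 \<le> s \<Longrightarrow> s \<le> K \<Longrightarrow> x \<in> S \<Longrightarrow> ((\<lambda>s. \<nu> s x) has_real_derivative \<nu>' s x) (at s)"
    and res: "\<And>s. 0 \<le> s \<Longrightarrow> s \<le> K \<Longrightarrow> (\<Sum>x\<in>S. \<bar>\<nu>' s x - (\<Sum>y\<in>S. \<nu> s y * G y x)\<bar>) \<le> \<delta>"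
    and g: "\<And>x. x \<in> S \<Longrightarrow> \<bar>g x\<bar> \<le> 1"
  shows "\<bar>(\<Sum>x\<in>S. \<nu> K x * g x) - (\<Sum>x\<in>S. \<nu> 0 x * sg K g x)\<bar> \<le> K * \<delta>"
proof (cases "K = 0")
  case True
  then show ?thesis by (simp add: sg_0)
next
  case False
  define \<phi> where "\<phi> = (\<lambda>s. \<Sum>x\<in>S. \<nu> s x * sg (K - s) g x)"
  define \<phi>' where "\<phi>' = (\<lambda>s. \<Sum>x\<in>S. (\<nu>' s x - (\<Sum>y\<in>S. \<nu> s y * G y x)) * sg (K - s) g x)"
  have d: "(\<phi> has_real_derivative \<phi>' s) (at s)" if s: "0 \<le> s" "s \<le> K" for s
  proof -
    have sg': "((\<lambda>s. sg (K - s) g x) has_real_derivative - (\<Sum>z\<in>S. G x z * sg (K - s) g z)) (at s)" if "x \<in> S" for x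
    proof -
      have "((\<lambda>s. sg (K - s) g x) has_real_derivative (\<Sum>z\<in>S. G x z * sg (K - s) g z) * (- 1)) (at s)"
        by (rule DERIV_chain2[OF sg_deriv[OF that]]) (auto intro!: derivative_eq_intros)
      then show ?thesis by simp
    qed
    have "(\<phi> has_real_derivative (\<Sum>x\<in>S. \<nu>' s x * sg (K - s) g x + (- (\<Sum>z\<in>S. G x z * sg (K - s) g z)) * \<nu> s x)) (at s)"
      unfolding \<phi>_def by (intro DERIV_sum DERIV_mult der s sg')
    also have "(\<Sum>x\<in>S. \<nu>' s x * sg (K - s) g x + (- (\<Sum>z\<in>S. G x z * sg (K - s) g z)) * \<nu> s x) =
       (\<Sum>x\<in>S. \<nu>' s x * sg (K - s) g x) - (\<Sum>x\<in>S. \<Sum>z\<in>S. \<nu> s x * G x z * sg (K - s) g z)"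
      by (simp add: sum_subtractf sum_distrib_left sum_distrib_right mult_ac)
    also have "\<dots> = \<phi>' s"
      unfolding \<phi>'_def left_diff_distrib sum_subtractf sum_distrib_right by (subst sum.swap) simp
    finally show ?thesis .
  qed
  have b: "\<bar>\<phi>' s\<bar> \<le> \<delta>" if s: "0 \<le> s" "s \<le> K" for s
  proof -
    have "\<bar>\<phi>' s\<bar> \<le> (\<Sum>x\<in>S. \<bar>(\<nu>' s x - (\<Sum>y\<in>S. \<nu> s y * G y x)) * sg (K - s) g x\<bar>)"
      unfolding \<phi>'_def by (rule sum_abs)
    also have "\<dots> \<le> (\<Sum>x\<in>S. \<bar>\<nu>' s x - (\<Sum>y\<in>S. \<nu> s y * G y x)\<bar> * 1)"
      unfolding abs_mult using s g by (intro sum_mono mult_left_mono sg_abs_le) auto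
    also have "\<dots> \<le> \<delta>" using res[OF s] by simp
    finally show ?thesis .
  qed
  from False K have "0 < K" by simp
  from MVT2[OF this, of \<phi> \<phi>'] d obtain z where z: "0 < z" "z < K" "\<phi> K - \<phi> 0 = (K - 0) * \<phi>' z" by blast
  have "\<bar>\<phi> K - \<phi> 0\<bar> \<le> K * \<delta>"
    unfolding z(3) using b[of z] z K by (simp add: abs_mult mult_left_mono)
  moreover have "\<phi> K = (\<Sum>x\<in>S. \<nu> K x * g x)" unfolding \<phi>_def by (simp add: sg_0)
  ultimately show ?thesis by (simp add: \<phi>_def)
qed

lemma exp_second_order:
  fixes x :: real
  assumes "\<bar>x\<bar> \<le> 1"
  shows "\<bar>exp x - 1 - x - x\<^sup>2 / 2\<bar> \<le> \<bar>x\<bar> ^ 3"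
proof -
  obtain t where t: "\<bar>t\<bar> \<le> \<bar>x\<bar>" "exp x = (\<Sum>m<3. x ^ m / fact m) + exp t / fact 3 * x ^ 3"
    using Maclaurin_exp_le[of x 3] by blast
  have "exp t \<le> exp 1" using t(1) assms by simp
  also have "\<dots> \<le> 3" by (rule exp_le)
  finally have "exp t / 6 \<le> 1" by simp
  have "exp x - 1 - x - x\<^sup>2 / 2 = exp t / 6 * x ^ 3"
    unfolding t(2) by (simp add: eval_nat_numeral)
  moreover have "\<bar>exp t / 6 * x ^ 3\<bar> = exp t / 6 * \<bar>x\<bar> ^ 3" by (simp add: abs_mult power_abs)
  ultimately have "\<bar>exp x - 1 - x - x\<^sup>2 / 2\<bar> = exp t / 6 * \<bar>x\<bar> ^ 3" by (simp only:)
  also have "\<dots> \<le> 1 * \<bar>x\<bar> ^ 3" using \<open>exp t / 6 \<le> 1\<close> by (intro mult_right_mono) auto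
  finally show ?thesis by simp
qed

context curie_weiss
begin

text \<open>The usual derivative in an exponential family: the density times the centred sufficient
  statistic.\<close>

lemma tilt_deriv:
  assumes h: "\<And>i. i \<in> I \<Longrightarrow> ((\<lambda>s. h s i) has_real_derivative h' i) (at s)"
  shows "((\<lambda>s. tilt (h s) \<sigma>) has_real_derivative
    tilt (h s) \<sigma> * ((\<Sum>i\<in>I. h' i * real_of_int (\<sigma> i)) - ex (h s) (\<lambda>\<sigma>. \<Sum>i\<in>I. h' i * real_of_int (\<sigma> i)))) (at s)"
proof -
  define X where "X = (\<lambda>\<sigma>. \<Sum>i\<in>I. h' i * real_of_int (\<sigma> i))"
  have w: "((\<lambda>s. wt (h s) \<sigma>) has_real_derivative wt (h s) \<sigma> * X \<sigma>) (at s)" for \<sigma>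
    unfolding wt_def X_def by (auto intro!: derivative_eq_intros h)
  have p: "((\<lambda>s. pf (h s)) has_real_derivative (\<Sum>\<sigma>\<in>\<Omega>. wt (h s) \<sigma> * X \<sigma>)) (at s)"
    unfolding pf_def by (intro DERIV_sum w)
  have p0: "pf (h s) \<noteq> 0" using pf_pos[of "h s"] by simp
  have "(\<Sum>\<sigma>\<in>\<Omega>. wt (h s) \<sigma> * X \<sigma>) = pf (h s) * ex (h s) X"
    using p0 by (simp add: ex_def tilt_def sum_distrib_left)
  then have "((\<lambda>s. wt (h s) \<sigma> / pf (h s)) has_real_derivative
      (wt (h s) \<sigma> * X \<sigma> * pf (h s) - wt (h s) \<sigma> * (pf (h s) * ex (h s) X)) / (pf (h s) * pf (h s))) (at s)"
    using DERIV_divide[OF w p p0] by simp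
  moreover have "(wt (h s) \<sigma> * X \<sigma> * pf (h s) - wt (h s) \<sigma> * (pf (h s) * ex (h s) X)) / (pf (h s) * pf (h s)) =
      tilt (h s) \<sigma> * (X \<sigma> - ex (h s) X)"
    using p0 by (simp add: tilt_def field_simps)
  ultimately show ?thesis by (simp add: tilt_def X_def)
qed

text \<open>By reversibility the forward operator acts on a density relative to the stationary
  measure as the generator acts on a function. This density is the exponential of a linear
  statistic, for which each flip gives an explicit factor.\<close>

lemma tilt_generator:
  assumes \<sigma>: "\<sigma> \<in> \<Omega>"
  shows "(\<Sum>\<tau>\<in>\<Omega>. tilt h \<tau> * G \<tau> \<sigma>) = tilt h \<sigma> * (\<Sum>i\<in>I. rt i \<sigma> * (exp (- 2 * real_of_int (\<sigma> i) * h i) - 1))"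
proof -
  define f where "f = (\<lambda>\<sigma>. exp (\<Sum>i\<in>I. h i * real_of_int (\<sigma> i)))"
  define c where "c = pf (\<lambda>_. 0) / pf h"
  have t: "tilt h \<tau> = c * f \<tau> * tilt (\<lambda>_. 0) \<tau>" for \<tau>
    using pf_pos[of "\<lambda>_. 0"] by (simp add: tilt_def c_def f_def wt_def exp_add)
  have "(\<Sum>\<tau>\<in>\<Omega>. tilt h \<tau> * G \<tau> \<sigma>) = (\<Sum>\<tau>\<in>\<Omega>. c * tilt (\<lambda>_. 0) \<sigma> * (G \<sigma> \<tau> * f \<tau>))"
  proof (rule sum.cong[OF refl])
    fix \<tau> assume "\<tau> \<in> \<Omega>"
    from detailed_balance[OF this \<sigma>]
    show "tilt h \<tau> * G \<tau> \<sigma> = c * tilt (\<lambda>_. 0) \<sigma> * (G \<sigma> \<tau> * f \<tau>)"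
      unfolding t by (simp add: mult_ac)
  qed
  also have "\<dots> = c * tilt (\<lambda>_. 0) \<sigma> * (\<Sum>i\<in>I. rt i \<sigma> * (f (flip i \<sigma>) - f \<sigma>))"
    by (simp add: sum_distrib_left[symmetric] generator_flip[OF \<sigma>])
  also have "(\<Sum>i\<in>I. rt i \<sigma> * (f (flip i \<sigma>) - f \<sigma>)) = f \<sigma> * (\<Sum>i\<in>I. rt i \<sigma> * (exp (- 2 * real_of_int (\<sigma> i) * h i) - 1))"
    unfolding sum_distrib_left
  proof (rule sum.cong[OF refl])
    fix i assume i: "i \<in> I"
    have "(\<Sum>j\<in>I. h j * real_of_int (flip i \<sigma> j)) = (\<Sum>j\<in>I. h j * real_of_int (\<sigma> j)) - 2 * h i * real_of_int (\<sigma> i)"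
      using i by (simp add: sum.remove[of I i] algebra_simps)
    then have "f (flip i \<sigma>) = f \<sigma> * exp (- 2 * real_of_int (\<sigma> i) * h i)"
      by (simp add: f_def exp_add[symmetric] algebra_simps)
    then show "rt i \<sigma> * (f (flip i \<sigma>) - f \<sigma>) = f \<sigma> * (rt i \<sigma> * (exp (- 2 * real_of_int (\<sigma> i) * h i) - 1))"
      by (simp add: algebra_simps)
  qed
  finally show ?thesis unfolding t by (simp add: mult_ac)
qed

text \<open>Along the linearized mean-field equation for \<open>h\<close>, the logarithmic residual of the tilted measures
  in the forward equation is the constant \<open>- (\<Sum>i\<in>I. (h i)\<^sup>2)\<close> up to an error of order \<open>1 / sqrt n\<close>.\<close>

lemma tilt_residual:
  fixes h h' :: "nat \<Rightarrow> real"
  assumes A: "0 \<le> A" "2 * A \<le> sqrt (real n)" and h: "\<And>i. i \<in> I \<Longrightarrow> \<bar>h i\<bar> \<le> A / sqrt (real n)"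
    and m: "\<bar>m\<bar> \<le> A / sqrt (real n)" "(\<Sum>i\<in>I. h i) = real n * (1 - \<beta>) * m"
    and h': "\<And>i. i \<in> I \<Longrightarrow> h' i = - h i + (1 - \<beta>) * tanh (\<beta> * m)"
    and \<sigma>: "\<sigma> \<in> \<Omega>"
  shows "\<bar>(\<Sum>i\<in>I. h' i * real_of_int (\<sigma> i)) - (\<Sum>i\<in>I. rt i \<sigma> * (exp (- 2 * real_of_int (\<sigma> i) * h i) - 1)) + (\<Sum>i\<in>I. (h i)\<^sup>2)\<bar>
    \<le> (A + 2 * A\<^sup>2 + 8 * A ^ 3) / sqrt (real n) * (1 + (\<bar>mag I \<sigma>\<bar> + 1)\<^sup>2 / real n)"
proof -
  define s where "s = sqrt (real n)"
  have s: "s > 0" "real n = s * s" using n_pos by (auto simp: s_def)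
  define X where "X = \<bar>mag I \<sigma>\<bar> + 1"
  have X: "X \<ge> 1" by (simp add: X_def)
  define E where "E = (\<lambda>i. exp (- 2 * real_of_int (\<sigma> i) * h i) - 1 - (- 2 * real_of_int (\<sigma> i) * h i) - (- 2 * real_of_int (\<sigma> i) * h i)\<^sup>2 / 2)"
  define th where "th = (\<lambda>i. tanh (fld i \<sigma>))"
  define S where "S = mag I \<sigma>"
  have hs: "\<bar>h i\<bar> \<le> A / s" if "i \<in> I" for i using h[OF that] by (simp add: s_def)
  have sp: "real_of_int (\<sigma> i) * real_of_int (\<sigma> i) = 1" if "i \<in> I" for i
    using spin_sq[OF \<sigma> that] by (simp add: power2_eq_square)
  have E: "\<bar>rt i \<sigma> * E i\<bar> \<le> 8 * A ^ 3 / (s * s * s)" if i: "i \<in> I" for i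
  proof -
    have a: "\<bar>- 2 * real_of_int (\<sigma> i) * h i\<bar> = 2 * \<bar>h i\<bar>"
      using spin_abs[OF \<sigma> i] by (simp add: abs_mult)
    have "2 * \<bar>h i\<bar> \<le> 2 * (A / s)" using hs[OF i] by simp
    also have "\<dots> \<le> 1" using A(2) s(1) unfolding s_def[symmetric] by (simp add: field_simps)
    finally have "\<bar>E i\<bar> \<le> (2 * \<bar>h i\<bar>) ^ 3"
      using exp_second_order[of "- 2 * real_of_int (\<sigma> i) * h i"] unfolding a E_def by simp
    also have "\<dots> \<le> (2 * (A / s)) ^ 3" using hs[OF i] by (intro power_mono) auto
    also have "\<dots> = 8 * A ^ 3 / (s * s * s)" by (simp add: power_divide power_mult_distrib power3_eq_cube)
    finally have "\<bar>E i\<bar> \<le> 8 * A ^ 3 / (s * s * s)" .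
    moreover have "\<bar>rt i \<sigma>\<bar> * \<bar>E i\<bar> \<le> 1 * \<bar>E i\<bar>"
      using rt_bounds(2)[OF \<sigma> i] rt_nonneg[OF \<sigma> i] by (intro mult_right_mono) auto
    ultimately show ?thesis by (simp add: abs_mult)
  qed
  have thX: "\<bar>th i\<bar> \<le> X / (s * s)" if i: "i \<in> I" for i
  proof -
    have "\<bar>th i\<bar> \<le> \<beta> * X / real n"
      using tanh_abs_le[of "fld i \<sigma>"] fld_abs_le_mag[OF \<sigma> i] by (simp add: th_def X_def)
    also have "\<dots> \<le> 1 * X / real n"
      using beta_less X by (intro divide_right_mono mult_right_mono) auto
    finally show ?thesis by (simp add: s(2))
  qed
  have thS: "\<bar>\<beta> * S / real n - th i\<bar> \<le> 1 / (s * s) + X\<^sup>2 / (s * s)\<^sup>2" if i: "i \<in> I" for i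
  proof -
    have f: "\<bar>fld i \<sigma>\<bar> \<le> 1 * X / real n"
    proof -
      have "\<bar>fld i \<sigma>\<bar> \<le> \<beta> * X / real n" using fld_abs_le_mag[OF \<sigma> i] by (simp add: X_def)
      also have "\<dots> \<le> 1 * X / real n" using beta_less X by (intro divide_right_mono mult_right_mono) auto
      finally show ?thesis .
    qed
    have "\<bar>th i - fld i \<sigma>\<bar> \<le> \<bar>fld i \<sigma>\<bar>\<^sup>2" using tanh_approx[of "fld i \<sigma>"] by (simp add: th_def)
    also have "\<dots> \<le> (X / (s * s))\<^sup>2" using f by (intro power_mono) (auto simp: s(2))
    finally have "\<bar>th i - fld i \<sigma>\<bar> \<le> X\<^sup>2 / (s * s)\<^sup>2" by (simp add: power_divide)
    moreover have "\<bar>fld i \<sigma> - \<beta> * S / real n\<bar> \<le> 1 / (s * s)"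
    proof -
      have "\<bar>fld i \<sigma> - \<beta> * S / real n\<bar> \<le> \<beta> / real n" using fld_bound[OF \<sigma> i] by (simp add: S_def)
      also have "\<dots> \<le> 1 / real n" using beta_less by (intro divide_right_mono) auto
      finally show ?thesis by (simp add: s(2))
    qed
    ultimately show ?thesis by linarith
  qed
  \<comment> \<open>The term \<open>- h i\<close> in \<open>h' i\<close> cancels the first-order
    part of the exponential. The second-order part leaves \<open>(h i)\<^sup>2\<close>, whose main
    term no longer depends on the spin.\<close>
  have trm: "h' i * real_of_int (\<sigma> i) - rt i \<sigma> * (exp (- 2 * real_of_int (\<sigma> i) * h i) - 1) + (h i)\<^sup>2 =
      (1 - \<beta>) * tanh (\<beta> * m) * real_of_int (\<sigma> i) - h i * th i + real_of_int (\<sigma> i) * th i * (h i)\<^sup>2 - rt i \<sigma> * E i"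
    if i: "i \<in> I" for i
  proof -
    define a where "a = real_of_int (\<sigma> i)"
    have aa: "a * a = 1" using sp[OF i] by (simp add: a_def)
    have r: "rt i \<sigma> = (1 - a * th i) / 2" by (simp add: rt_def a_def th_def)
    have ex: "exp (- 2 * a * h i) - 1 = E i - 2 * a * h i + 2 * (a * a) * (h i)\<^sup>2"
      by (simp add: E_def a_def power2_eq_square)
    have "rt i \<sigma> * (exp (- 2 * a * h i) - 1) = rt i \<sigma> * E i + (1 - a * th i) * (- a * h i + (a * a) * (h i)\<^sup>2)"
      unfolding ex r by (simp add: field_simps)
    also have "\<dots> = rt i \<sigma> * E i - a * h i + (a * a) * th i * h i + (a * a) * (h i)\<^sup>2 - (a * a) * a * th i * (h i)\<^sup>2"
      by (simp add: algebra_simps)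
    also have "\<dots> = rt i \<sigma> * E i - a * h i + th i * h i + (h i)\<^sup>2 - a * th i * (h i)\<^sup>2"
      unfolding aa by simp
    finally show ?thesis unfolding a_def[symmetric] h'[OF i] by (simp add: algebra_simps)
  qed
  have T1: "\<bar>(1 - \<beta>) * (tanh (\<beta> * m) - \<beta> * m) * S\<bar> \<le> A\<^sup>2 / (s * s) * X"
  proof -
    have "\<bar>tanh (\<beta> * m) - \<beta> * m\<bar> \<le> (\<beta> * m)\<^sup>2" by (rule tanh_approx)
    also have "\<dots> = \<bar>\<beta> * m\<bar>\<^sup>2" by simp
    also have "\<dots> \<le> (1 * (A / s))\<^sup>2"
      unfolding abs_mult using m(1) beta_less beta_nonneg by (intro power_mono mult_mono) (auto simp: s_def)
    finally have 1: "\<bar>tanh (\<beta> * m) - \<beta> * m\<bar> \<le> A\<^sup>2 / (s * s)" by (simp add: power_divide power2_eq_square)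
    have "\<bar>(1 - \<beta>) * (tanh (\<beta> * m) - \<beta> * m) * S\<bar> \<le> 1 * (A\<^sup>2 / (s * s)) * X"
      unfolding abs_mult using 1 beta_less beta_nonneg
      by (intro mult_mono) (auto simp: S_def X_def)
    then show ?thesis by simp
  qed
  have T2: "\<bar>\<Sum>i\<in>I. h i * (\<beta> * S / real n - th i)\<bar> \<le> A / s * (1 + X\<^sup>2 / (s * s))"
  proof -
    have "\<bar>\<Sum>i\<in>I. h i * (\<beta> * S / real n - th i)\<bar> \<le> (\<Sum>i\<in>I. A / s * (1 / (s * s) + X\<^sup>2 / (s * s)\<^sup>2))"
    proof (rule order_trans[OF sum_abs sum_mono])
      fix i assume i: "i \<in> I"
      show "\<bar>h i * (\<beta> * S / real n - th i)\<bar> \<le> A / s * (1 / (s * s) + X\<^sup>2 / (s * s)\<^sup>2)"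
        unfolding abs_mult using hs[OF i] thS[OF i] A s by (intro mult_mono) auto
    qed
    also have "\<dots> = A / s * (1 + X\<^sup>2 / (s * s))"
      using s by (simp add: field_simps power2_eq_square)
    finally show ?thesis .
  qed
  have T3: "\<bar>\<Sum>i\<in>I. real_of_int (\<sigma> i) * th i * (h i)\<^sup>2\<bar> \<le> A\<^sup>2 / (s * s) * X"
  proof -
    have "\<bar>\<Sum>i\<in>I. real_of_int (\<sigma> i) * th i * (h i)\<^sup>2\<bar> \<le> (\<Sum>i\<in>I. 1 * (X / (s * s)) * (A\<^sup>2 / (s * s)))"
    proof (rule order_trans[OF sum_abs sum_mono])
      fix i assume i: "i \<in> I"
      have "\<bar>h i\<bar>\<^sup>2 \<le> (A / s)\<^sup>2" using hs[OF i] by (intro power_mono) auto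
      then have "\<bar>(h i)\<^sup>2\<bar> \<le> A\<^sup>2 / (s * s)" by (simp add: power_divide power2_eq_square)
      then show "\<bar>real_of_int (\<sigma> i) * th i * (h i)\<^sup>2\<bar> \<le> 1 * (X / (s * s)) * (A\<^sup>2 / (s * s))"
        unfolding abs_mult[of _ "(h i)\<^sup>2"] abs_mult[of "real_of_int (\<sigma> i)"] using thX[OF i] spin_abs[OF \<sigma> i] X s
        by (intro mult_mono) auto
    qed
    also have "\<dots> = A\<^sup>2 / (s * s) * X" using s by (simp add: field_simps)
    finally show ?thesis .
  qed
  have T4: "\<bar>\<Sum>i\<in>I. rt i \<sigma> * E i\<bar> \<le> 8 * A ^ 3 / s"
  proof -
    have "\<bar>\<Sum>i\<in>I. rt i \<sigma> * E i\<bar> \<le> (\<Sum>i\<in>I. 8 * A ^ 3 / (s * s * s))"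
      by (rule order_trans[OF sum_abs sum_mono]) (rule E)
    also have "\<dots> = 8 * A ^ 3 / s" using s by (simp add: field_simps)
    finally show ?thesis .
  qed
  have "(\<Sum>i\<in>I. h' i * real_of_int (\<sigma> i)) - (\<Sum>i\<in>I. rt i \<sigma> * (exp (- 2 * real_of_int (\<sigma> i) * h i) - 1)) + (\<Sum>i\<in>I. (h i)\<^sup>2) =
     (\<Sum>i\<in>I. h' i * real_of_int (\<sigma> i) - rt i \<sigma> * (exp (- 2 * real_of_int (\<sigma> i) * h i) - 1) + (h i)\<^sup>2)"
    by (simp only: sum.distrib sum_subtractf)
  also have "\<dots> = (\<Sum>i\<in>I. (1 - \<beta>) * tanh (\<beta> * m) * real_of_int (\<sigma> i) - h i * th i + real_of_int (\<sigma> i) * th i * (h i)\<^sup>2 - rt i \<sigma> * E i)"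
    by (intro sum.cong refl trm)
  also have "\<dots> = ((1 - \<beta>) * tanh (\<beta> * m) * S - (\<Sum>i\<in>I. h i * th i)) + (\<Sum>i\<in>I. real_of_int (\<sigma> i) * th i * (h i)\<^sup>2) - (\<Sum>i\<in>I. rt i \<sigma> * E i)"
    by (simp add: sum.distrib sum_subtractf S_def mag_def sum_distrib_left)
  \<comment> \<open>To first order \<open>th i\<close> is \<open>\<beta> * S / real n\<close>. As
    the fields sum to \<open>real n * (1 - \<beta>) * m\<close>, the two main terms, both linear in
    \<open>S\<close>, cancel.\<close>
  also have "(1 - \<beta>) * tanh (\<beta> * m) * S - (\<Sum>i\<in>I. h i * th i) =
      (1 - \<beta>) * (tanh (\<beta> * m) - \<beta> * m) * S + (\<Sum>i\<in>I. h i * (\<beta> * S / real n - th i))"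
  proof -
    have "(\<Sum>i\<in>I. h i * (\<beta> * S / real n - th i)) = (\<Sum>i\<in>I. h i) * (\<beta> * S / real n) - (\<Sum>i\<in>I. h i * th i)"
      unfolding right_diff_distrib sum_subtractf sum_distrib_right ..
    then show ?thesis unfolding m(2) using n_pos by (simp add: algebra_simps)
  qed
  finally have "\<bar>(\<Sum>i\<in>I. h' i * real_of_int (\<sigma> i)) - (\<Sum>i\<in>I. rt i \<sigma> * (exp (- 2 * real_of_int (\<sigma> i) * h i) - 1)) + (\<Sum>i\<in>I. (h i)\<^sup>2)\<bar>
     \<le> A / s * (1 + X\<^sup>2 / (s * s)) + 2 * (A\<^sup>2 / (s * s) * X) + 8 * A ^ 3 / s"
    using T1 T2 T3 T4 by linarith
  also have "\<dots> \<le> A / s * (1 + X\<^sup>2 / (s * s)) + 2 * (A\<^sup>2 / s * (1 + X\<^sup>2 / (s * s))) + 8 * A ^ 3 / s * (1 + X\<^sup>2 / (s * s))"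
  proof (intro add_mono mult_left_mono order_refl)
    have "X / s \<le> 1 + X\<^sup>2 / (s * s)"
    proof -
      have "0 \<le> X / s" using X s by simp
      moreover have "(X / s)\<^sup>2 = X\<^sup>2 / (s * s)" by (simp add: power_divide power2_eq_square)
      ultimately show ?thesis using sum_squares_bound[of "X / s" 1] by simp
    qed
    then have "A\<^sup>2 / s * (X / s) \<le> A\<^sup>2 / s * (1 + X\<^sup>2 / (s * s))" using s by (intro mult_left_mono) auto
    then show "A\<^sup>2 / (s * s) * X \<le> A\<^sup>2 / s * (1 + X\<^sup>2 / (s * s))" by simp
    have "8 * A ^ 3 / s * 1 \<le> 8 * A ^ 3 / s * (1 + X\<^sup>2 / (s * s))" using s A by (intro mult_left_mono) auto
    then show "8 * A ^ 3 / s \<le> 8 * A ^ 3 / s * (1 + X\<^sup>2 / (s * s))" by simp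
  qed (use A s in auto)
  also have "\<dots> = (A + 2 * A\<^sup>2 + 8 * A ^ 3) / s * (1 + X\<^sup>2 / (s * s))"
    by (simp add: add_divide_distrib distrib_right)
  finally show ?thesis unfolding X_def s(2)[symmetric] unfolding s_def .
qed

text \<open>The polynomial stems from \<open>tilt_residual\<close>, \<open>1 + M0 A\<close> from
  taking expectations there, and the factor 2 from centring.\<close>

definition DA :: "real \<Rightarrow> real" where
  "DA A = 2 * (A + 2 * A\<^sup>2 + 8 * A ^ 3) * (1 + M0 A)"

text \<open>A constant logarithmic residual does no harm: the derivative of the densities and the
  forward operator both preserve total mass, so the mean of the residual is 0 and the constant
  \<open>b\<close> may be subtracted at the price of a factor 2.\<close>

lemma tilt_flow:
  assumes K: "0 \<le> K" and A: "0 \<le> A" "2 * A \<le> sqrt (real n)"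
    and h: "\<And>s i. 0 \<le> s \<Longrightarrow> s \<le> K \<Longrightarrow> i \<in> I \<Longrightarrow> \<bar>h s i\<bar> \<le> A / sqrt (real n)"
    and m: "\<And>s. 0 \<le> s \<Longrightarrow> s \<le> K \<Longrightarrow> \<bar>m s\<bar> \<le> A / sqrt (real n)"
      "\<And>s. 0 \<le> s \<Longrightarrow> s \<le> K \<Longrightarrow> (\<Sum>i\<in>I. h s i) = real n * (1 - \<beta>) * m s"
    and h': "\<And>s i. 0 \<le> s \<Longrightarrow> s \<le> K \<Longrightarrow> i \<in> I \<Longrightarrow>
      ((\<lambda>s. h s i) has_real_derivative - h s i + (1 - \<beta>) * tanh (\<beta> * m s)) (at s)"
    and g: "\<And>\<sigma>. \<sigma> \<in> \<Omega> \<Longrightarrow> \<bar>g \<sigma>\<bar> \<le> 1"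
  shows "\<bar>ex (h K) g - ex (h 0) (sg K g)\<bar> \<le> K * (DA A / sqrt (real n))"
  unfolding ex_def
proof (rule duhamel[OF K _ _ g])
  fix s :: real assume s: "0 \<le> s" "s \<le> K"
  define h' where "h' = (\<lambda>i. - h s i + (1 - \<beta>) * tanh (\<beta> * m s))"
  define X where "X = (\<lambda>\<sigma>. \<Sum>i\<in>I. h' i * real_of_int (\<sigma> i))"
  define J where "J = (\<lambda>\<sigma>. \<Sum>i\<in>I. rt i \<sigma> * (exp (- 2 * real_of_int (\<sigma> i) * h s i) - 1))"
  define b where "b = - (\<Sum>i\<in>I. (h s i)\<^sup>2)"
  define B where "B = (A + 2 * A\<^sup>2 + 8 * A ^ 3) / sqrt (real n)"
  have B0: "0 \<le> B" using A by (simp add: B_def)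
  show "((\<lambda>s. tilt (h s) \<sigma>) has_real_derivative
    tilt (h s) \<sigma> * ((\<Sum>i\<in>I. (- h s i + (1 - \<beta>) * tanh (\<beta> * m s)) * real_of_int (\<sigma> i)) -
       ex (h s) (\<lambda>\<sigma>. \<Sum>i\<in>I. (- h s i + (1 - \<beta>) * tanh (\<beta> * m s)) * real_of_int (\<sigma> i)))) (at s)" for \<sigma>
    by (rule tilt_deriv) (rule h'[OF s])
  have "ex (h s) J = (\<Sum>\<sigma>\<in>\<Omega>. \<Sum>\<tau>\<in>\<Omega>. tilt (h s) \<tau> * G \<tau> \<sigma>)"
    unfolding ex_def J_def by (simp add: tilt_generator)
  also have "\<dots> = (\<Sum>\<tau>\<in>\<Omega>. tilt (h s) \<tau> * (\<Sum>\<sigma>\<in>\<Omega>. G \<tau> \<sigma> * 1))"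
    by (subst sum.swap) (simp add: sum_distrib_left)
  also have "\<dots> = 0" by (intro sum.neutral ballI) (simp only: generator_flip, simp)
  finally have J0: "ex (h s) J = 0" .
  have R: "ex (h s) (\<lambda>\<sigma>. \<bar>X \<sigma> - J \<sigma> - b\<bar>) \<le> B * (1 + M0 A)"
  proof -
    have "ex (h s) (\<lambda>\<sigma>. \<bar>X \<sigma> - J \<sigma> - b\<bar>) \<le> ex (h s) (\<lambda>\<sigma>. B * (1 + (\<bar>mag I \<sigma>\<bar> + 1)\<^sup>2 / real n))"
    proof (rule ex_mono)
      fix \<sigma> assume "\<sigma> \<in> \<Omega>"
      from tilt_residual[OF A h[OF s] m(1)[OF s] m(2)[OF s] h'_def[THEN fun_cong] this]
      show "\<bar>X \<sigma> - J \<sigma> - b\<bar> \<le> B * (1 + (\<bar>mag I \<sigma>\<bar> + 1)\<^sup>2 / real n)"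
        by (simp add: X_def J_def b_def B_def)
    qed
    also have "\<dots> = B * (1 + ex (h s) (\<lambda>\<sigma>. (\<bar>mag I \<sigma>\<bar> + 1)\<^sup>2) / real n)"
      by (simp add: ex_cmult ex_add ex_divide)
    also have "\<dots> \<le> B * (1 + M0 A * real n / real n)"
      using second_moment_bound[OF A(1) h[OF s]] B0 by (intro mult_left_mono add_left_mono divide_right_mono) auto
    finally show ?thesis using n_pos by simp
  qed
  have "(\<Sum>\<sigma>\<in>\<Omega>. \<bar>tilt (h s) \<sigma> * (X \<sigma> - ex (h s) X) - (\<Sum>\<tau>\<in>\<Omega>. tilt (h s) \<tau> * G \<tau> \<sigma>)\<bar>) =
     ex (h s) (\<lambda>\<sigma>. \<bar>(X \<sigma> - J \<sigma> - b) - (ex (h s) X - ex (h s) J - b)\<bar>)"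
    unfolding ex_def[of _ "\<lambda>\<sigma>. \<bar>_ \<sigma>\<bar>"]
  proof (rule sum.cong[OF refl])
    fix \<sigma> assume \<sigma>: "\<sigma> \<in> \<Omega>"
    have e: "(\<Sum>\<tau>\<in>\<Omega>. tilt (h s) \<tau> * G \<tau> \<sigma>) = tilt (h s) \<sigma> * J \<sigma>"
      unfolding J_def by (rule tilt_generator[OF \<sigma>])
    have "tilt (h s) \<sigma> * (X \<sigma> - ex (h s) X) - (\<Sum>\<tau>\<in>\<Omega>. tilt (h s) \<tau> * G \<tau> \<sigma>) =
       tilt (h s) \<sigma> * ((X \<sigma> - J \<sigma> - b) - (ex (h s) X - ex (h s) J - b))"
      unfolding e J0 by (simp add: algebra_simps)
    then show "\<bar>tilt (h s) \<sigma> * (X \<sigma> - ex (h s) X) - (\<Sum>\<tau>\<in>\<Omega>. tilt (h s) \<tau> * G \<tau> \<sigma>)\<bar> =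
       tilt (h s) \<sigma> * \<bar>(X \<sigma> - J \<sigma> - b) - (ex (h s) X - ex (h s) J - b)\<bar>"
      using tilt_pos[of "h s" \<sigma>] by (simp add: abs_mult)
  qed
  also have "\<dots> \<le> ex (h s) (\<lambda>\<sigma>. \<bar>X \<sigma> - J \<sigma> - b\<bar> + \<bar>ex (h s) X - ex (h s) J - b\<bar>)"
    by (rule ex_mono) linarith
  also have "\<dots> = ex (h s) (\<lambda>\<sigma>. \<bar>X \<sigma> - J \<sigma> - b\<bar>) + \<bar>ex (h s) (\<lambda>\<sigma>. X \<sigma> - J \<sigma> - b)\<bar>"
    by (simp add: ex_add ex_diff)
  also have "\<dots> \<le> 2 * (B * (1 + M0 A))"
    using R ex_abs[of "h s" "\<lambda>\<sigma>. X \<sigma> - J \<sigma> - b"] by linarith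
  also have "\<dots> = DA A / sqrt (real n)" by (simp add: DA_def B_def)
  finally show "(\<Sum>\<sigma>\<in>\<Omega>. \<bar>tilt (h s) \<sigma> * ((\<Sum>i\<in>I. (- h s i + (1 - \<beta>) * tanh (\<beta> * m s)) * real_of_int (\<sigma> i)) -
       ex (h s) (\<lambda>\<sigma>. \<Sum>i\<in>I. (- h s i + (1 - \<beta>) * tanh (\<beta> * m s)) * real_of_int (\<sigma> i))) -
      (\<Sum>\<tau>\<in>\<Omega>. tilt (h s) \<tau> * G \<tau> \<sigma>)\<bar>) \<le> DA A / sqrt (real n)"
    by (simp only: X_def h'_def)
qed

end

section \<open>Reduction to tilted measures\<close>

text \<open>Equal total masses make the positive and the negative excess coincide. The distance is
  thus attained at an indicator, to which the semigroup estimates can be applied.\<close>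

lemma sum_abs_diff_eq:
  fixes p q :: "'a \<Rightarrow> real"
  assumes "sum p S = sum q S"
  shows "(\<Sum>x\<in>S. \<bar>p x - q x\<bar>) = 2 * (\<Sum>x\<in>S. (p x - q x) * (if q x < p x then 1 else 0))"
proof -
  have "(\<Sum>x\<in>S. \<bar>p x - q x\<bar>) = (\<Sum>x\<in>S. 2 * ((p x - q x) * (if q x < p x then 1 else 0)) - (p x - q x))"
    by (intro sum.cong) auto
  also have "\<dots> = 2 * (\<Sum>x\<in>S. (p x - q x) * (if q x < p x then 1 else 0))"
    unfolding sum_subtractf sum_distrib_left[symmetric] using assms by simp
  finally show ?thesis .
qed

lemma measure_point_measure:
  assumes "finite S" "A \<subseteq> S" "\<And>x. x \<in> S \<Longrightarrow> 0 \<le> p x"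
  shows "measure (point_measure S (\<lambda>x. ennreal (p x))) A = (\<Sum>x\<in>A. p x)"
proof -
  have "emeasure (point_measure S (\<lambda>x. ennreal (p x))) A = (\<Sum>x\<in>A. ennreal (p x))"
    using assms by (intro emeasure_point_measure_finite)
  also have "\<dots> = ennreal (\<Sum>x\<in>A. p x)" using assms by (intro sum_ennreal) auto
  finally show ?thesis using assms by (intro measure_eq_emeasure_eq_ennreal sum_nonneg) auto
qed

lemma tv_dist_point_measure:
  fixes p q :: "'a \<Rightarrow> real"
  assumes S: "finite S" and p: "\<And>x. x \<in> S \<Longrightarrow> 0 \<le> p x" and q: "\<And>x. x \<in> S \<Longrightarrow> 0 \<le> q x"
    and 1: "sum p S = 1" "sum q S = 1"
  shows "tv_dist (point_measure S (\<lambda>x. ennreal (p x))) (point_measure S (\<lambda>x. ennreal (q x))) =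
    (\<Sum>x\<in>S. \<bar>p x - q x\<bar>) / 2"
proof -
  define d where "d = (\<lambda>A. \<bar>(\<Sum>x\<in>A. p x) - (\<Sum>x\<in>A. q x)\<bar>)"
  have "tv_dist (point_measure S (\<lambda>x. ennreal (p x))) (point_measure S (\<lambda>x. ennreal (q x))) = (SUP A\<in>Pow S. d A)"
    unfolding tv_dist_def d_def by (intro SUP_cong) (auto simp: sets_point_measure measure_point_measure S p q)
  also have "\<dots> = (\<Sum>x\<in>S. \<bar>p x - q x\<bar>) / 2"
  proof (rule cSup_eq_maximum)
    define A where "A = {x\<in>S. q x < p x}"
    have "(\<Sum>x\<in>A. p x) - (\<Sum>x\<in>A. q x) = (\<Sum>x\<in>S. (p x - q x) * (if q x < p x then 1 else 0))"
      unfolding sum_subtractf[symmetric] A_def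
      using S by (simp add: sum.inter_filter if_distrib[of "\<lambda>u. _ * u"] cong: if_cong)
    then have "(\<Sum>x\<in>A. p x) - (\<Sum>x\<in>A. q x) = (\<Sum>x\<in>S. \<bar>p x - q x\<bar>) / 2"
      using sum_abs_diff_eq[of p S q] 1 by simp
    moreover have "0 \<le> (\<Sum>x\<in>S. \<bar>p x - q x\<bar>) / 2" by (simp add: sum_nonneg)
    ultimately have "d A = (\<Sum>x\<in>S. \<bar>p x - q x\<bar>) / 2" unfolding d_def by (simp only: abs_of_nonneg)
    then show "(\<Sum>x\<in>S. \<bar>p x - q x\<bar>) / 2 \<in> d ` Pow S"
      by (intro image_eqI[of _ _ A]) (auto simp: A_def)
  next
    fix y assume "y \<in> d ` Pow S"
    then obtain A where A: "A \<subseteq> S" "y = d A" by auto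
    define D where "D = (\<lambda>B. \<Sum>x\<in>B. p x - q x)"
    have "D S = D (S - A) + D A" unfolding D_def using S A by (intro sum.subset_diff) auto
    moreover have "D S = 0" using 1 by (simp add: D_def sum_subtractf)
    moreover have "\<bar>D A\<bar> + \<bar>D (S - A)\<bar> \<le> (\<Sum>x\<in>S. \<bar>p x - q x\<bar>)"
    proof -
      have "\<bar>D A\<bar> + \<bar>D (S - A)\<bar> \<le> (\<Sum>x\<in>A. \<bar>p x - q x\<bar>) + (\<Sum>x\<in>S-A. \<bar>p x - q x\<bar>)"
        unfolding D_def by (intro add_mono sum_abs)
      also have "\<dots> = (\<Sum>x\<in>S. \<bar>p x - q x\<bar>)"
        using sum.subset_diff[OF A(1) S, of "\<lambda>x. \<bar>p x - q x\<bar>"] by simp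
      finally show ?thesis .
    qed
    ultimately have "\<bar>D A\<bar> \<le> (\<Sum>x\<in>S. \<bar>p x - q x\<bar>) / 2" by linarith
    then show "y \<le> (\<Sum>x\<in>S. \<bar>p x - q x\<bar>) / 2" by (simp add: A(2) d_def D_def sum_subtractf)
  qed
  finally show ?thesis .
qed

lemma (in finite_chain) sg_semigroup:
  assumes "0 \<le> t" "x \<in> S"
  shows "sg (t + s) f x = sg t (sg s f) x"
proof -
  have "sg (t + s) f x = (\<Sum>y\<in>S. \<Sum>z\<in>S. H t x z * H s z y * f y)"
    unfolding sg_def H_semigroup[OF assms] sum_distrib_right ..
  also have "\<dots> = (\<Sum>z\<in>S. \<Sum>y\<in>S. H t x z * H s z y * f y)" by (rule sum.swap)
  also have "\<dots> = sg t (sg s f) x" unfolding sg_def sum_distrib_left by (simp add: mult_ac)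
  finally show ?thesis .
qed

context curie_weiss
begin

text \<open>The class size cancels: the squared Lipschitz constant is inversely proportional to it,
  the second moment at most proportional.\<close>

lemma lip_moment:
  assumes "Q \<le> M2 * real (card (cls \<xi> c))"
  shows "1 / 2 + (lip \<xi> c)\<^sup>2 / 2 * Q \<le> 1 / 2 + M2 / 4"
proof (cases "card (cls \<xi> c) = 0")
  case True
  then show ?thesis using M2_pos by (simp add: lip_def)
next
  case False
  then have k: "real (card (cls \<xi> c)) > 0" by (simp only: of_nat_0_less_iff neq0_conv)
  have l2: "(lip \<xi> c)\<^sup>2 = 1 / (2 * real (card (cls \<xi> c)))"
    using k by (simp add: lip_def power_divide field_simps)
  have "(lip \<xi> c)\<^sup>2 / 2 * Q \<le> (lip \<xi> c)\<^sup>2 / 2 * (M2 * real (card (cls \<xi> c)))"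
    using assms by (intro mult_left_mono) auto
  also have "(lip \<xi> c)\<^sup>2 / 2 * (M2 * real (card (cls \<xi> c))) = M2 / 4"
  proof -
    have "1 / (2 * k) / 2 * (M2 * k) = M2 / 4" if "k > 0" for k :: real using that by simp
    from this[OF k] show ?thesis unfolding l2 .
  qed
  finally show ?thesis by simp
qed

lemma swap_invariant_sg:
  assumes "swap_invariant \<xi> g" "0 \<le> t"
  shows "swap_invariant \<xi> (sg t g)"
  unfolding swap_invariant_def
proof (intro ballI impI)
  fix i j \<sigma> assume ij: "i \<in> I" "j \<in> I" "\<xi> i = \<xi> j" and \<sigma>: "\<sigma> \<in> \<Omega>"
  have "sg t g (sw i j \<sigma>) = sg t (\<lambda>\<sigma>. g (sw i j \<sigma>)) \<sigma>" by (rule sg_sw[OF ij(1,2) assms(2) \<sigma>])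
  also have "\<dots> = sg t g \<sigma>"
    unfolding sg_def by (intro sum.cong refl) (simp add: swap_invariantD[OF assms(1) ij])
  finally show "sg t g (sw i j \<sigma>) = sg t g \<sigma>" .
qed

lemma tilt_sw:
  assumes "i \<in> I" "j \<in> I" "h i = h j"
  shows "tilt h (sw i j \<sigma>) = tilt h \<sigma>"
proof -
  have "(\<Sum>k\<in>I. h k * real_of_int (sw i j \<sigma> k)) = (\<Sum>k\<in>I. h (tr i j k) * real_of_int (\<sigma> (tr i j k)))"
    using assms(3) by (intro sum.cong refl) (auto simp: sw_tr tr_def)
  also have "\<dots> = (\<Sum>k\<in>I. h k * real_of_int (\<sigma> k))"
    using assms by (intro sum_tr) auto
  finally show ?thesis using assms by (simp add: tilt_def wt_def mag_sw)
qed

text \<open>Take independent samples from the two laws. After time \<open>K\<close> the values of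
  the test function differ by at most \<open>1 / sqrt (\<rho> * K)\<close> times the normalized
  class deviations from the common centres \<open>a c\<close>. The inequality
  \<open>x \<le> 1/2 + x^2/2\<close> reduces these to the two second moment bounds.\<close>

lemma smoothing_bound:
  assumes large: "\<beta>\<^sup>2 / (real n * \<rho>) \<le> 2 * (1 - \<beta>)" and \<xi>: "\<xi> \<in> \<Omega>" and T: "0 \<le> T" and K: "0 < K"
    and g: "swap_invariant \<xi> g" "\<And>\<sigma>. \<sigma> \<in> \<Omega> \<Longrightarrow> \<bar>g \<sigma>\<bar> \<le> 1"
    and dyn: "\<And>c. sg T (\<lambda>\<sigma>. (mag (cls \<xi> c) \<sigma> - a c)\<^sup>2) \<xi> \<le> M2 * real (card (cls \<xi> c))"
    and stat: "\<And>c. ex h (\<lambda>\<sigma>. (mag (cls \<xi> c) \<sigma> - a c)\<^sup>2) \<le> M2 * real (card (cls \<xi> c))"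
  shows "\<bar>sg T (sg K g) \<xi> - ex h (sg K g)\<bar> \<le> (2 + M2) / sqrt (\<rho> * K)"
proof -
  define f where "f = sg K g"
  define e where "e = 1 / sqrt (\<rho> * K)"
  have rK: "\<rho> * K > 0" using rho_pos K by simp
  have e: "e > 0" "e\<^sup>2 = 1 / (\<rho> * K)" using rK by (auto simp: e_def power_divide)
  have grad: "grad2 f \<sigma> \<le> e\<^sup>2" if "\<sigma> \<in> \<Omega>" for \<sigma>
    using sg_gradient_bound[OF large g(2) less_imp_le[OF K] that] rK by (simp add: f_def e field_simps)
  have inv: "swap_invariant \<xi> f" unfolding f_def using K by (intro swap_invariant_sg g) simp
  define Y where "Y = (\<lambda>c \<sigma>. mag (cls \<xi> c) \<sigma> - a c)"
  define y where "y = (\<lambda>c \<sigma>. 1 / 2 + (lip \<xi> c)\<^sup>2 / 2 * (Y c \<sigma>)\<^sup>2)"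
  have lipY: "lip \<xi> c * \<bar>Y c \<sigma>\<bar> \<le> y c \<sigma>" for c \<sigma>
    using sum_squares_bound[of "lip \<xi> c * \<bar>Y c \<sigma>\<bar>" 1] by (simp add: y_def power_mult_distrib)
  have lip0: "0 \<le> lip \<xi> c" for c by (simp add: lip_def)
  have pair: "\<bar>f \<sigma> - f \<tau>\<bar> \<le> e * (y (-1) \<sigma> + y 1 \<sigma>) + e * (y (-1) \<tau> + y 1 \<tau>)" if "\<sigma> \<in> \<Omega>" "\<tau> \<in> \<Omega>" for \<sigma> \<tau>
  proof -
    have "\<bar>f \<sigma> - f \<tau>\<bar> \<le> e * (\<Sum>c\<in>{-1, 1}. lip \<xi> c * \<bar>mag (cls \<xi> c) \<sigma> - mag (cls \<xi> c) \<tau>\<bar>)"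
      by (rule swap_invariant_lipschitz[OF inv grad less_imp_le[OF e(1)] \<xi> that])
    also have "\<dots> \<le> e * (\<Sum>c\<in>{-1, 1}. y c \<sigma> + y c \<tau>)"
    proof (intro mult_left_mono sum_mono)
      fix c
      have "\<bar>mag (cls \<xi> c) \<sigma> - mag (cls \<xi> c) \<tau>\<bar> \<le> \<bar>Y c \<sigma>\<bar> + \<bar>Y c \<tau>\<bar>" by (simp add: Y_def)
      then have "lip \<xi> c * \<bar>mag (cls \<xi> c) \<sigma> - mag (cls \<xi> c) \<tau>\<bar> \<le> lip \<xi> c * (\<bar>Y c \<sigma>\<bar> + \<bar>Y c \<tau>\<bar>)"
        using lip0 by (intro mult_left_mono)
      also have "\<dots> \<le> y c \<sigma> + y c \<tau>" using lipY[of c \<sigma>] lipY[of c \<tau>] by (simp add: distrib_left)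
      finally show "lip \<xi> c * \<bar>mag (cls \<xi> c) \<sigma> - mag (cls \<xi> c) \<tau>\<bar> \<le> y c \<sigma> + y c \<tau>" .
    qed (use e in auto)
    also have "\<dots> = e * (y (-1) \<sigma> + y 1 \<sigma>) + e * (y (-1) \<tau> + y 1 \<tau>)" by (simp add: algebra_simps)
    finally show ?thesis .
  qed
  have exy: "ex h (y c) \<le> 1 / 2 + M2 / 4" for c
  proof -
    have "ex h (y c) = 1 / 2 + (lip \<xi> c)\<^sup>2 / 2 * ex h (\<lambda>\<sigma>. (Y c \<sigma>)\<^sup>2)"
      unfolding y_def ex_add ex_cmult ex_const ..
    also have "\<dots> \<le> 1 / 2 + M2 / 4" using stat by (intro lip_moment) (simp add: Y_def)
    finally show ?thesis .
  qed
  have sgy: "sg T (y c) \<xi> \<le> 1 / 2 + M2 / 4" for c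
  proof -
    have "sg T (y c) \<xi> = 1 / 2 + (lip \<xi> c)\<^sup>2 / 2 * sg T (\<lambda>\<sigma>. (Y c \<sigma>)\<^sup>2) \<xi>"
      unfolding y_def sg_add sg_cmult sg_const[OF T \<xi>] ..
    also have "\<dots> \<le> 1 / 2 + M2 / 4" using dyn by (intro lip_moment) (simp add: Y_def)
    finally show ?thesis .
  qed
  define b where "b = e * (1 + M2 / 2)"
  have pt: "\<bar>f \<sigma> - ex h f\<bar> \<le> e * (y (-1) \<sigma> + y 1 \<sigma>) + b" if \<sigma>: "\<sigma> \<in> \<Omega>" for \<sigma>
  proof -
    have "\<bar>f \<sigma> - ex h f\<bar> = \<bar>ex h (\<lambda>\<tau>. f \<sigma> - f \<tau>)\<bar>" by (simp add: ex_diff)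
    also have "\<dots> \<le> ex h (\<lambda>\<tau>. \<bar>f \<sigma> - f \<tau>\<bar>)" by (rule ex_abs)
    also have "\<dots> \<le> ex h (\<lambda>\<tau>. e * (y (-1) \<sigma> + y 1 \<sigma>) + e * (y (-1) \<tau> + y 1 \<tau>))"
      by (rule ex_mono) (rule pair[OF \<sigma>])
    also have "\<dots> = e * (y (-1) \<sigma> + y 1 \<sigma>) + e * (ex h (y (-1)) + ex h (y 1))"
      unfolding ex_add ex_cmult ex_const ..
    also have "\<dots> \<le> e * (y (-1) \<sigma> + y 1 \<sigma>) + b"
      unfolding b_def using exy[of "-1"] exy[of 1] e by (intro add_left_mono mult_left_mono) auto
    finally show ?thesis .
  qed
  have "\<bar>sg T f \<xi> - ex h f\<bar> = \<bar>sg T (\<lambda>\<sigma>. f \<sigma> + - ex h f) \<xi>\<bar>"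
    unfolding sg_add sg_const[OF T \<xi>] by simp
  also have "\<dots> \<le> sg T (\<lambda>\<sigma>. e * (y (-1) \<sigma> + y 1 \<sigma>) + b) \<xi>"
  proof -
    have "sg T (\<lambda>\<sigma>. f \<sigma> + - ex h f) \<xi> \<le> sg T (\<lambda>\<sigma>. e * (y (-1) \<sigma> + y 1 \<sigma>) + b) \<xi>"
      using pt by (intro sg_mono T \<xi>) (fastforce simp: abs_le_iff)
    moreover have "sg T (\<lambda>\<sigma>. - 1 * (f \<sigma> + - ex h f)) \<xi> \<le> sg T (\<lambda>\<sigma>. e * (y (-1) \<sigma> + y 1 \<sigma>) + b) \<xi>"
      using pt by (intro sg_mono T \<xi>) (fastforce simp: abs_le_iff)
    ultimately show ?thesis unfolding sg_cmult by simp
  qed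
  also have "\<dots> = e * (sg T (y (-1)) \<xi> + sg T (y 1) \<xi>) + b"
    unfolding sg_add sg_cmult sg_const[OF T \<xi>] ..
  also have "\<dots> \<le> b + b"
    unfolding b_def using sgy[of "-1"] sgy[of 1] e by (intro add_right_mono mult_left_mono) auto
  also have "\<dots> = (2 + M2) / sqrt (\<rho> * K)" by (simp add: b_def e_def field_simps)
  finally show ?thesis by (simp add: f_def)
qed

text \<open>The cost of smoothing plus the accumulated residual over time \<open>K\<close>. In the
  end \<open>U\<close> grows exponentially in \<open>K\<close>, which is harmless since
  \<open>K\<close> is fixed before \<open>n\<close> grows.\<close>

definition error_bound :: "real \<Rightarrow> real \<Rightarrow> real" where
  "error_bound U K = (2 + M2) / sqrt (\<rho> * K) + K * (DA (2 * U) / sqrt (real n))"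

text \<open>The field \<open>u - \<beta> * m\<close> inverts the first-order relation between field
  and mean, so the tilted measure has the right class magnetizations at time \<open>T\<close>. It
  also solves exactly the equation that \<open>tilt_flow\<close> asks for. The bound
  \<open>2 * U\<close> adds the bounds of \<open>u\<close> and \<open>\<beta> * m\<close>.\<close>

lemma law_close_to_tilt:
  assumes large: "\<beta>\<^sup>2 / (real n * \<rho>) \<le> 2 * (1 - \<beta>)" "\<beta> + U\<^sup>2 \<le> sqrt (real n)" "4 * U \<le> sqrt (real n)"
    and \<xi>: "\<xi> \<in> \<Omega>" and T: "0 \<le> T" and K: "0 < K" and U: "0 \<le> U"
    and m: "\<And>t. real n * m t = (\<Sum>i\<in>I. u t i)"
    and u: "\<And>t i. 0 \<le> t \<Longrightarrow> i \<in> I \<Longrightarrow> ((\<lambda>t. u t i) has_real_derivative - u t i + tanh (\<beta> * m t)) (at t)"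
    and u0: "\<And>i. i \<in> I \<Longrightarrow> u 0 i = real_of_int (\<xi> i)"
    and usym: "\<And>t i j. i \<in> I \<Longrightarrow> j \<in> I \<Longrightarrow> \<xi> i = \<xi> j \<Longrightarrow> u t i = u t j"
    and uU: "\<And>t i. T \<le> t \<Longrightarrow> i \<in> I \<Longrightarrow> \<bar>u t i\<bar> \<le> U / sqrt (real n)"
    and mU: "\<And>t. T \<le> t \<Longrightarrow> \<bar>m t\<bar> \<le> U / sqrt (real n)"
  shows "(\<Sum>\<sigma>\<in>\<Omega>. \<bar>H (T + K) \<xi> \<sigma> - tilt (\<lambda>i. u (T + K) i - \<beta> * m (T + K)) \<sigma>\<bar>) \<le> 2 * error_bound U K"
proof -
  define h where "h = (\<lambda>s i. u (T + s) i - \<beta> * m (T + s))"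
  \<comment> \<open>The optimal test function for total variation. It inherits swap invariance from
    the two laws that it compares.\<close>
  define g :: "(nat \<Rightarrow> int) \<Rightarrow> real" where "g = (\<lambda>\<sigma>. if tilt (h K) \<sigma> < H (T + K) \<xi> \<sigma> then 1 else 0)"
  have TK: "0 \<le> T + K" using T K by simp
  have g1: "\<bar>g \<sigma>\<bar> \<le> 1" for \<sigma> by (simp add: g_def)
  have ginv: "swap_invariant \<xi> g"
    unfolding swap_invariant_def
  proof (intro ballI impI)
    fix i j \<sigma> assume ij: "i \<in> I" "j \<in> I" "\<xi> i = \<xi> j" and \<sigma>: "\<sigma> \<in> \<Omega>"
    have "sw i j \<xi> = \<xi>" using ij(3) by (auto simp: sw_def fun_eq_iff)
    from H_sw[OF ij(1,2) TK \<xi> \<sigma> this] tilt_sw[OF ij(1,2), of "h K" \<sigma>] usym[OF ij]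
    show "g (sw i j \<sigma>) = g \<sigma>" by (simp add: g_def h_def)
  qed
  have sums: "(\<Sum>\<sigma>\<in>\<Omega>. H (T + K) \<xi> \<sigma>) = (\<Sum>\<sigma>\<in>\<Omega>. tilt (h K) \<sigma>)"
    by (simp add: tilt_sum H_sum TK \<xi>)
  have "(\<Sum>\<sigma>\<in>\<Omega>. \<bar>H (T + K) \<xi> \<sigma> - tilt (h K) \<sigma>\<bar>) = 2 * (\<Sum>\<sigma>\<in>\<Omega>. (H (T + K) \<xi> \<sigma> - tilt (h K) \<sigma>) * g \<sigma>)"
    unfolding g_def by (rule sum_abs_diff_eq[OF sums])
  also have "(\<Sum>\<sigma>\<in>\<Omega>. (H (T + K) \<xi> \<sigma> - tilt (h K) \<sigma>) * g \<sigma>) = sg (T + K) g \<xi> - ex (h K) g"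
    by (simp add: sg_def ex_def left_diff_distrib sum_subtractf)
  also have "sg (T + K) g \<xi> = sg T (sg K g) \<xi>" by (rule sg_semigroup[OF T \<xi>])
  also have "sg T (sg K g) \<xi> - ex (h K) g \<le> error_bound U K"
  proof -
    have n0: "real n \<noteq> 0" using n_pos by simp
    have "\<bar>sg T (sg K g) \<xi> - ex (h 0) (sg K g)\<bar> \<le> (2 + M2) / sqrt (\<rho> * K)"
    proof (rule smoothing_bound[OF large(1) \<xi> T K ginv g1])
      fix c
      show "sg T (\<lambda>\<sigma>. (mag (cls \<xi> c) \<sigma> - (\<Sum>i\<in>cls \<xi> c. u T i))\<^sup>2) \<xi> \<le> M2 * real (card (cls \<xi> c))"
        by (rule dynamics_concentration(2)[OF \<xi> m u u0 cls_subset T])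
      show "ex (h 0) (\<lambda>\<sigma>. (mag (cls \<xi> c) \<sigma> - (\<Sum>i\<in>cls \<xi> c. u T i))\<^sup>2) \<le> M2 * real (card (cls \<xi> c))"
        by (rule tilt_concentration(2)[OF m _ uU[OF order_refl] large(2) cls_subset]) (auto simp: h_def)
    qed
    moreover have "\<bar>ex (h K) g - ex (h 0) (sg K g)\<bar> \<le> K * (DA (2 * U) / sqrt (real n))"
    proof (rule tilt_flow[where m = "\<lambda>s. m (T + s)"])
      show "0 \<le> K" "0 \<le> 2 * U" "2 * (2 * U) \<le> sqrt (real n)" using K U large(3) by auto
      fix s :: real assume s: "0 \<le> s"
      then have Ts: "T \<le> T + s" "0 \<le> T + s" using T by auto
      have mU': "\<bar>m (T + s)\<bar> \<le> U / sqrt (real n)" by (rule mU[OF Ts(1)])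
      also have "\<dots> \<le> 2 * U / sqrt (real n)" using U by (intro divide_right_mono) auto
      finally show "\<bar>m (T + s)\<bar> \<le> 2 * U / sqrt (real n)" .
      have bm: "\<bar>\<beta> * m (T + s)\<bar> \<le> U / sqrt (real n)"
        using mU' beta_nonneg beta_less mult_left_le_one_le[of "\<bar>m (T + s)\<bar>" \<beta>] by (simp add: abs_mult)
      show "(\<Sum>i\<in>I. h s i) = real n * (1 - \<beta>) * m (T + s)"
        by (simp add: h_def sum_subtractf m[symmetric] algebra_simps)
      fix i assume i: "i \<in> I"
      show "\<bar>h s i\<bar> \<le> 2 * U / sqrt (real n)"
        using uU[OF Ts(1) i] bm abs_triangle_ineq4[of "u (T + s) i" "\<beta> * m (T + s)"] by (simp add: h_def)
      have dm: "(m has_real_derivative - m (T + s) + tanh (\<beta> * m (T + s))) (at (T + s))"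
      proof -
        have "((\<lambda>t. (\<Sum>i\<in>I. u t i) / real n) has_real_derivative
            (\<Sum>i\<in>I. - u (T + s) i + tanh (\<beta> * m (T + s))) / real n) (at (T + s))"
          by (intro DERIV_cdivide DERIV_sum u Ts)
        moreover have "(\<lambda>t. (\<Sum>i\<in>I. u t i) / real n) = m" using n0 by (simp add: m[symmetric] fun_eq_iff)
        moreover have "(\<Sum>i\<in>I. - u (T + s) i + tanh (\<beta> * m (T + s))) / real n = - m (T + s) + tanh (\<beta> * m (T + s))"
          using n0 by (simp add: sum_subtractf m[symmetric] field_simps)
        ultimately show ?thesis by simp
      qed
      have shift: "((\<lambda>s. f (T + s)) has_real_derivative D) (at s)"
        if "(f has_real_derivative D) (at (T + s))" for f D
      proof -
        have "((\<lambda>s. T + s) has_real_derivative 1) (at s)" by (auto intro!: derivative_eq_intros)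
        from DERIV_chain2[where f = f and g = "\<lambda>s. T + s" and x = s, OF that this] show ?thesis by simp
      qed
      have "((\<lambda>s. h s i) has_real_derivative (- u (T + s) i + tanh (\<beta> * m (T + s))) -
          \<beta> * (- m (T + s) + tanh (\<beta> * m (T + s)))) (at s)"
        unfolding h_def by (intro DERIV_diff DERIV_cmult shift dm u[OF Ts(2) i, THEN shift])
      then show "((\<lambda>s. h s i) has_real_derivative - h s i + (1 - \<beta>) * tanh (\<beta> * m (T + s))) (at s)"
        by (simp add: h_def algebra_simps)
    qed (rule g1)
    ultimately show ?thesis unfolding error_bound_def by linarith
  qed
  finally show ?thesis by (simp add: h_def)
qed

lemma tv_glauber:
  assumes "\<xi> \<in> \<Omega>" "0 \<le> t"
  shows "tv_dist (glauber_law \<beta> n t \<xi>) (cw_measure \<beta> n) = (\<Sum>\<sigma>\<in>\<Omega>. \<bar>H t \<xi> \<sigma> - tilt (\<lambda>_. 0) \<sigma>\<bar>) / 2"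
proof -
  have "cw_measure \<beta> n = point_measure \<Omega> (\<lambda>\<sigma>. ennreal (tilt (\<lambda>_. 0) \<sigma>))"
    unfolding cw_measure_def point_measure_def density_def
    by (rule arg_cong[where f = "measure_of _ _"], rule ext, rule nn_integral_cong) (auto simp: cw_prob_tilt)
  then show ?thesis unfolding glauber_law_def
    using assms by (simp add: tv_dist_point_measure H_nonneg H_sum tilt_sum less_imp_le[OF tilt_pos])
qed

definition tvt :: "(nat \<Rightarrow> real) \<Rightarrow> real" where
  "tvt h = (\<Sum>\<sigma>\<in>\<Omega>. \<bar>tilt h \<sigma> - tilt (\<lambda>_. 0) \<sigma>\<bar>) / 2"

lemma tv_glauber_tilt:
  assumes "\<xi> \<in> \<Omega>" "0 \<le> t" and close: "(\<Sum>\<sigma>\<in>\<Omega>. \<bar>H t \<xi> \<sigma> - tilt h \<sigma>\<bar>) \<le> 2 * \<delta>"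
  shows "\<bar>tv_dist (glauber_law \<beta> n t \<xi>) (cw_measure \<beta> n) - tvt h\<bar> \<le> \<delta>"
proof -
  have "\<bar>(\<Sum>\<sigma>\<in>\<Omega>. \<bar>H t \<xi> \<sigma> - tilt (\<lambda>_. 0) \<sigma>\<bar>) - (\<Sum>\<sigma>\<in>\<Omega>. \<bar>tilt h \<sigma> - tilt (\<lambda>_. 0) \<sigma>\<bar>)\<bar> \<le> (\<Sum>\<sigma>\<in>\<Omega>. \<bar>H t \<xi> \<sigma> - tilt h \<sigma>\<bar>)"
    unfolding sum_subtractf[symmetric] by (rule order_trans[OF sum_abs sum_mono]) linarith
  then show ?thesis unfolding tv_glauber[OF assms(1,2)] tvt_def using close by linarith
qed

end

section \<open>Linear statistics under the Curie-Weiss measure\<close>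

context curie_weiss
begin

definition W :: "(nat \<Rightarrow> real) \<Rightarrow> (nat \<Rightarrow> int) \<Rightarrow> real" where
  "W h \<sigma> = (\<Sum>i\<in>I. h i * real_of_int (\<sigma> i))"

text \<open>The leading-order variance of \<open>W h\<close> under the stationary measure. The
  covariance matrix is asymptotically the inverse of the identity minus the matrix with all entries
  \<open>\<beta> / n\<close>, and the second summand is its rank-one correction.\<close>

definition V :: "(nat \<Rightarrow> real) \<Rightarrow> real" where
  "V h = (\<Sum>i\<in>I. (h i)\<^sup>2) + \<beta> / (1 - \<beta>) * ((\<Sum>i\<in>I. h i)\<^sup>2 / real n)"

lemma V_nonneg: "0 \<le> V h"
  using beta_nonneg beta_less by (simp add: V_def sum_nonneg)

lemma sum_abs_h_le:
  assumes "\<And>i. i \<in> I \<Longrightarrow> \<bar>h i\<bar> \<le> B / sqrt (real n)"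
  shows "(\<Sum>i\<in>I. \<bar>h i\<bar>) \<le> B * sqrt (real n)"
proof -
  have "(\<Sum>i\<in>I. \<bar>h i\<bar>) \<le> (\<Sum>i\<in>I. B / sqrt (real n))" by (rule sum_mono) (rule assms)
  also have "\<dots> = B * (real n / sqrt (real n))" by simp
  also have "real n / sqrt (real n) = sqrt (real n)" by (rule real_div_sqrt) simp
  finally show ?thesis .
qed

text \<open>Solves the approximate linear system \<open>a i = \<beta> / n * (\<Sum>j\<in>I. a j) + q * h i\<close>.\<close>

lemma linear_response:
  assumes B: "0 \<le> B" "\<And>i. i \<in> I \<Longrightarrow> \<bar>h i\<bar> \<le> B / sqrt (real n)" and C: "0 \<le> C"
    and a: "\<And>i. i \<in> I \<Longrightarrow> \<bar>a i - \<beta> / real n * (\<Sum>j\<in>I. a j) - q * h i\<bar> \<le> C / real n"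
  shows "\<bar>(\<Sum>i\<in>I. h i * a i) - q * V h\<bar> \<le> 2 * B * C / (1 - \<beta>) / sqrt (real n)"
proof -
  define s where "s = sqrt (real n)"
  have s: "s > 0" "s * s = real n" using n_pos by (auto simp: s_def)
  define P where "P = (\<Sum>j\<in>I. a j)"
  define \<epsilon> where "\<epsilon> = (\<lambda>i. a i - \<beta> / real n * P - q * h i)"
  have \<epsilon>: "\<bar>\<epsilon> i\<bar> \<le> C / real n" if "i \<in> I" for i using a[OF that] by (simp add: \<epsilon>_def P_def)
  define E where "E = (\<Sum>i\<in>I. \<epsilon> i)"
  have E: "\<bar>E\<bar> \<le> C"
  proof -
    have "\<bar>E\<bar> \<le> (\<Sum>i\<in>I. C / real n)" unfolding E_def by (rule order_trans[OF sum_abs sum_mono]) (rule \<epsilon>)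
    then show ?thesis using n_pos by simp
  qed
  have "E = (\<Sum>i\<in>I. a i) - real n * (\<beta> / real n * P) - q * (\<Sum>i\<in>I. h i)"
    unfolding E_def \<epsilon>_def sum_subtractf sum_distrib_left by simp
  also have "\<dots> = (1 - \<beta>) * P - q * (\<Sum>i\<in>I. h i)" using n_pos by (simp add: P_def algebra_simps)
  finally have P: "P = (q * (\<Sum>i\<in>I. h i) + E) / (1 - \<beta>)" using beta_less by (simp add: field_simps)
  have ai: "a i = \<epsilon> i + \<beta> / real n * P + q * h i" for i by (simp add: \<epsilon>_def)
  have "(\<Sum>i\<in>I. h i * a i) = (\<Sum>i\<in>I. h i * \<epsilon> i + \<beta> / real n * P * h i + q * (h i)\<^sup>2)"
    unfolding ai by (intro sum.cong refl) (simp add: power2_eq_square algebra_simps)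
  also have "\<dots> = (\<Sum>i\<in>I. h i * \<epsilon> i) + \<beta> / real n * P * (\<Sum>i\<in>I. h i) + q * (\<Sum>i\<in>I. (h i)\<^sup>2)"
    by (simp add: sum.distrib sum_distrib_left)
  also have "\<beta> / real n * P * (\<Sum>i\<in>I. h i) = q * (\<beta> / (1 - \<beta>) * ((\<Sum>i\<in>I. h i)\<^sup>2 / real n)) + \<beta> / (1 - \<beta>) * ((\<Sum>i\<in>I. h i) / real n) * E"
  proof -
    have "b / m * ((q * S + E) / d) * S = q * (b / d * (S\<^sup>2 / m)) + b / d * (S / m) * E" for b m d S :: real
      by (simp add: power2_eq_square add_divide_distrib algebra_simps)
    then show ?thesis unfolding P .
  qed
  finally have "(\<Sum>i\<in>I. h i * a i) - q * V h = (\<Sum>i\<in>I. h i * \<epsilon> i) + \<beta> / (1 - \<beta>) * ((\<Sum>i\<in>I. h i) / real n) * E"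
    by (simp add: V_def distrib_left)
  moreover have "\<bar>\<Sum>i\<in>I. h i * \<epsilon> i\<bar> \<le> B * C / s"
  proof -
    have "\<bar>\<Sum>i\<in>I. h i * \<epsilon> i\<bar> \<le> (\<Sum>i\<in>I. \<bar>h i\<bar> * (C / real n))"
      unfolding abs_mult[symmetric]
      by (rule order_trans[OF sum_abs sum_mono]) (unfold abs_mult, intro mult_left_mono \<epsilon>, auto)
    also have "\<dots> = (\<Sum>i\<in>I. \<bar>h i\<bar>) * (C / real n)" by (rule sum_distrib_right[symmetric])
    also have "\<dots> \<le> (B * s) * (C / real n)"
      using sum_abs_h_le[OF B(2)] C by (intro mult_right_mono) (auto simp: s_def)
    also have "\<dots> = B * C / s" using s by (simp flip: s(2))
    finally show ?thesis .
  qed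
  moreover have "\<bar>\<beta> / (1 - \<beta>) * ((\<Sum>i\<in>I. h i) / real n) * E\<bar> \<le> 1 / (1 - \<beta>) * (B / s) * C"
  proof -
    have "\<bar>\<Sum>i\<in>I. h i\<bar> \<le> B * s" unfolding s_def by (rule order_trans[OF sum_abs sum_abs_h_le]) (rule B(2))
    then have "\<bar>(\<Sum>i\<in>I. h i) / real n\<bar> \<le> B * s / real n" using n_pos by (simp add: divide_right_mono)
    also have "\<dots> = B / s" using s by (simp flip: s(2))
    finally have "\<bar>(\<Sum>i\<in>I. h i) / real n\<bar> \<le> B / s" .
    moreover have "\<bar>\<beta> / (1 - \<beta>)\<bar> \<le> 1 / (1 - \<beta>)"
      using beta_nonneg beta_less by (simp add: divide_right_mono)
    ultimately show ?thesis unfolding abs_mult using E B C s beta_less by (intro mult_mono) auto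
  qed
  moreover have "B * C / s \<le> 1 / (1 - \<beta>) * (B / s) * C"
  proof -
    have "1 * (B / s * C) \<le> 1 / (1 - \<beta>) * (B / s * C)"
      using B C s beta_less beta_nonneg by (intro mult_right_mono) (auto simp: field_simps)
    then show ?thesis by simp
  qed
  ultimately have "\<bar>(\<Sum>i\<in>I. h i * a i) - q * V h\<bar> \<le> 2 * (1 / (1 - \<beta>) * (B / s) * C)" by linarith
  then show ?thesis by (simp add: s_def mult_ac)
qed

text \<open>Two errors of order \<open>1 / n\<close>: the own spin left out of \<open>fld\<close>,
  and the squared argument from \<open>tanh_approx\<close>.\<close>

lemma tanh_field_linear:
  assumes B: "0 \<le> B" and k: "\<bar>k\<bar> \<le> B / sqrt (real n)" and \<sigma>: "\<sigma> \<in> \<Omega>" and i: "i \<in> I"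
  shows "\<bar>tanh (fld i \<sigma> + k) - (\<beta> / real n * mag I \<sigma> + k)\<bar> \<le>
    (1 + 2 * B\<^sup>2 + 2 * ((\<bar>mag I \<sigma>\<bar> + 1)\<^sup>2 / real n)) / real n"
proof -
  define X where "X = \<bar>mag I \<sigma>\<bar> + 1"
  define y where "y = fld i \<sigma> + k"
  have f: "\<bar>fld i \<sigma>\<bar> \<le> X / real n"
  proof -
    have "\<bar>fld i \<sigma>\<bar> \<le> \<beta> * X / real n" using fld_abs_le_mag[OF \<sigma> i] by (simp add: X_def)
    also have "\<dots> \<le> 1 * X / real n"
      using beta_less by (intro divide_right_mono mult_right_mono) (auto simp: X_def)
    finally show ?thesis by simp
  qed
  have "\<bar>y\<bar> \<le> X / real n + B / sqrt (real n)" using f k by (simp add: y_def)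
  then have "\<bar>y\<bar>\<^sup>2 \<le> (X / real n + B / sqrt (real n))\<^sup>2" by (intro power_mono) auto
  also have "\<dots> \<le> 2 * ((X / real n)\<^sup>2 + (B / sqrt (real n))\<^sup>2)"
    using sum_squares_bound[of "X / real n" "B / sqrt (real n)"] by (simp add: power2_sum)
  also have "\<dots> = (2 * B\<^sup>2 + 2 * (X\<^sup>2 / real n)) / real n"
    by (simp add: power_divide add_divide_distrib power2_eq_square[of "real n"])
  finally have "y\<^sup>2 \<le> (2 * B\<^sup>2 + 2 * (X\<^sup>2 / real n)) / real n" by simp
  then have "\<bar>tanh y - y\<bar> \<le> (2 * B\<^sup>2 + 2 * (X\<^sup>2 / real n)) / real n"
    using tanh_approx[of y] by linarith
  moreover have "\<bar>y - (\<beta> / real n * mag I \<sigma> + k)\<bar> \<le> 1 / real n"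
  proof -
    have "\<bar>y - (\<beta> / real n * mag I \<sigma> + k)\<bar> \<le> \<beta> / real n" using fld_bound[OF \<sigma> i] by (simp add: y_def)
    also have "\<dots> \<le> 1 / real n" using beta_less by (intro divide_right_mono) auto
    finally show ?thesis .
  qed
  ultimately have "\<bar>tanh y - (\<beta> / real n * mag I \<sigma> + k)\<bar> \<le> (2 * B\<^sup>2 + 2 * (X\<^sup>2 / real n)) / real n + 1 / real n"
    by linarith
  then show ?thesis by (simp add: y_def X_def add_divide_distrib)
qed

text \<open>The sum of the constant in \<open>ex_tanh_field\<close> and of the one from the
  trigonometric error terms in \<open>ex_W_sin\<close>; large enough for both uses of
  \<open>linear_response\<close>.\<close>

definition C1 :: "real \<Rightarrow> real" where "C1 B = 1 + 5 * B\<^sup>2 + B + (2 + B) * M0 B"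

lemma M0_pos: "0 < M0 A"
  using beta_less by (simp add: M0_def add_pos_nonneg)

lemma C1_pos: "0 \<le> B \<Longrightarrow> 0 < C1 B"
  using M0_pos[of B] by (simp add: C1_def add_pos_nonneg)

lemma ex_tanh_field:
  assumes B: "0 \<le> B" and k: "\<And>i. i \<in> I \<Longrightarrow> \<bar>k i\<bar> \<le> B / sqrt (real n)" and i: "i \<in> I"
  shows "ex k (\<lambda>\<sigma>. \<bar>tanh (fld i \<sigma> + k i) - (\<beta> / real n * mag I \<sigma> + k i)\<bar>) \<le> (1 + 2 * B\<^sup>2 + 2 * M0 B) / real n"
proof -
  have "ex k (\<lambda>\<sigma>. \<bar>tanh (fld i \<sigma> + k i) - (\<beta> / real n * mag I \<sigma> + k i)\<bar>) \<le>
     ex k (\<lambda>\<sigma>. (1 + 2 * B\<^sup>2 + 2 * ((\<bar>mag I \<sigma>\<bar> + 1)\<^sup>2 / real n)) / real n)"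
    by (rule ex_mono) (rule tanh_field_linear[OF B k[OF i] _ i])
  also have "\<dots> = (1 + 2 * B\<^sup>2 + 2 * (ex k (\<lambda>\<sigma>. (\<bar>mag I \<sigma>\<bar> + 1)\<^sup>2) / real n)) / real n"
    unfolding ex_divide ex_add ex_cmult ex_const ..
  also have "\<dots> \<le> (1 + 2 * B\<^sup>2 + 2 * M0 B) / real n"
    using second_moment_bound[OF B k] n_pos
    by (intro divide_right_mono add_left_mono mult_left_mono) (auto simp: pos_divide_le_eq)
  finally show ?thesis .
qed

lemma ex_spin: "i \<in> I \<Longrightarrow> (\<And>\<sigma>. \<sigma> \<in> \<Omega> \<Longrightarrow> \<phi> (flip i \<sigma>) = \<phi> \<sigma>) \<Longrightarrow>
   ex k (\<lambda>\<sigma>. real_of_int (\<sigma> i) * \<phi> \<sigma>) = ex k (\<lambda>\<sigma>. tanh (fld i \<sigma> + k i) * \<phi> \<sigma>)"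
  using spin_conditional_mean[of i \<phi> k]
  by (simp add: ex_def right_diff_distrib left_diff_distrib sum_subtractf mult.assoc)

text \<open>Replacing each spin by its linearized conditional mean shows that the spin means under
  the field \<open>l * h\<close> solve the system of \<open>linear_response\<close> with
  \<open>q = l\<close>.\<close>

lemma ex_W_mean:
  assumes B: "0 \<le> B" "\<And>i. i \<in> I \<Longrightarrow> \<bar>h i\<bar> \<le> B / sqrt (real n)" and l: "0 \<le> l" "l \<le> 1"
  shows "\<bar>ex (\<lambda>i. l * h i) (W h) - l * V h\<bar> \<le> 2 * B * C1 B / (1 - \<beta>) / sqrt (real n)"
proof -
  define k where "k = (\<lambda>i. l * h i)"
  have k: "\<bar>k i\<bar> \<le> B / sqrt (real n)" if "i \<in> I" for i
  proof -
    have "\<bar>k i\<bar> \<le> 1 * \<bar>h i\<bar>" unfolding k_def abs_mult using l by (intro mult_right_mono) auto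
    then show ?thesis using B(2)[OF that] by simp
  qed
  define a where "a = (\<lambda>i. ex k (\<lambda>\<sigma>. real_of_int (\<sigma> i)))"
  have S: "(\<Sum>j\<in>I. a j) = ex k (mag I)" unfolding a_def mag_def ex_sum[symmetric] ..
  have "\<bar>(\<Sum>i\<in>I. h i * a i) - l * V h\<bar> \<le> 2 * B * C1 B / (1 - \<beta>) / sqrt (real n)"
  proof (rule linear_response[OF B])
    fix i assume i: "i \<in> I"
    have "a i = ex k (\<lambda>\<sigma>. tanh (fld i \<sigma> + k i))" using ex_spin[OF i, of "\<lambda>_. 1" k] by (simp add: a_def)
    then have "a i - \<beta> / real n * (\<Sum>j\<in>I. a j) - l * h i = ex k (\<lambda>\<sigma>. tanh (fld i \<sigma> + k i) - (\<beta> / real n * mag I \<sigma> + k i))"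
      unfolding S ex_diff ex_add ex_cmult ex_const by (simp add: k_def)
    also have "\<bar>\<dots>\<bar> \<le> (1 + 2 * B\<^sup>2 + 2 * M0 B) / real n"
      by (rule order_trans[OF ex_abs ex_tanh_field[OF B(1) k i]])
    also have "\<dots> \<le> C1 B / real n"
      using B(1) M0_pos[of B] by (intro divide_right_mono) (auto simp: C1_def distrib_right)
    finally show "\<bar>a i - \<beta> / real n * (\<Sum>j\<in>I. a j) - l * h i\<bar> \<le> C1 B / real n" .
  qed (use C1_pos[OF B(1)] in auto)
  moreover have "(\<Sum>i\<in>I. h i * a i) = ex k (W h)"
    unfolding a_def ex_cmult[symmetric] ex_sum[symmetric] W_def ..
  ultimately show ?thesis by (simp add: k_def)
qed

definition logZ :: "(nat \<Rightarrow> real) \<Rightarrow> real" where "logZ h = ln (pf h / pf (\<lambda>_. 0))"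

text \<open>Along the fields \<open>l * h\<close> the log partition function has derivative
  \<open>ex (W h)\<close>, which is close to \<open>l * V h\<close>; going from \<open>l = 0\<close>
  to \<open>l = 1\<close> gives half of \<open>V h\<close>.\<close>

lemma logZ_approx:
  assumes B: "0 \<le> B" "\<And>i. i \<in> I \<Longrightarrow> \<bar>h i\<bar> \<le> B / sqrt (real n)"
  shows "\<bar>logZ h - V h / 2\<bar> \<le> 2 * B * C1 B / (1 - \<beta>) / sqrt (real n)"
proof -
  define f where "f = (\<lambda>l. ln (pf (\<lambda>i. l * h i)) - l\<^sup>2 / 2 * V h)"
  have "(f has_real_derivative ex (\<lambda>i. l * h i) (W h) - l * V h) (at l)" for l
  proof -
    have w: "((\<lambda>l. wt (\<lambda>i. l * h i) \<sigma>) has_real_derivative wt (\<lambda>i. l * h i) \<sigma> * W h \<sigma>) (at l)" for \<sigma>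
      unfolding wt_def W_def by (auto intro!: derivative_eq_intros)
    have p: "((\<lambda>l. pf (\<lambda>i. l * h i)) has_real_derivative (\<Sum>\<sigma>\<in>\<Omega>. wt (\<lambda>i. l * h i) \<sigma> * W h \<sigma>)) (at l)"
      unfolding pf_def by (intro DERIV_sum w)
    have d: "((\<lambda>l. ln (pf (\<lambda>i. l * h i))) has_real_derivative 1 / pf (\<lambda>i. l * h i) * (\<Sum>\<sigma>\<in>\<Omega>. wt (\<lambda>i. l * h i) \<sigma> * W h \<sigma>)) (at l)"
      by (rule DERIV_chain2[OF DERIV_ln_divide[OF pf_pos] p])
    have e: "1 / pf (\<lambda>i. l * h i) * (\<Sum>\<sigma>\<in>\<Omega>. wt (\<lambda>i. l * h i) \<sigma> * W h \<sigma>) = ex (\<lambda>i. l * h i) (W h)"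
      by (simp add: ex_def tilt_def sum_divide_distrib)
    have "((\<lambda>l. l\<^sup>2 / 2 * V h) has_real_derivative l * V h) (at l)"
      by (auto intro!: derivative_eq_intros)
    with d[unfolded e] show ?thesis unfolding f_def by (rule DERIV_diff)
  qed
  from MVT2[of 0 1 f "\<lambda>l. ex (\<lambda>i. l * h i) (W h) - l * V h", OF _ this]
  obtain l where l: "0 < l" "l < 1" "f 1 - f 0 = ex (\<lambda>i. l * h i) (W h) - l * V h" by auto
  have "f 1 - f 0 = logZ h - V h / 2"
    using pf_pos[of h] pf_pos[of "\<lambda>_. 0"] by (simp add: f_def logZ_def ln_div)
  moreover have "\<bar>ex (\<lambda>i. l * h i) (W h) - l * V h\<bar> \<le> 2 * B * C1 B / (1 - \<beta>) / sqrt (real n)"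
    using l by (intro ex_W_mean B) auto
  ultimately show ?thesis using l(3) by simp
qed

text \<open>The likelihood ratio is \<open>exp (W h \<sigma> - logZ h)\<close>, and total variation
  is 1 minus the overlap. This form is a bounded continuous function of \<open>W h\<close>, suited
  to weak convergence.\<close>

lemma tvt_eq: "tvt h = 1 - ex (\<lambda>_. 0) (\<lambda>\<sigma>. min 1 (exp (W h \<sigma> - logZ h)))"
proof -
  have r: "tilt h \<sigma> = tilt (\<lambda>_. 0) \<sigma> * exp (W h \<sigma> - logZ h)" for \<sigma>
  proof -
    have "wt h \<sigma> = wt (\<lambda>_. 0) \<sigma> * exp (W h \<sigma>)" by (simp add: wt_def W_def exp_add)
    moreover have "exp (logZ h) = pf h / pf (\<lambda>_. 0)" by (simp add: logZ_def pf_pos)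
    ultimately show ?thesis using pf_pos[of h] pf_pos[of "\<lambda>_. 0"] by (simp add: tilt_def exp_diff)
  qed
  have "(\<Sum>\<sigma>\<in>\<Omega>. \<bar>tilt h \<sigma> - tilt (\<lambda>_. 0) \<sigma>\<bar>) =
      (\<Sum>\<sigma>\<in>\<Omega>. tilt h \<sigma> + tilt (\<lambda>_. 0) \<sigma> - 2 * (tilt (\<lambda>_. 0) \<sigma> * min 1 (exp (W h \<sigma> - logZ h))))"
  proof (rule sum.cong[OF refl])
    fix \<sigma>
    have "tilt (\<lambda>_. 0) \<sigma> * min 1 (exp (W h \<sigma> - logZ h)) = min (tilt (\<lambda>_. 0) \<sigma>) (tilt h \<sigma>)"
      unfolding r[of \<sigma>] using tilt_pos[of "\<lambda>_. 0" \<sigma>] by (auto simp: min_def mult_le_cancel_left1)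
    then show "\<bar>tilt h \<sigma> - tilt (\<lambda>_. 0) \<sigma>\<bar> =
       tilt h \<sigma> + tilt (\<lambda>_. 0) \<sigma> - 2 * (tilt (\<lambda>_. 0) \<sigma> * min 1 (exp (W h \<sigma> - logZ h)))"
      by (simp add: min_def)
  qed
  also have "\<dots> = 2 - 2 * ex (\<lambda>_. 0) (\<lambda>\<sigma>. min 1 (exp (W h \<sigma> - logZ h)))"
    by (simp add: sum_subtractf sum.distrib tilt_sum ex_def sum_distrib_left)
  finally show ?thesis by (simp add: tvt_def)
qed

lemma min_exp_lipschitz: "\<bar>min 1 (exp x) - min 1 (exp y)\<bar> \<le> \<bar>x - (y::real)\<bar>"
proof -
  have *: "\<bar>min 1 (exp x) - min 1 (exp y)\<bar> \<le> \<bar>x - y\<bar>" if "y \<le> x" for x y :: real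
  proof -
    define x' y' where "x' = min 0 x" and "y' = min 0 y"
    have m: "min 1 (exp z) = exp (min 0 z)" for z :: real by (auto simp: min_def)
    have "exp x' * (1 + (y' - x')) \<le> exp x' * exp (y' - x')"
      by (intro mult_left_mono exp_ge_add_one_self) auto
    then have "exp x' - exp y' \<le> exp x' * (x' - y')" by (simp add: exp_diff algebra_simps)
    also have "\<dots> \<le> 1 * (x' - y')" using that by (intro mult_right_mono) (auto simp: x'_def y'_def min_def)
    also have "\<dots> \<le> x - y" using that by (auto simp: x'_def y'_def min_def)
    finally have "exp x' - exp y' \<le> x - y" .
    moreover have "exp y' \<le> exp x'" using that by (auto simp: x'_def y'_def min_def)
    ultimately show ?thesis using that unfolding m x'_def y'_def by simp
  qed
  show ?thesis using *[of x y] *[of y x] by (cases "y \<le> x") (auto simp: abs_minus_commute)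
qed

lemma tvt_approx:
  assumes B: "0 \<le> B" "\<And>i. i \<in> I \<Longrightarrow> \<bar>h i\<bar> \<le> B / sqrt (real n)"
  shows "\<bar>tvt h - (1 - ex (\<lambda>_. 0) (\<lambda>\<sigma>. min 1 (exp (W h \<sigma> - v / 2))))\<bar> \<le>
     2 * B * C1 B / (1 - \<beta>) / sqrt (real n) + \<bar>V h - v\<bar>"
proof -
  have "\<bar>tvt h - (1 - ex (\<lambda>_. 0) (\<lambda>\<sigma>. min 1 (exp (W h \<sigma> - v / 2))))\<bar> =
      \<bar>ex (\<lambda>_. 0) (\<lambda>\<sigma>. min 1 (exp (W h \<sigma> - v / 2)) - min 1 (exp (W h \<sigma> - logZ h)))\<bar>"
    unfolding tvt_eq ex_diff by simp
  also have "\<dots> \<le> ex (\<lambda>_. 0) (\<lambda>\<sigma>. \<bar>min 1 (exp (W h \<sigma> - v / 2)) - min 1 (exp (W h \<sigma> - logZ h))\<bar>)"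
    by (rule ex_abs)
  also have "\<dots> \<le> ex (\<lambda>_. 0) (\<lambda>\<sigma>. \<bar>logZ h - v / 2\<bar>)"
  proof (rule ex_mono)
    fix \<sigma>
    show "\<bar>min 1 (exp (W h \<sigma> - v / 2)) - min 1 (exp (W h \<sigma> - logZ h))\<bar> \<le> \<bar>logZ h - v / 2\<bar>"
      using min_exp_lipschitz[of "W h \<sigma> - v / 2" "W h \<sigma> - logZ h"] by simp
  qed
  also have "\<dots> \<le> 2 * B * C1 B / (1 - \<beta>) / sqrt (real n) + \<bar>V h - v\<bar>"
  proof -
    have "\<bar>logZ h - V h / 2\<bar> \<le> 2 * B * C1 B / (1 - \<beta>) / sqrt (real n)" by (intro logZ_approx B)
    then show ?thesis unfolding ex_const by linarith
  qed
  finally show ?thesis .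
qed

section \<open>The characteristic function of a linear statistic\<close>

definition neg :: "(nat \<Rightarrow> int) \<Rightarrow> nat \<Rightarrow> int" where
  "neg \<sigma> = (\<lambda>i. if i \<in> I then - \<sigma> i else \<sigma> i)"

text \<open>Without external field the weight depends only on the squared magnetization. Only sites
  in \<open>I\<close> are negated, so that configurations keep their default value
  elsewhere.\<close>

lemma ex_neg: "ex (\<lambda>_. 0) (\<lambda>\<sigma>. f (neg \<sigma>)) = ex (\<lambda>_. 0) f"
proof -
  have n1: "neg \<sigma> \<in> \<Omega>" if "\<sigma> \<in> \<Omega>" for \<sigma>
    using that unfolding spin_configs_def neg_def I_def by (auto simp: PiE_iff extensional_def)
  have n2: "neg (neg \<sigma>) = \<sigma>" for \<sigma> by (auto simp: neg_def)
  have "mag I (neg \<sigma>) = - mag I \<sigma>" for \<sigma> unfolding mag_def by (simp add: neg_def sum_negf)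
  then have "tilt (\<lambda>_. 0) (neg \<sigma>) = tilt (\<lambda>_. 0) \<sigma>" for \<sigma> by (simp add: tilt_def wt_def)
  then show ?thesis unfolding ex_def
    by (intro sum.reindex_bij_witness[where i = neg and j = neg]) (simp_all add: n1 n2)
qed

lemma ex_sin_W: "ex (\<lambda>_. 0) (\<lambda>\<sigma>. sin (x * W h \<sigma>)) = 0"
proof -
  have "W h (neg \<sigma>) = - W h \<sigma>" for \<sigma> unfolding W_def by (simp add: neg_def sum_negf)
  then have "ex (\<lambda>_. 0) (\<lambda>\<sigma>. sin (x * W h \<sigma>)) = ex (\<lambda>_. 0) (\<lambda>\<sigma>. - 1 * sin (x * W h \<sigma>))"
    using ex_neg[of "\<lambda>\<sigma>. sin (x * W h \<sigma>)"] by simp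
  then show ?thesis unfolding ex_cmult by simp
qed

lemma sin_approx: "\<bar>sin z - z\<bar> \<le> (z::real)\<^sup>2" and cos_approx: "\<bar>cos z - 1\<bar> \<le> (z::real)\<^sup>2"
proof -
  have "\<bar>sin z - (\<Sum>m<2. sin_coeff m * z ^ m)\<bar> \<le> inverse (fact 2) * \<bar>z\<bar> ^ 2"
    by (rule Maclaurin_sin_bound)
  moreover have "(\<Sum>m<2. sin_coeff m * z ^ m) = z" by (simp add: eval_nat_numeral sin_coeff_def)
  ultimately have "\<bar>sin z - z\<bar> \<le> z\<^sup>2 / 2" by simp
  then show "\<bar>sin z - z\<bar> \<le> z\<^sup>2" by (rule order_trans) simp
  have "\<bar>sin (z / 2)\<bar>\<^sup>2 \<le> \<bar>z / 2\<bar>\<^sup>2" by (intro power_mono abs_sin_x_le_abs_x) auto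
  then have "4 * (sin (z / 2))\<^sup>2 \<le> z\<^sup>2" by (simp add: power_divide)
  then have "2 * (sin (z / 2))\<^sup>2 \<le> z\<^sup>2" using zero_le_power2[of "sin (z / 2)"] by linarith
  then show "\<bar>cos z - 1\<bar> \<le> z\<^sup>2" using cos_double_sin[of "z / 2"] by simp
qed

lemma sin_diff_lipschitz: "\<bar>sin x - sin y\<bar> \<le> \<bar>x - (y::real)\<bar>"
  and cos_diff_lipschitz: "\<bar>cos x - cos y\<bar> \<le> \<bar>x - (y::real)\<bar>"
proof -
  have "\<bar>sin ((x - y) / 2)\<bar> * \<bar>cos ((x + y) / 2)\<bar> \<le> \<bar>(x - y) / 2\<bar> * 1"
    by (intro mult_mono abs_sin_x_le_abs_x) auto
  then show "\<bar>sin x - sin y\<bar> \<le> \<bar>x - y\<bar>" unfolding sin_diff_sin abs_mult by simp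
  have "\<bar>sin ((x + y) / 2)\<bar> * \<bar>sin ((y - x) / 2)\<bar> \<le> 1 * \<bar>(y - x) / 2\<bar>"
    by (intro mult_mono abs_sin_x_le_abs_x) auto
  then show "\<bar>cos x - cos y\<bar> \<le> \<bar>x - y\<bar>" unfolding cos_diff_cos abs_mult by (simp add: abs_minus_commute)
qed

lemma W_spin_split:
  assumes i: "i \<in> I"
  shows "\<sigma> \<in> \<Omega> \<Longrightarrow> W h (flip i \<sigma>) - h i * real_of_int (flip i \<sigma> i) = W h \<sigma> - h i * real_of_int (\<sigma> i)"
  unfolding W_def using i by (simp add: sum.remove[of I i])

text \<open>Stein's method: the correlations \<open>a i\<close> of the spins with
  \<open>sin (x * W h \<sigma>)\<close> solve the system of \<open>linear_response\<close> with
  \<open>q = x * ex (cos (x * W h))\<close>. The bulk part of \<open>a i\<close> yields the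
  mean-field term, and the dependence of the sine on spin \<open>i\<close> itself yields the term
  with \<open>h i\<close>.\<close>

lemma ex_W_sin:
  assumes B: "0 \<le> B" "\<And>i. i \<in> I \<Longrightarrow> \<bar>h i\<bar> \<le> B / sqrt (real n)" "\<And>i. i \<in> I \<Longrightarrow> \<bar>x * h i\<bar> \<le> B / sqrt (real n)"
  shows "\<bar>ex (\<lambda>_. 0) (\<lambda>\<sigma>. W h \<sigma> * sin (x * W h \<sigma>)) - x * ex (\<lambda>_. 0) (\<lambda>\<sigma>. cos (x * W h \<sigma>)) * V h\<bar>
    \<le> 2 * B * C1 B / (1 - \<beta>) / sqrt (real n)"
proof -
  define s where "s = sqrt (real n)"
  have s: "s > 0" "s * s = real n" using n_pos by (auto simp: s_def)
  define E where "E = ex (\<lambda>_. 0)"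
  define \<psi> where "\<psi> = E (\<lambda>\<sigma>. cos (x * W h \<sigma>))"
  define a where "a = (\<lambda>i. E (\<lambda>\<sigma>. real_of_int (\<sigma> i) * sin (x * W h \<sigma>)))"
  have S: "(\<Sum>j\<in>I. a j) = E (\<lambda>\<sigma>. mag I \<sigma> * sin (x * W h \<sigma>))"
    unfolding a_def E_def mag_def ex_sum[symmetric] sum_distrib_right ..
  have "\<bar>(\<Sum>i\<in>I. h i * a i) - (x * \<psi>) * V h\<bar> \<le> 2 * B * C1 B / (1 - \<beta>) / sqrt (real n)"
  proof (rule linear_response[OF B(1,2)])
    fix i assume i: "i \<in> I"
    \<comment> \<open>The argument without spin \<open>i\<close>; being invariant under
      \<open>flip i\<close>, it lets the spin be replaced by its conditional mean.\<close>
    define R where "R = (\<lambda>\<sigma>. x * (W h \<sigma> - h i * real_of_int (\<sigma> i)))"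
    define z where "z = x * h i"
    have z: "\<bar>z\<bar> \<le> B / s" using B(3)[OF i] by (simp add: z_def s_def)
    then have "\<bar>z\<bar>\<^sup>2 \<le> (B / s)\<^sup>2" by (intro power_mono) auto
    then have z2: "z\<^sup>2 \<le> B\<^sup>2 / real n" using s by (simp add: power_divide power2_eq_square)
    have Rf: "R (flip i \<sigma>) = R \<sigma>" if "\<sigma> \<in> \<Omega>" for \<sigma>
      using W_spin_split[OF i that, of h] by (simp add: R_def)
    have sp: "real_of_int (\<sigma> i) * real_of_int (\<sigma> i) = 1" if "\<sigma> \<in> \<Omega>" for \<sigma>
      using spin_sq[OF that i] by (simp add: power2_eq_square)
    have xW: "x * W h \<sigma> = R \<sigma> + z * real_of_int (\<sigma> i)" for \<sigma> by (simp add: R_def z_def algebra_simps)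
    have cz: "cos (z * real_of_int (\<sigma> i)) = cos z" "sin (z * real_of_int (\<sigma> i)) = real_of_int (\<sigma> i) * sin z"
      if "\<sigma> \<in> \<Omega>" for \<sigma>
      by (rule spin_cases[OF that i]; simp)+
    define D where "D = (\<lambda>\<sigma>. tanh (fld i \<sigma>) * (cos z * sin (R \<sigma>)) + sin z * cos (R \<sigma>))"
    have "a i = E (\<lambda>\<sigma>. real_of_int (\<sigma> i) * (cos z * sin (R \<sigma>)) + sin z * cos (R \<sigma>))"
      unfolding a_def E_def
    proof (rule ex_cong)
      fix \<sigma> assume \<sigma>: "\<sigma> \<in> \<Omega>"
      have "real_of_int (\<sigma> i) * sin (x * W h \<sigma>) =
          real_of_int (\<sigma> i) * (cos z * sin (R \<sigma>)) + (real_of_int (\<sigma> i) * real_of_int (\<sigma> i)) * (sin z * cos (R \<sigma>))"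
        unfolding xW sin_add cz[OF \<sigma>] by (simp add: algebra_simps)
      then show "real_of_int (\<sigma> i) * sin (x * W h \<sigma>) = real_of_int (\<sigma> i) * (cos z * sin (R \<sigma>)) + sin z * cos (R \<sigma>)"
        unfolding sp[OF \<sigma>] by simp
    qed
    also have "\<dots> = E D"
      unfolding E_def D_def ex_add using ex_spin[OF i, of "\<lambda>\<sigma>. cos z * sin (R \<sigma>)" "\<lambda>_. 0"] Rf by simp
    finally have ai: "a i = E D" .
    have eq: "a i - \<beta> / real n * (\<Sum>j\<in>I. a j) - x * \<psi> * h i =
      E (\<lambda>\<sigma>. D \<sigma> - \<beta> / real n * (mag I \<sigma> * sin (x * W h \<sigma>)) - x * h i * cos (x * W h \<sigma>))"
      unfolding S ai \<psi>_def E_def ex_diff ex_cmult by simp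
    have "\<bar>E (\<lambda>\<sigma>. D \<sigma> - \<beta> / real n * (mag I \<sigma> * sin (x * W h \<sigma>)) - x * h i * cos (x * W h \<sigma>))\<bar> \<le>
      E (\<lambda>\<sigma>. \<bar>tanh (fld i \<sigma> + 0) - (\<beta> / real n * mag I \<sigma> + 0)\<bar> + (3 * B\<^sup>2 + B + B * ((\<bar>mag I \<sigma>\<bar> + 1)\<^sup>2 / real n)) / real n)"
      unfolding E_def
    proof (rule order_trans[OF ex_abs ex_mono])
      fix \<sigma> assume \<sigma>: "\<sigma> \<in> \<Omega>"
      define th where "th = tanh (fld i \<sigma>)"
      define p where "p = \<beta> / real n * mag I \<sigma>"
      define X where "X = \<bar>mag I \<sigma>\<bar> + 1"
      have th1: "\<bar>th\<bar> \<le> 1" using abs_tanh_less_1[of "fld i \<sigma>"] by (simp add: th_def)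
      have dsin: "\<bar>sin (R \<sigma>) - sin (x * W h \<sigma>)\<bar> \<le> \<bar>z\<bar>" and dcos: "\<bar>cos (R \<sigma>) - cos (x * W h \<sigma>)\<bar> \<le> \<bar>z\<bar>"
      proof -
        have l: "\<bar>R \<sigma> - x * W h \<sigma>\<bar> = \<bar>z\<bar>" using spin_abs[OF \<sigma> i] by (simp add: xW abs_mult)
        show "\<bar>sin (R \<sigma>) - sin (x * W h \<sigma>)\<bar> \<le> \<bar>z\<bar>"
          using sin_diff_lipschitz[of "R \<sigma>" "x * W h \<sigma>"] l by simp
        show "\<bar>cos (R \<sigma>) - cos (x * W h \<sigma>)\<bar> \<le> \<bar>z\<bar>"
          using cos_diff_lipschitz[of "R \<sigma>" "x * W h \<sigma>"] l by simp
      qed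
      \<comment> \<open>The five terms: linearizing \<open>tanh\<close>, restoring spin
        \<open>i\<close> in the sine, \<open>cos z\<close> against 1, \<open>sin z\<close> against
        \<open>z\<close>, and restoring spin \<open>i\<close> in the cosine. With \<open>z\<close>
        of order \<open>n^(-1/2)\<close> each has expectation \<open>O(1/n)\<close>.\<close>
      have "D \<sigma> - p * sin (x * W h \<sigma>) - z * cos (x * W h \<sigma>) =
          (th - p) * sin (R \<sigma>) + p * (sin (R \<sigma>) - sin (x * W h \<sigma>)) + th * (cos z - 1) * sin (R \<sigma>)
          + (sin z - z) * cos (R \<sigma>) + z * (cos (R \<sigma>) - cos (x * W h \<sigma>))"
        by (simp add: D_def th_def algebra_simps)
      also have "\<bar>\<dots>\<bar> \<le> \<bar>th - p\<bar> + \<bar>p\<bar> * \<bar>z\<bar> + z\<^sup>2 + z\<^sup>2 + \<bar>z\<bar> * \<bar>z\<bar>"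
      proof -
        have tri: "\<bar>a + b + c + d + e\<bar> \<le> \<bar>a\<bar> + \<bar>b\<bar> + \<bar>c\<bar> + \<bar>d\<bar> + \<bar>e\<bar>" for a b c d e :: real
          by linarith
        have t1: "\<bar>(th - p) * sin (R \<sigma>)\<bar> \<le> \<bar>th - p\<bar> * 1" unfolding abs_mult by (intro mult_left_mono) auto
        have t2: "\<bar>p * (sin (R \<sigma>) - sin (x * W h \<sigma>))\<bar> \<le> \<bar>p\<bar> * \<bar>z\<bar>"
          unfolding abs_mult by (intro mult_left_mono dsin) auto
        have t3: "\<bar>th * (cos z - 1) * sin (R \<sigma>)\<bar> \<le> 1 * z\<^sup>2 * 1"
          unfolding abs_mult using th1 by (intro mult_mono cos_approx) auto
        have t4: "\<bar>(sin z - z) * cos (R \<sigma>)\<bar> \<le> z\<^sup>2 * 1"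
          unfolding abs_mult by (intro mult_mono sin_approx) auto
        have t5: "\<bar>z * (cos (R \<sigma>) - cos (x * W h \<sigma>))\<bar> \<le> \<bar>z\<bar> * \<bar>z\<bar>"
          unfolding abs_mult by (intro mult_left_mono dcos) auto
        from order_trans[OF tri add_mono[OF add_mono[OF add_mono[OF add_mono[OF t1 t2] t3] t4] t5]]
        show ?thesis by simp
      qed
      also have "\<dots> = \<bar>th - p\<bar> + \<bar>p\<bar> * \<bar>z\<bar> + 3 * z\<^sup>2" by (simp add: power2_eq_square)
      also have "\<bar>p\<bar> * \<bar>z\<bar> \<le> B * (1 + X\<^sup>2 / real n) / real n"
      proof -
        have "\<bar>p\<bar> \<le> X / real n"
        proof -
          have "\<bar>p\<bar> = \<beta> * \<bar>mag I \<sigma>\<bar> / real n" using beta_nonneg by (simp add: p_def abs_mult)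
          also have "\<dots> \<le> 1 * X / real n"
            using beta_less beta_nonneg by (intro divide_right_mono mult_mono) (auto simp: X_def)
          finally show ?thesis by simp
        qed
        then have "\<bar>p\<bar> * \<bar>z\<bar> \<le> X / real n * (B / s)" using z by (intro mult_mono) (auto simp: X_def)
        also have "\<dots> = B * (X / s) / real n" by (simp add: mult_ac)
        also have "\<dots> \<le> B * (1 + X\<^sup>2 / real n) / real n"
        proof -
          have "0 \<le> X / s" using s by (simp add: X_def)
          moreover have "(X / s)\<^sup>2 = X\<^sup>2 / real n" unfolding s(2)[symmetric] by (simp add: power_divide power2_eq_square)
          ultimately have "X / s \<le> 1 + X\<^sup>2 / real n" using sum_squares_bound[of "X / s" 1] by simp
          then show ?thesis using B(1) by (intro divide_right_mono mult_left_mono) auto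
        qed
        finally show ?thesis .
      qed
      finally have "\<bar>D \<sigma> - p * sin (x * W h \<sigma>) - z * cos (x * W h \<sigma>)\<bar> \<le>
         \<bar>th - p\<bar> + B * (1 + X\<^sup>2 / real n) / real n + 3 * (B\<^sup>2 / real n)" using z2 by linarith
      also have "\<dots> = \<bar>th - p\<bar> + (3 * B\<^sup>2 + B + B * (X\<^sup>2 / real n)) / real n"
        by (simp add: distrib_left add_divide_distrib)
      finally show "\<bar>D \<sigma> - \<beta> / real n * (mag I \<sigma> * sin (x * W h \<sigma>)) - x * h i * cos (x * W h \<sigma>)\<bar> \<le>
        \<bar>tanh (fld i \<sigma> + 0) - (\<beta> / real n * mag I \<sigma> + 0)\<bar> + (3 * B\<^sup>2 + B + B * ((\<bar>mag I \<sigma>\<bar> + 1)\<^sup>2 / real n)) / real n"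
        by (simp add: th_def p_def X_def z_def)
    qed
    also have "\<dots> \<le> (1 + 2 * B\<^sup>2 + 2 * M0 B) / real n + (3 * B\<^sup>2 + B + B * M0 B) / real n"
      unfolding E_def
    proof (subst ex_add, rule add_mono)
      have B0: "\<bar>0\<bar> \<le> B / sqrt (real n)" using B(1) by simp
      show "ex (\<lambda>_. 0) (\<lambda>\<sigma>. \<bar>tanh (fld i \<sigma> + 0) - (\<beta> / real n * mag I \<sigma> + 0)\<bar>) \<le> (1 + 2 * B\<^sup>2 + 2 * M0 B) / real n"
        using ex_tanh_field[OF B(1) _ i, of "\<lambda>_. 0"] B0 by simp
      have "ex (\<lambda>_. 0) (\<lambda>\<sigma>. (3 * B\<^sup>2 + B + B * ((\<bar>mag I \<sigma>\<bar> + 1)\<^sup>2 / real n)) / real n) =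
         (3 * B\<^sup>2 + B + B * (ex (\<lambda>_. 0) (\<lambda>\<sigma>. (\<bar>mag I \<sigma>\<bar> + 1)\<^sup>2) / real n)) / real n"
        unfolding ex_divide ex_add ex_cmult ex_const ..
      also have "\<dots> \<le> (3 * B\<^sup>2 + B + B * M0 B) / real n"
        using second_moment_bound[OF B(1), of "\<lambda>_. 0"] B0 n_pos B(1)
        by (intro divide_right_mono add_left_mono mult_left_mono) (auto simp: pos_divide_le_eq)
      finally show "ex (\<lambda>_. 0) (\<lambda>\<sigma>. (3 * B\<^sup>2 + B + B * ((\<bar>mag I \<sigma>\<bar> + 1)\<^sup>2 / real n)) / real n) \<le>
         (3 * B\<^sup>2 + B + B * M0 B) / real n" .
    qed
    also have "\<dots> = C1 B / real n" by (simp add: C1_def add_divide_distrib[symmetric] algebra_simps)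
    finally show "\<bar>a i - \<beta> / real n * (\<Sum>j\<in>I. a j) - x * \<psi> * h i\<bar> \<le> C1 B / real n" unfolding eq .
  qed (use C1_pos[OF B(1)] in auto)
  moreover have "(\<Sum>i\<in>I. h i * a i) = E (\<lambda>\<sigma>. W h \<sigma> * sin (x * W h \<sigma>))"
    unfolding a_def E_def ex_cmult[symmetric] ex_sum[symmetric] W_def sum_distrib_right by (simp add: mult_ac)
  ultimately show ?thesis by (simp add: \<psi>_def E_def)
qed

text \<open>By \<open>ex_W_sin\<close> the function \<open>\<psi>\<close> nearly solves
  \<open>\<psi>' y = - y * V h * \<psi> y\<close>. Multiplied by the inverse of the Gaussian
  solution it has a small derivative; in the mean value theorem that weight is largest at
  \<open>x\<close>, where it cancels.\<close>

lemma cos_W_approx: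
  assumes x: "0 \<le> x" and B: "0 \<le> B" "\<And>i. i \<in> I \<Longrightarrow> \<bar>h i\<bar> \<le> B / sqrt (real n)"
    "\<And>i. i \<in> I \<Longrightarrow> \<bar>x * h i\<bar> \<le> B / sqrt (real n)"
  shows "\<bar>ex (\<lambda>_. 0) (\<lambda>\<sigma>. cos (x * W h \<sigma>)) - exp (- (x\<^sup>2 * V h / 2))\<bar> \<le>
    x * (2 * B * C1 B / (1 - \<beta>) / sqrt (real n))"
proof (cases "x = 0")
  case True
  then show ?thesis by simp
next
  case False
  with x have x0: "0 < x" by simp
  define \<delta> where "\<delta> = 2 * B * C1 B / (1 - \<beta>) / sqrt (real n)"
  define \<psi> where "\<psi> = (\<lambda>y. ex (\<lambda>_. 0) (\<lambda>\<sigma>. cos (y * W h \<sigma>)))"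
  define \<psi>' where "\<psi>' = (\<lambda>y. - ex (\<lambda>_. 0) (\<lambda>\<sigma>. W h \<sigma> * sin (y * W h \<sigma>)))"
  define f where "f = (\<lambda>y. \<psi> y * exp (y\<^sup>2 * V h / 2))"
  define f' where "f' = (\<lambda>y. (\<psi>' y + y * \<psi> y * V h) * exp (y\<^sup>2 * V h / 2))"
  have d: "(f has_real_derivative f' y) (at y)" for y
  proof -
    have "(\<psi> has_real_derivative (\<Sum>\<sigma>\<in>\<Omega>. tilt (\<lambda>_. 0) \<sigma> * (- sin (y * W h \<sigma>) * W h \<sigma>))) (at y)"
      unfolding \<psi>_def ex_def by (intro DERIV_sum DERIV_cmult) (auto intro!: derivative_eq_intros)
    also have "(\<Sum>\<sigma>\<in>\<Omega>. tilt (\<lambda>_. 0) \<sigma> * (- sin (y * W h \<sigma>) * W h \<sigma>)) = \<psi>' y"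
      unfolding \<psi>'_def ex_def sum_negf[symmetric] by (intro sum.cong refl) (simp add: mult_ac)
    finally have p: "(\<psi> has_real_derivative \<psi>' y) (at y)" .
    have "((\<lambda>y. exp (y\<^sup>2 * V h / 2)) has_real_derivative exp (y\<^sup>2 * V h / 2) * (y * V h)) (at y)"
      by (auto intro!: derivative_eq_intros)
    from DERIV_mult[OF p this] show ?thesis unfolding f_def f'_def by (simp add: algebra_simps)
  qed
  from MVT2[OF x0, of f f'] d obtain y where y: "0 < y" "y < x" "f x - f 0 = (x - 0) * f' y" by blast
  have "\<bar>y * h i\<bar> \<le> B / sqrt (real n)" if "i \<in> I" for i
  proof -
    have "\<bar>y * h i\<bar> \<le> \<bar>x * h i\<bar>" using y by (simp add: abs_mult mult_right_mono)
    then show ?thesis using B(3)[OF that] by simp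
  qed
  then have "\<bar>ex (\<lambda>_. 0) (\<lambda>\<sigma>. W h \<sigma> * sin (y * W h \<sigma>)) - y * ex (\<lambda>_. 0) (\<lambda>\<sigma>. cos (y * W h \<sigma>)) * V h\<bar> \<le> \<delta>"
    unfolding \<delta>_def by (intro ex_W_sin B) auto
  then have "\<bar>\<psi>' y + y * \<psi> y * V h\<bar> \<le> \<delta>"
    unfolding \<psi>'_def \<psi>_def by linarith
  moreover have "exp (y\<^sup>2 * V h / 2) \<le> exp (x\<^sup>2 * V h / 2)"
    using y V_nonneg[of h] by (auto intro!: mult_right_mono power_mono)
  ultimately have f': "\<bar>f' y\<bar> \<le> \<delta> * exp (x\<^sup>2 * V h / 2)"
    unfolding f'_def abs_mult by (intro mult_mono) auto
  have "\<psi> x - exp (- (x\<^sup>2 * V h / 2)) = (f x - f 0) * exp (- (x\<^sup>2 * V h / 2))"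
    by (simp add: f_def \<psi>_def left_diff_distrib mult.assoc exp_add[symmetric])
  also have "\<dots> = x * (f' y * exp (- (x\<^sup>2 * V h / 2)))" unfolding y(3) by simp
  finally have "\<bar>\<psi> x - exp (- (x\<^sup>2 * V h / 2))\<bar> = x * (\<bar>f' y\<bar> * exp (- (x\<^sup>2 * V h / 2)))"
    using x by (simp add: abs_mult)
  also have "\<dots> \<le> x * (\<delta> * exp (x\<^sup>2 * V h / 2) * exp (- (x\<^sup>2 * V h / 2)))"
    using x f' by (intro mult_left_mono mult_right_mono) auto
  also have "\<dots> = x * \<delta>" by (simp add: mult.assoc exp_add[symmetric])
  finally show ?thesis by (simp add: \<psi>_def \<delta>_def)
qed

end

section \<open>Limit of the distance of tilted measures\<close>

context curie_weiss
begin

definition law :: "(nat \<Rightarrow> real) \<Rightarrow> real measure" where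
  "law h = distr (point_measure \<Omega> (\<lambda>\<sigma>. ennreal (tilt (\<lambda>_. 0) \<sigma>))) borel (W h)"

lemma W_measurable: "W h \<in> borel_measurable (point_measure \<Omega> (\<lambda>\<sigma>. ennreal (tilt (\<lambda>_. 0) \<sigma>)))"
  by (simp add: measurable_def space_point_measure sets_point_measure)

lemma real_distribution_law: "real_distribution (law h)"
proof -
  interpret prob_space "point_measure \<Omega> (\<lambda>\<sigma>. ennreal (tilt (\<lambda>_. 0) \<sigma>))"
    by (rule prob_space_point_measure) (auto simp: tilt_sum less_imp_le[OF tilt_pos] sum_ennreal)
  show ?thesis unfolding law_def by (rule real_distribution_distr) (rule W_measurable)
qed

lemma integral_law:
  fixes f :: "real \<Rightarrow> 'b::{banach, second_countable_topology}"
  assumes "f \<in> borel_measurable borel"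
  shows "integral\<^sup>L (law h) f = (\<Sum>\<sigma>\<in>\<Omega>. tilt (\<lambda>_. 0) \<sigma> *\<^sub>R f (W h \<sigma>))"
  unfolding law_def integral_distr[OF W_measurable assms]
  by (rule lebesgue_integral_point_measure_finite) (auto simp: less_imp_le[OF tilt_pos])

lemma char_law: "char (law h) x = complex_of_real (ex (\<lambda>_. 0) (\<lambda>\<sigma>. cos (x * W h \<sigma>)))"
proof -
  have "char (law h) x = (\<Sum>\<sigma>\<in>\<Omega>. tilt (\<lambda>_. 0) \<sigma> *\<^sub>R iexp (x * W h \<sigma>))"
    unfolding char_def by (rule integral_law) simp
  also have "\<dots> = complex_of_real (ex (\<lambda>_. 0) (\<lambda>\<sigma>. cos (x * W h \<sigma>)))"
    unfolding cis_conv_exp[symmetric] using ex_sin_W[of x h]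
    by (intro complex_eqI) (simp_all add: Re_sum Im_sum ex_def)
  finally show ?thesis .
qed

end

text \<open>The limit of \<open>tvt_eq\<close> when \<open>W h\<close> becomes centred normal with
  variance \<open>v\<close> and \<open>logZ h\<close> tends to \<open>v / 2\<close>. By
  \<open>gauss_tv_eq\<close> it is the distance between unit-variance normal laws whose means differ
  by \<open>sqrt v\<close>.\<close>

definition gauss_tv :: "real \<Rightarrow> real" where
  "gauss_tv v = 1 - (LINT x|std_normal_distribution. min 1 (exp (sqrt v * x - v / 2)))"

text \<open>Levy continuity gives weak convergence of \<open>W\<close>, and the overlap is a bounded
  continuous functional of it. The sizes \<open>N j\<close> form an arbitrary sequence, since a
  subsequence argument needs the lemma later.\<close>

lemma tvt_limit:
  fixes N :: "nat \<Rightarrow> nat" and h :: "nat \<Rightarrow> nat \<Rightarrow> real"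
  assumes cw: "\<And>j. curie_weiss \<beta> (N j)" and N: "filterlim N at_top sequentially"
    and A: "0 \<le> A" "\<And>j i. i \<in> {1..N j} \<Longrightarrow> \<bar>h j i\<bar> \<le> A / sqrt (real (N j))"
    and V: "(\<lambda>j. curie_weiss.V \<beta> (N j) (h j)) \<longlonglongrightarrow> v"
  shows "(\<lambda>j. curie_weiss.tvt \<beta> (N j) (h j)) \<longlonglongrightarrow> gauss_tv v"
proof -
  define E where "E = (\<lambda>j. curie_weiss.ex \<beta> (N j) (\<lambda>_. 0))"
  define W where "W = (\<lambda>j. curie_weiss.W (N j) (h j))"
  define M where "M = (\<lambda>j. curie_weiss.law \<beta> (N j) (h j))"
  define M' where "M' = distr std_normal_distribution borel (\<lambda>x. sqrt v * x)"
  define V' where "V' = (\<lambda>j. curie_weiss.V \<beta> (N j) (h j))"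
  note Iv = curie_weiss.I_def[OF cw]
  have v0: "0 \<le> v"
    by (rule LIMSEQ_le_const[OF V]) (auto intro!: curie_weiss.V_nonneg[OF cw])
  have sq: "filterlim (\<lambda>j. sqrt (real (N j))) at_top sequentially"
    by (rule filterlim_compose[OF sqrt_at_top], rule filterlim_compose[OF filterlim_real_sequentially N])
  have small: "(\<lambda>j. c / sqrt (real (N j))) \<longlonglongrightarrow> 0" for c :: real
    by (rule real_tendsto_divide_at_top[OF tendsto_const sq])
  have sB: "B / sqrt (real m) \<le> B' / sqrt (real m)" if "B \<le> B'" for B B' :: real and m :: nat
    using that by (intro divide_right_mono) auto
  have cosE: "(\<lambda>j. E j (\<lambda>\<sigma>. cos (x * W j \<sigma>))) \<longlonglongrightarrow> exp (- (x\<^sup>2 * v / 2))" if x: "0 \<le> x" for x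
  proof -
    \<comment> \<open>Large enough to bound the fields \<open>h\<close> and \<open>x * h\<close> at
      the same time.\<close>
    define B where "B = A * (1 + x)"
    have B: "0 \<le> B" "A \<le> B" "x * A \<le> B" using A x by (auto simp: B_def algebra_simps)
    have bd: "\<bar>E j (\<lambda>\<sigma>. cos (x * W j \<sigma>)) - exp (- (x\<^sup>2 * V' j / 2))\<bar> \<le>
        x * (2 * B * curie_weiss.C1 \<beta> B / (1 - \<beta>) / sqrt (real (N j)))" for j
      unfolding E_def W_def V'_def
    proof (rule curie_weiss.cos_W_approx[OF cw x B(1)])
      fix i assume "i \<in> curie_weiss.I (N j)"
      then have i: "\<bar>h j i\<bar> \<le> A / sqrt (real (N j))" using A(2) by (simp add: Iv)
      then show "\<bar>h j i\<bar> \<le> B / sqrt (real (N j))" using sB[OF B(2), of "N j"] by linarith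
      have "\<bar>x * h j i\<bar> \<le> x * (A / sqrt (real (N j)))"
        using mult_left_mono[OF i x] x by (simp add: abs_mult)
      then show "\<bar>x * h j i\<bar> \<le> B / sqrt (real (N j))" using sB[OF B(3), of "N j"] by simp
    qed
    have "(\<lambda>j. E j (\<lambda>\<sigma>. cos (x * W j \<sigma>)) - exp (- (x\<^sup>2 * V' j / 2))) \<longlonglongrightarrow> 0"
    proof (rule Lim_null_comparison)
      show "\<forall>\<^sub>F j in sequentially. norm (E j (\<lambda>\<sigma>. cos (x * W j \<sigma>)) - exp (- (x\<^sup>2 * V' j / 2))) \<le>
        x * (2 * B * curie_weiss.C1 \<beta> B / (1 - \<beta>) / sqrt (real (N j)))"
        unfolding real_norm_def by (intro always_eventually allI bd)
    qed (intro tendsto_mult_right_zero small)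
    moreover have "(\<lambda>j. exp (- (x\<^sup>2 * V' j / 2))) \<longlonglongrightarrow> exp (- (x\<^sup>2 * v / 2))"
      using V unfolding V'_def by (intro tendsto_intros) simp_all
    ultimately have "(\<lambda>j. (E j (\<lambda>\<sigma>. cos (x * W j \<sigma>)) - exp (- (x\<^sup>2 * V' j / 2))) + exp (- (x\<^sup>2 * V' j / 2)))
       \<longlonglongrightarrow> 0 + exp (- (x\<^sup>2 * v / 2))" by (rule tendsto_add)
    then show ?thesis by simp
  qed
  have charM: "char (M j) x = complex_of_real (E j (\<lambda>\<sigma>. cos (x * W j \<sigma>)))" for j x
    unfolding M_def E_def W_def by (rule curie_weiss.char_law[OF cw])
  interpret sn: real_distribution std_normal_distribution by (rule real_dist_normal_dist)
  have rM': "real_distribution M'" unfolding M'_def by (rule sn.real_distribution_distr) simp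
  have charM': "char M' x = complex_of_real (exp (- (x\<^sup>2 * v / 2)))" for x
  proof -
    have "char M' x = char std_normal_distribution (x * sqrt v)"
      unfolding char_def M'_def by (subst integral_distr) (auto simp: mult.assoc)
    also have "\<dots> = complex_of_real (exp (- (x\<^sup>2 * v / 2)))"
      using v0 by (simp add: char_std_normal_distribution power_mult_distrib)
    finally show ?thesis .
  qed
  have wc: "weak_conv_m M M'"
  proof (rule levy_continuity)
    show "real_distribution (M j)" for j unfolding M_def by (rule curie_weiss.real_distribution_law[OF cw])
    show "real_distribution M'" by (rule rM')
    fix x :: real
    have "(\<lambda>j. E j (\<lambda>\<sigma>. cos (x * W j \<sigma>))) \<longlonglongrightarrow> exp (- (x\<^sup>2 * v / 2))"
    proof (cases "0 \<le> x")
      case False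
      then have "(\<lambda>j. E j (\<lambda>\<sigma>. cos ((- x) * W j \<sigma>))) \<longlonglongrightarrow> exp (- ((- x)\<^sup>2 * v / 2))" by (intro cosE) simp
      then show ?thesis by simp
    qed (rule cosE)
    then show "(\<lambda>j. char (M j) x) \<longlonglongrightarrow> char M' x"
      unfolding charM charM' by (rule tendsto_of_real)
  qed
  define f where "f = (\<lambda>w::real. min 1 (exp (w - v / 2)))"
  have fc: "isCont f x" for x unfolding f_def by (intro continuous_intros)
  have fb: "f \<in> borel_measurable borel" unfolding f_def by measurable
  have i1: "(\<lambda>j. integral\<^sup>L (M j) f) \<longlonglongrightarrow> integral\<^sup>L M' f"
  proof (rule weak_conv_imp_integral_bdd_continuous_conv[OF _ rM' wc fc, of 1])
    show "real_distribution (M j)" for j unfolding M_def by (rule curie_weiss.real_distribution_law[OF cw])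
    show "norm (f x) \<le> 1" for x by (simp add: f_def)
  qed
  have i2: "integral\<^sup>L (M j) f = E j (\<lambda>\<sigma>. f (W j \<sigma>))" for j
    unfolding M_def E_def W_def curie_weiss.integral_law[OF cw fb] curie_weiss.ex_def[OF cw] by simp
  have i3: "1 - integral\<^sup>L M' f = gauss_tv v"
    unfolding M'_def gauss_tv_def by (subst integral_distr) (auto simp: f_def)
  have lim: "(\<lambda>j. 1 - E j (\<lambda>\<sigma>. f (W j \<sigma>))) \<longlonglongrightarrow> gauss_tv v"
    using tendsto_diff[OF tendsto_const[of 1] i1] unfolding i2 i3 .
  have bd: "\<bar>curie_weiss.tvt \<beta> (N j) (h j) - (1 - E j (\<lambda>\<sigma>. f (W j \<sigma>)))\<bar> \<le>
      2 * A * curie_weiss.C1 \<beta> A / (1 - \<beta>) / sqrt (real (N j)) + \<bar>V' j - v\<bar>" for j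
    unfolding E_def W_def V'_def f_def using A(2) by (intro curie_weiss.tvt_approx[OF cw A(1)]) (simp add: Iv)
  have "(\<lambda>j. V' j - v) \<longlonglongrightarrow> 0" unfolding V'_def by (rule LIM_zero[OF V])
  from tendsto_add[OF small[of "2 * A * curie_weiss.C1 \<beta> A / (1 - \<beta>)"] tendsto_rabs_zero[OF this]]
  have b0: "(\<lambda>j. 2 * A * curie_weiss.C1 \<beta> A / (1 - \<beta>) / sqrt (real (N j)) + \<bar>V' j - v\<bar>) \<longlonglongrightarrow> 0"
    by (simp only: add_0_right)
  have "(\<lambda>j. curie_weiss.tvt \<beta> (N j) (h j) - (1 - E j (\<lambda>\<sigma>. f (W j \<sigma>)))) \<longlonglongrightarrow> 0"
    by (rule Lim_null_comparison[OF always_eventually b0]) (unfold real_norm_def, rule allI, rule bd)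
  from tendsto_add[OF this lim] show ?thesis by simp
qed

section \<open>The distance between Gaussians\<close>

lemma measure_density_lborel:
  fixes p :: "real \<Rightarrow> real"
  assumes p: "integrable lborel p" "\<And>x. 0 \<le> p x" and A: "A \<in> sets borel"
  shows "measure (density lborel (\<lambda>x. ennreal (p x))) A = (\<integral>x. indicator A x * p x \<partial>lborel)"
proof -
  have [measurable]: "p \<in> borel_measurable lborel" "A \<in> sets borel" using p A by auto
  have "emeasure (density lborel (\<lambda>x. ennreal (p x))) A = (\<integral>\<^sup>+x. ennreal (p x) * indicator A x \<partial>lborel)"
    by (rule emeasure_density) auto
  also have "\<dots> = (\<integral>\<^sup>+x. ennreal (indicator A x * p x) \<partial>lborel)"
    by (intro nn_integral_cong) (auto split: split_indicator)
  also have "\<dots> = ennreal (\<integral>x. indicator A x * p x \<partial>lborel)"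
  proof (rule nn_integral_eq_integral)
    show "integrable lborel (\<lambda>x. indicator A x * p x)"
      using integrable_mult_indicator[of A lborel p] p A by simp
    show "AE x in lborel. 0 \<le> indicator A x * p x" using p by simp
  qed
  finally show ?thesis using p by (intro measure_eq_emeasure_eq_ennreal integral_nonneg) (auto split: split_indicator)
qed

lemma tv_dist_density:
  fixes p q :: "real \<Rightarrow> real"
  assumes p: "integrable lborel p" "\<And>x. 0 \<le> p x" "(\<integral>x. p x \<partial>lborel) = 1"
    and q: "integrable lborel q" "\<And>x. 0 \<le> q x" "(\<integral>x. q x \<partial>lborel) = 1"
  shows "tv_dist (density lborel (\<lambda>x. ennreal (p x))) (density lborel (\<lambda>x. ennreal (q x))) =
    1 - (\<integral>x. min (p x) (q x) \<partial>lborel)"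
proof -
  let ?r = "\<lambda>x. min (p x) (q x)"
  have r: "integrable lborel ?r" using p q by (intro Bochner_Integration.integrable_min)
  have [measurable]: "p \<in> borel_measurable lborel" "q \<in> borel_measurable lborel" using p q by auto
  have ind: "integrable lborel (\<lambda>x. indicator A x * f x)" if "integrable lborel f" "A \<in> sets borel"
    for A and f :: "real \<Rightarrow> real"
    using integrable_mult_indicator[of A lborel f] that by simp
  define d where "d = (\<lambda>A. \<bar>(\<integral>x. indicator A x * p x \<partial>lborel) - (\<integral>x. indicator A x * q x \<partial>lborel)\<bar>)"
  have up: "(\<integral>x. indicator A x * p x \<partial>lborel) - (\<integral>x. indicator A x * q x \<partial>lborel) \<le> 1 - integral\<^sup>L lborel ?r"
    if A: "A \<in> sets borel" and p: "integrable lborel p" "(\<integral>x. p x \<partial>lborel) = 1"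
      and q: "integrable lborel q" and r: "integrable lborel (\<lambda>x. min (p x) (q x))"
      and e: "integral\<^sup>L lborel (\<lambda>x. min (p x) (q x)) = integral\<^sup>L lborel ?r"
    for A and p q :: "real \<Rightarrow> real"
  proof -
    have "(\<integral>x. indicator A x * p x \<partial>lborel) - (\<integral>x. indicator A x * q x \<partial>lborel) =
        (\<integral>x. indicator A x * p x - indicator A x * q x \<partial>lborel)"
      by (intro Bochner_Integration.integral_diff[symmetric] ind A p q)
    also have "\<dots> \<le> (\<integral>x. p x - min (p x) (q x) \<partial>lborel)"
      by (intro integral_mono Bochner_Integration.integrable_diff ind A p q r) (auto split: split_indicator)
    also have "\<dots> = 1 - integral\<^sup>L lborel ?r"
      using p r e by (subst Bochner_Integration.integral_diff) auto
    finally show ?thesis .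
  qed
  have "tv_dist (density lborel (\<lambda>x. ennreal (p x))) (density lborel (\<lambda>x. ennreal (q x))) = (SUP A\<in>sets borel. d A)"
    unfolding tv_dist_def d_def using p q by (intro SUP_cong) (auto simp: measure_density_lborel)
  also have "\<dots> = 1 - integral\<^sup>L lborel ?r"
  proof (rule cSup_eq_maximum)
    define A where "A = {x. q x < p x}"
    have A: "A \<in> sets borel" unfolding A_def by measurable
    have "(\<integral>x. indicator A x * p x \<partial>lborel) - (\<integral>x. indicator A x * q x \<partial>lborel) =
        (\<integral>x. indicator A x * p x - indicator A x * q x \<partial>lborel)"
      by (intro Bochner_Integration.integral_diff[symmetric] ind A p q)
    also have "\<dots> = (\<integral>x. p x - ?r x \<partial>lborel)"
      by (intro Bochner_Integration.integral_cong) (auto simp: A_def split: split_indicator)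
    also have "\<dots> = 1 - integral\<^sup>L lborel ?r"
      using p r by (subst Bochner_Integration.integral_diff) auto
    finally have "d A = \<bar>1 - integral\<^sup>L lborel ?r\<bar>" by (simp add: d_def)
    moreover have "integral\<^sup>L lborel ?r \<le> 1"
      using integral_mono[OF r p(1)] p(3) by simp
    ultimately show "1 - integral\<^sup>L lborel ?r \<in> d ` sets borel"
      using A by (intro image_eqI[of _ _ A]) auto
  next
    fix y assume "y \<in> d ` sets borel"
    then obtain A where A: "A \<in> sets borel" "y = d A" by auto
    have "integral\<^sup>L lborel (\<lambda>x. min (q x) (p x)) = integral\<^sup>L lborel ?r" by (simp add: min.commute)
    then show "y \<le> 1 - integral\<^sup>L lborel ?r"
      using up[OF A(1) p(1,3) q(1) r refl] up[OF A(1) q(1,3) p(1)] r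
      by (simp add: A(2) d_def abs_le_iff min.commute)
  qed
  finally show ?thesis .
qed

lemma gauss_tv_eq:
  "gauss_tv v = 1 - (\<integral>x. min (std_normal_density x) (std_normal_density (x - sqrt v)) \<partial>lborel)" if "0 \<le> v"
proof -
  define a where "a = sqrt v"
  have va: "v = a * a" using that by (simp add: a_def)
  have "(LINT x|std_normal_distribution. min 1 (exp (a * x - v / 2))) =
      (\<integral>x. std_normal_density x *\<^sub>R min 1 (exp (a * x - v / 2)) \<partial>lborel)"
    by (rule integral_density) auto
  also have "\<dots> = (\<integral>x. min (std_normal_density x) (std_normal_density (x - a)) \<partial>lborel)"
  proof (rule Bochner_Integration.integral_cong[OF refl])
    fix x :: real
    have "std_normal_density x * exp (a * x - v / 2) = std_normal_density (x - a)"
      unfolding std_normal_density_def mult.assoc exp_add[symmetric] va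
      by (simp add: power2_eq_square field_simps)
    then show "std_normal_density x *\<^sub>R min 1 (exp (a * x - v / 2)) = min (std_normal_density x) (std_normal_density (x - a))"
      using normal_density_nonneg[of 0 1 x] by (simp add: min_mult_distrib_left)
  qed
  finally show ?thesis by (simp add: gauss_tv_def a_def)
qed

text \<open>For centres at distance \<open>a\<close> the overlap of the densities is the standard
  normal mass outside \<open>(-a/2, a/2]\<close>, which shrinks as \<open>a\<close> grows.\<close>

lemma gauss_tv_mono:
  assumes "0 \<le> v" "v \<le> w"
  shows "gauss_tv v \<le> gauss_tv w"
proof -
  let ?\<phi> = std_normal_density
  have ind: "integrable lborel (\<lambda>x. indicator A x * f x)" if "integrable lborel f" "A \<in> sets borel"
    for A and f :: "real \<Rightarrow> real"
    using integrable_mult_indicator[of A lborel f] that by simp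
  have \<phi>: "integrable lborel ?\<phi>" by simp
  have *: "(\<integral>x. min (?\<phi> x) (?\<phi> (x - a)) \<partial>lborel) =
      (\<integral>x. indicator {..- (a / 2)} x * ?\<phi> x + indicator {a / 2<..} x * ?\<phi> x \<partial>lborel)" if a: "0 \<le> a" for a
  proof -
    have sh: "integrable lborel (\<lambda>x. ?\<phi> (x - a))"
      using lborel_integrable_real_affine[OF \<phi>, of 1 "- a"] by simp
    have "(\<integral>x. min (?\<phi> x) (?\<phi> (x - a)) \<partial>lborel) =
        (\<integral>x. indicator {..a / 2} x * ?\<phi> (x - a) + indicator {a / 2<..} x * ?\<phi> x \<partial>lborel)"
    proof (rule Bochner_Integration.integral_cong[OF refl])
      fix x :: real
      have e: "?\<phi> y \<le> ?\<phi> z \<longleftrightarrow> z\<^sup>2 \<le> y\<^sup>2" for y z by (simp add: std_normal_density_def divide_le_cancel)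
      have s: "(x - a)\<^sup>2 = x\<^sup>2 + a * (a - 2 * x)" by (simp add: power2_eq_square algebra_simps)
      show "min (?\<phi> x) (?\<phi> (x - a)) = indicator {..a / 2} x * ?\<phi> (x - a) + indicator {a / 2<..} x * ?\<phi> x"
      proof (cases "x \<le> a / 2")
        case True
        then have "0 \<le> a * (a - 2 * x)" using a by (intro mult_nonneg_nonneg) auto
        then have "?\<phi> (x - a) \<le> ?\<phi> x" unfolding e s by simp
        then show ?thesis using True by simp
      next
        case False
        then have "a * (a - 2 * x) \<le> 0" using a by (intro mult_nonneg_nonpos) auto
        then have "?\<phi> x \<le> ?\<phi> (x - a)" unfolding e s by simp
        then show ?thesis using False by simp
      qed
    qed
    also have "\<dots> = (\<integral>x. indicator {..a / 2} x * ?\<phi> (x - a) \<partial>lborel) + (\<integral>x. indicator {a / 2<..} x * ?\<phi> x \<partial>lborel)"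
      by (intro Bochner_Integration.integral_add ind sh \<phi>) auto
    also have "(\<integral>x. indicator {..a / 2} x * ?\<phi> (x - a) \<partial>lborel) = (\<integral>x. indicator {..- (a / 2)} x * ?\<phi> x \<partial>lborel)"
      by (subst lborel_integral_real_affine[where c = 1 and t = a])
         (auto intro!: Bochner_Integration.integral_cong split: split_indicator)
    also have "(\<integral>x. indicator {..- (a / 2)} x * ?\<phi> x \<partial>lborel) + (\<integral>x. indicator {a / 2<..} x * ?\<phi> x \<partial>lborel) =
        (\<integral>x. indicator {..- (a / 2)} x * ?\<phi> x + indicator {a / 2<..} x * ?\<phi> x \<partial>lborel)"
      by (intro Bochner_Integration.integral_add[symmetric] ind \<phi>) auto
    finally show ?thesis .
  qed
  have w: "0 \<le> w" using assms by simp
  have "(\<integral>x. min (?\<phi> x) (?\<phi> (x - sqrt w)) \<partial>lborel) \<le> (\<integral>x. min (?\<phi> x) (?\<phi> (x - sqrt v)) \<partial>lborel)"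
    unfolding *[OF real_sqrt_ge_zero[OF assms(1)]] *[OF real_sqrt_ge_zero[OF w]]
  proof (intro integral_mono Bochner_Integration.integrable_add ind \<phi>)
    fix x :: real
    have s: "sqrt v \<le> sqrt w" using assms by simp
    have "indicator {..- (sqrt w / 2)} x \<le> (indicator {..- (sqrt v / 2)} x :: real)"
      "indicator {sqrt w / 2<..} x \<le> (indicator {sqrt v / 2<..} x :: real)"
      using s by (auto split: split_indicator simp del: real_sqrt_le_iff)
    then show "indicator {..- (sqrt w / 2)} x * ?\<phi> x + indicator {sqrt w / 2<..} x * ?\<phi> x \<le>
        indicator {..- (sqrt v / 2)} x * ?\<phi> x + indicator {sqrt v / 2<..} x * ?\<phi> x"
      by (intro add_mono mult_right_mono) auto
  qed auto
  then show ?thesis using gauss_tv_eq[OF assms(1)] gauss_tv_eq[OF w] by simp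
qed

text \<open>Rescaling the line by \<open>sqrt s\<close> makes both variances 1 and the distance of
  the means \<open>M / sqrt s\<close>.\<close>

lemma tv_dist_gaussian:
  assumes s: "0 < s" and M: "0 \<le> M"
  shows "tv_dist (gaussian M s) (gaussian 0 s) = gauss_tv (M\<^sup>2 / s)"
proof -
  define r where "r = sqrt s"
  have r: "0 < r" "r * r = s" using s by (auto simp: r_def)
  have "tv_dist (gaussian M s) (gaussian 0 s) = 1 - (\<integral>x. min (normal_density M r x) (normal_density 0 r x) \<partial>lborel)"
    unfolding gaussian_def r_def[symmetric] using r by (intro tv_dist_density) auto
  also have "(\<integral>x. min (normal_density M r x) (normal_density 0 r x) \<partial>lborel) =
      r * (\<integral>x. min (normal_density M r (r * x)) (normal_density 0 r (r * x)) \<partial>lborel)"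
    using r by (subst lborel_integral_real_affine[where c = r and t = 0]) auto
  also have "\<dots> = (\<integral>x. r * min (normal_density M r (r * x)) (normal_density 0 r (r * x)) \<partial>lborel)"
    by simp
  also have "\<dots> = (\<integral>x. min (std_normal_density x) (std_normal_density (x - M / r)) \<partial>lborel)"
  proof (rule Bochner_Integration.integral_cong[OF refl])
    fix x
    have "r * normal_density m r (r * x) = std_normal_density (x - m / r)" for m
    proof -
      have "(r * x - m)\<^sup>2 / (2 * r\<^sup>2) = (x - m / r)\<^sup>2 / 2"
        using r(1) by (simp add: power2_eq_square field_simps)
      then show ?thesis
        using r(1) by (simp add: normal_density_def std_normal_density_def real_sqrt_mult)
    qed
    from this[of M] this[of 0]
    show "r * min (normal_density M r (r * x)) (normal_density 0 r (r * x)) = min (std_normal_density x) (std_normal_density (x - M / r))"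
      using r(1) by (simp add: min_mult_distrib_left min.commute)
  qed
  also have "1 - \<dots> = gauss_tv (M\<^sup>2 / s)"
  proof -
    have "sqrt (M\<^sup>2 / s) = M / r" using M by (simp add: real_sqrt_divide r_def)
    then show ?thesis using s by (simp add: gauss_tv_eq)
  qed
  finally show ?thesis .
qed

section \<open>The mean-field flow\<close>

text \<open>The quadratic bound would only make the integrand of \<open>c_const\<close> bounded near
  0; the cubic one makes it vanish there.\<close>

lemma tanh_cubic:
  fixes y :: real
  assumes "0 \<le> y"
  shows "y - tanh y \<le> y ^ 3"
proof (cases "y = 0")
  case False
  with assms have y: "0 < y" by simp
  have "((\<lambda>x. x - tanh x) has_real_derivative (tanh z)\<^sup>2) (at z)" for z :: real
    by (auto intro!: derivative_eq_intros)
  from MVT2[OF y, of "\<lambda>x. x - tanh x" "\<lambda>z. (tanh z)\<^sup>2", OF this] obtain z where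
    z: "0 < z" "z < y" "y - tanh y = y * (tanh z)\<^sup>2" by auto
  have "\<bar>tanh z\<bar>\<^sup>2 \<le> y\<^sup>2" using tanh_abs_le[of z] z by (intro power_mono) auto
  then have "y * (tanh z)\<^sup>2 \<le> y * y\<^sup>2" using y by (intro mult_left_mono) auto
  then show ?thesis using z(3) by (simp add: power3_eq_cube power2_eq_square)
qed simp

lemma tanh_le_self: "0 \<le> y \<Longrightarrow> tanh y \<le> (y::real)"
  using tanh_abs_le[of y] by simp

locale mean_field =
  fixes \<beta> :: real
  assumes b0: "0 \<le> \<beta>" and b1: "\<beta> < 1"
begin

abbreviation "ci \<equiv> c_integrand \<beta>"

lemma gap_pos:
  assumes "0 < x" shows "0 < x - tanh (\<beta> * x)"
proof -
  have "\<beta> * x < 1 * x" using b1 assms by (rule mult_strict_right_mono)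
  moreover have "tanh (\<beta> * x) \<le> \<beta> * x" using b0 assms by (intro tanh_le_self) simp
  ultimately show ?thesis by linarith
qed

lemma denominator: "0 < t \<Longrightarrow> 1 - \<beta> \<le> 1 - tanh (\<beta> * t) / t"
  using tanh_le_self[of "\<beta> * t"] b0 by (simp add: pos_divide_le_eq)

lemma ci_nonneg:
  assumes "0 \<le> t" shows "0 \<le> ci t"
proof (cases "t = 0")
  case False
  with assms have "0 < t" by simp
  then have "0 \<le> 1 - tanh (\<beta> * t) / t" using denominator[of t] b1 by linarith
  moreover have "0 \<le> \<beta> * t - tanh (\<beta> * t)" using tanh_le_self[of "\<beta> * t"] b0 assms by simp
  ultimately show ?thesis unfolding c_integrand_def by (intro divide_nonneg_nonneg) auto
qed (simp add: c_integrand_def)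

lemma ci_le:
  assumes "0 \<le> t" shows "ci t \<le> t / (1 - \<beta>)"
proof (cases "t = 0")
  case False
  with assms have t: "0 < t" by simp
  have "\<beta> * t - tanh (\<beta> * t) \<le> (\<beta> * t) ^ 3" using b0 t by (intro tanh_cubic) auto
  also have "\<dots> \<le> (1 * t) ^ 3" using b0 b1 t by (intro power_mono mult_right_mono) auto
  finally have "(\<beta> * t - tanh (\<beta> * t)) / t\<^sup>2 \<le> t ^ 3 / t\<^sup>2" by (intro divide_right_mono) auto
  also have "\<dots> = t" using t by (simp add: power3_eq_cube power2_eq_square)
  finally show ?thesis
    unfolding c_integrand_def using denominator[OF t] b1 t by (intro frac_le) auto
qed (simp add: c_integrand_def)

text \<open>At 0 the limit agrees with the conventional value 0. The interval extends beyond 1 so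
  that functions built from the integral are differentiable on both sides of 1, the starting point
  of the flow.\<close>

lemma ci_continuous: "continuous_on {0..2} ci"
  unfolding continuous_on_eq_continuous_within
proof
  fix t :: real assume t: "t \<in> {0..2}"
  show "continuous (at t within {0..2}) ci"
  proof (cases "t = 0")
    case True
    have "((\<lambda>t. ci t) \<longlongrightarrow> 0) (at 0 within {0..2})"
    proof (rule Lim_null_comparison)
      show "\<forall>\<^sub>F t in at 0 within {0..2}. norm (ci t) \<le> t / (1 - \<beta>)"
        using ci_nonneg ci_le by (auto simp: eventually_at_filter intro!: always_eventually)
      have "((\<lambda>t. t / (1 - \<beta>)) \<longlongrightarrow> 0 / (1 - \<beta>)) (at 0 within {0..2})"
        using b1 by (intro tendsto_intros) auto
      then show "((\<lambda>t. t / (1 - \<beta>)) \<longlongrightarrow> 0) (at 0 within {0..2})" by simp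
    qed
    moreover have "ci 0 = 0" by (simp add: c_integrand_def)
    ultimately show ?thesis unfolding True continuous_within by (simp only:)
  next
    case False
    with t have t: "0 < t" by simp
    then have "1 - tanh (\<beta> * t) / t \<noteq> 0" "t\<^sup>2 \<noteq> 0" "t \<noteq> 0" using denominator[OF t] b1 by auto
    then have "isCont (\<lambda>t. ((\<beta> * t - tanh (\<beta> * t)) / t\<^sup>2) / (1 - tanh (\<beta> * t) / t)) t"
      by (intro continuous_intros) (simp_all del: right_minus_eq)
    then show ?thesis unfolding c_integrand_def[abs_def] by (rule continuous_at_imp_continuous_at_within)
  qed
qed

definition J :: "real \<Rightarrow> real" where "J x = integral {0..x} ci"

lemma ci_integrable: "x \<le> 2 \<Longrightarrow> 0 \<le> a \<Longrightarrow> ci integrable_on {a..x}"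
  by (intro integrable_continuous_real continuous_on_subset[OF ci_continuous]) auto

lemma J_deriv:
  assumes "0 < x" "x < 2"
  shows "(J has_real_derivative ci x) (at x)"
proof -
  have "((\<lambda>u. integral {0..u} ci) has_real_derivative ci x) (at x within {0..2})"
    using assms by (intro integral_has_real_derivative ci_continuous) auto
  then show ?thesis using assms unfolding J_def[abs_def] by (simp add: at_within_Icc_at)
qed

lemma J_mono: "0 \<le> x \<Longrightarrow> x \<le> y \<Longrightarrow> y \<le> 2 \<Longrightarrow> J x \<le> J y"
  unfolding J_def using ci_integrable ci_nonneg by (intro integral_subset_le) auto

lemma J_bounds:
  assumes "0 \<le> x" "x \<le> 1"
  shows "0 \<le> J x" "J x \<le> x / (1 - \<beta>)"
proof -
  show "0 \<le> J x" unfolding J_def using assms ci_nonneg by (intro integral_nonneg ci_integrable) auto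
  have "J x \<le> integral {0..x} (\<lambda>_. 1 / (1 - \<beta>))"
    unfolding J_def
  proof (rule integral_le)
    fix t assume t: "t \<in> {0..x}"
    then have "ci t \<le> t / (1 - \<beta>)" by (intro ci_le) auto
    also have "\<dots> \<le> 1 / (1 - \<beta>)" using t assms b1 by (intro divide_right_mono) auto
    finally show "ci t \<le> 1 / (1 - \<beta>)" .
  qed (use assms in \<open>auto intro!: ci_integrable\<close>)
  then show "J x \<le> x / (1 - \<beta>)" using assms by simp
qed

lemma set_integrable_ci: "set_integrable lborel {0..1} ci"
  by (rule borel_integrable_atLeastAtMost') (rule continuous_on_subset[OF ci_continuous], auto)

lemma c_const_eq: "c_const \<beta> = - J 1"
  unfolding c_const_def J_def using set_borel_integral_eq_integral(2)[OF set_integrable_ci] by simp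

text \<open>The time \<open>hit x\<close> at which the solution started at \<open>1\<close> reaches \<open>x\<close>, in closed form up to the integral \<open>J\<close>.\<close>

definition hit :: "real \<Rightarrow> real" where
  "hit x = (- ln x + J x - J 1) / (1 - \<beta>)"

text \<open>The reciprocal of the speed \<open>x - tanh (\<beta> * x)\<close> equals
  \<open>(1 / x - ci x) / (1 - \<beta>)\<close>. The first part integrates to the logarithm; the
  integrand of \<open>c(\<beta>)\<close> is what makes up for the nonlinearity.\<close>

lemma hit_deriv:
  assumes x: "0 < x" "x < 2"
  shows "(hit has_real_derivative - inverse (x - tanh (\<beta> * x))) (at x)"
proof -
  have d: "(hit has_real_derivative (- (1 / x) + ci x - 0) / (1 - \<beta>)) (at x)"
    unfolding hit_def[abs_def]
    using x by (intro DERIV_cdivide DERIV_diff DERIV_add DERIV_minus DERIV_ln_divide J_deriv DERIV_const)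
  have g: "x - tanh (\<beta> * x) > 0" by (rule gap_pos[OF x(1)])
  define T where "T = tanh (\<beta> * x)"
  define w where "w = x - T"
  have w: "w > 0" using g by (simp add: w_def T_def)
  have T: "T = x - w" by (simp add: w_def)
  have "1 - T / x = w / x" using x by (simp add: w_def diff_divide_distrib)
  then have "ci x = (\<beta> * x - T) / (x * w)"
    using x w unfolding c_integrand_def T_def[symmetric] by (simp add: power2_eq_square)
  then have "- (1 / x) + ci x = - (1 - \<beta>) * inverse w"
    using x w unfolding T by (simp add: field_simps)
  moreover have "(- c * y) / c = - y" if "c \<noteq> 0" for c y :: real using that by simp
  ultimately have "(- (1 / x) + ci x - 0) / (1 - \<beta>) = - inverse w"
    using b1 by (simp only: diff_0_right)
  then show ?thesis using d by (simp add: T_def w_def)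
qed

lemma hit_strict_antimono:
  assumes "0 < x" "x < y" "y < 2"
  shows "hit y < hit x"
proof (rule DERIV_neg_imp_decreasing[OF assms(2)])
  fix z assume z: "x \<le> z" "z \<le> y"
  then have "(hit has_real_derivative - inverse (z - tanh (\<beta> * z))) (at z)" "0 < z - tanh (\<beta> * z)"
    using assms by (intro hit_deriv gap_pos; simp)+
  then show "\<exists>d. (hit has_real_derivative d) (at z) \<and> d < 0" by force
qed

lemma hit_1 [simp]: "hit 1 = 0"
  by (simp add: hit_def)

text \<open>The solution started at 1, as the inverse of its hitting time. Inverting on
  \<open>{0<..<2}\<close> also covers slightly negative times, so that \<open>m0\<close> has a
  two-sided derivative at time 0.\<close>

definition m0 :: "real \<Rightarrow> real" where "m0 t = the_inv_into {0<..<2} hit t"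

lemma inj_hit: "inj_on hit {0<..<2}"
proof (rule inj_onI)
  fix x y assume "x \<in> {0<..<2}" "y \<in> {0<..<2}" "hit x = hit y"
  then show "x = y" using hit_strict_antimono[of x y] hit_strict_antimono[of y x]
    by (cases x y rule: linorder_cases) auto
qed

lemma m0_hit: "0 < x \<Longrightarrow> x < 2 \<Longrightarrow> m0 (hit x) = x"
  unfolding m0_def by (rule the_inv_into_f_f[OF inj_hit]) simp

lemma m0_props:
  assumes "0 \<le> t"
  shows "0 < m0 t" "m0 t \<le> 1" "hit (m0 t) = t"
proof -
  \<comment> \<open>Dropping the nonnegative \<open>J x0\<close> from \<open>hit x0\<close> gives
    exactly \<open>t\<close>, so \<open>x0\<close> is reached no earlier than \<open>t\<close> and
    serves as lower end for the intermediate value theorem.\<close>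
  define x0 where "x0 = exp (- (1 - \<beta>) * t - J 1)"
  have J1: "0 \<le> J 1" using J_bounds(1)[of 1] by simp
  have "(1 - \<beta>) * t \<ge> 0" using assms b1 by simp
  then have "- (1 - \<beta>) * t - J 1 \<le> 0" using J1 unfolding mult_minus_left by linarith
  then have x0: "0 < x0" "x0 \<le> 1" unfolding x0_def exp_le_one_iff by simp_all
  have "ln x0 = - ((1 - \<beta>) * t) - J 1" unfolding x0_def mult_minus_left by simp
  then have "(1 - \<beta>) * t \<le> - ln x0 + J x0 - J 1" using J_bounds(1)[of x0] x0 by linarith
  then have "t \<le> hit x0" using b1 by (simp add: hit_def pos_le_divide_eq mult.commute)
  moreover have "hit 1 \<le> t" using assms by simp
  moreover have "\<forall>x. x0 \<le> x \<and> x \<le> 1 \<longrightarrow> isCont hit x"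
    using x0 by (auto intro!: DERIV_isCont[OF hit_deriv])
  ultimately obtain x where x: "x0 \<le> x" "x \<le> 1" "hit x = t" using IVT2[of hit 1 t x0] x0 by blast
  then have "m0 t = x" using m0_hit[of x] x0 by auto
  then show "0 < m0 t" "m0 t \<le> 1" "hit (m0 t) = t" using x x0 by auto
qed

lemma m0_deriv:
  assumes "0 \<le> t"
  shows "(m0 has_real_derivative - m0 t + tanh (\<beta> * m0 t)) (at t)"
proof -
  note x = m0_props[OF assms]
  define D where "D = - inverse (m0 t - tanh (\<beta> * m0 t))"
  have D: "D \<noteq> 0" using gap_pos[OF x(1)] by (simp add: D_def)
  have "(m0 has_derivative (*) (inverse D)) (at (hit (m0 t)))"
  proof (rule has_derivative_inverse_strong[where S = "{0<..<2}" and f = hit and f' = "(*) D"])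
    show "(hit has_derivative (*) D) (at (m0 t))"
      using hit_deriv[of "m0 t"] x unfolding D_def by (simp add: has_field_derivative_def)
    show "continuous_on {0<..<2} hit"
      by (intro continuous_at_imp_continuous_on ballI DERIV_isCont[OF hit_deriv]) auto
    show "(*) D \<circ> (*) (inverse D) = id" using D by (auto simp: fun_eq_iff)
  qed (use x m0_hit in auto)
  then have "(m0 has_real_derivative inverse D) (at (hit (m0 t)))" by (simp add: has_field_derivative_def)
  then have "(m0 has_real_derivative - (m0 t - tanh (\<beta> * m0 t))) (at (hit (m0 t)))"
    by (simp add: D_def)
  then show ?thesis unfolding x(3) by simp
qed

lemma ln_m0: "0 \<le> t \<Longrightarrow> ln (m0 t) = J (m0 t) - J 1 - (1 - \<beta>) * t"
  using m0_props(3)[of t] b1 by (simp add: hit_def field_simps)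

lemma m0_le_exp:
  assumes "0 \<le> t"
  shows "m0 t \<le> exp (- (1 - \<beta>) * t)"
proof -
  have "J (m0 t) \<le> J 1" using m0_props[OF assms] by (intro J_mono) auto
  then have "ln (m0 t) \<le> - (1 - \<beta>) * t" unfolding ln_m0[OF assms] by (simp add: algebra_simps)
  then have "exp (ln (m0 t)) \<le> exp (- (1 - \<beta>) * t)" by simp
  then show ?thesis using m0_props(1)[OF assms] by simp
qed

lemma m0_antimono:
  assumes "0 \<le> s" "s \<le> t"
  shows "m0 t \<le> m0 s"
proof (rule ccontr)
  assume "\<not> m0 t \<le> m0 s"
  then have "hit (m0 t) < hit (m0 s)"
    using m0_props[of s] m0_props[of t] assms by (intro hit_strict_antimono) auto
  then show False using m0_props(3)[of s] m0_props(3)[of t] assms by simp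
qed

text \<open>The product equals \<open>exp (J (m0 t) - J 1)\<close> exactly. As \<open>m0 t\<close>
  tends to 0 so does \<open>J (m0 t)\<close>, and \<open>- J 1\<close> is
  \<open>c_const\<close>.\<close>

lemma m0_asymptotics:
  assumes "filterlim t at_top F"
  shows "((\<lambda>x. exp ((1 - \<beta>) * t x) * m0 (t x)) \<longlongrightarrow> exp (c_const \<beta>)) F"
proof -
  have ev: "eventually (\<lambda>x. 0 \<le> t x) F" using assms by (simp add: filterlim_at_top)
  have lim0: "((\<lambda>x. exp (- (1 - \<beta>) * t x) / (1 - \<beta>)) \<longlongrightarrow> 0 / (1 - \<beta>)) F"
  proof (intro tendsto_divide tendsto_const)
    have "filterlim (\<lambda>x. (1 - \<beta>) * t x) at_top F"
      using b1 by (intro filterlim_tendsto_pos_mult_at_top[OF tendsto_const _ assms]) auto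
    then have "filterlim (\<lambda>x. - ((1 - \<beta>) * t x)) at_bot F" by (simp add: filterlim_uminus_at_bot)
    then have "((\<lambda>x. exp (- ((1 - \<beta>) * t x))) \<longlongrightarrow> 0) F" by (rule filterlim_compose[OF exp_at_bot])
    then show "((\<lambda>x. exp (- (1 - \<beta>) * t x)) \<longlongrightarrow> 0) F" by (simp only: mult_minus_left)
  qed (use b1 in auto)
  have bd: "eventually (\<lambda>x. norm (J (m0 (t x))) \<le> exp (- (1 - \<beta>) * t x) / (1 - \<beta>)) F"
    using ev
  proof eventually_elim
    case (elim x)
    note p = m0_props[OF elim]
    have "J (m0 (t x)) \<le> m0 (t x) / (1 - \<beta>)" using p by (intro J_bounds) auto
    also have "\<dots> \<le> exp (- (1 - \<beta>) * t x) / (1 - \<beta>)"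
      using m0_le_exp[OF elim] b1 by (intro divide_right_mono) auto
    finally show ?case using J_bounds(1)[of "m0 (t x)"] p by simp
  qed
  have "((\<lambda>x. J (m0 (t x))) \<longlongrightarrow> 0) F"
    by (rule Lim_null_comparison[OF bd lim0[unfolded div_0]])
  from tendsto_exp[OF tendsto_diff[OF this tendsto_const[of "J 1"]]]
  have "((\<lambda>x. exp (J (m0 (t x)) - J 1)) \<longlongrightarrow> exp (- J 1)) F" by simp
  moreover have "eventually (\<lambda>x. exp (J (m0 (t x)) - J 1) = exp ((1 - \<beta>) * t x) * m0 (t x)) F"
    using ev
  proof eventually_elim
    case (elim x)
    have "exp ((1 - \<beta>) * t x) * m0 (t x) = exp ((1 - \<beta>) * t x) * exp (ln (m0 (t x)))"
      using m0_props(1)[OF elim] by simp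
    then show ?case unfolding ln_m0[OF elim] exp_add[symmetric] by simp
  qed
  ultimately show ?thesis unfolding c_const_eq by (rule Lim_transform_eventually)
qed

text \<open>The equation is autonomous and odd, so the solution from \<open>x\<close> is, up to
  sign, \<open>m0\<close> entered at the time at which it passes
  \<open>\<bar>x\<bar>\<close>.\<close>

definition flow :: "real \<Rightarrow> real \<Rightarrow> real" where
  "flow x t = (if x = 0 then 0 else sgn x * m0 (t + hit \<bar>x\<bar>))"

lemma hit_nonneg:
  assumes "0 < x" "x \<le> 1" shows "0 \<le> hit x"
  using hit_strict_antimono[of x 1] assms by (cases "x = 1") auto

lemma flow_0: "\<bar>x\<bar> \<le> 1 \<Longrightarrow> flow x 0 = x"
  using m0_hit[of "\<bar>x\<bar>"] by (auto simp: flow_def sgn_mult_abs)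

text \<open>Other starts are time shifts of the decreasing \<open>m0\<close> by a nonnegative
  amount; this is why the all-plus start is extremal.\<close>

lemma flow_abs_le:
  assumes "\<bar>x\<bar> \<le> 1" "0 \<le> t" shows "\<bar>flow x t\<bar> \<le> m0 t"
proof (cases "x = 0")
  case True
  then show ?thesis using m0_props(1)[OF assms(2)] by (simp add: flow_def)
next
  case False
  then have "0 \<le> hit \<bar>x\<bar>" using assms by (intro hit_nonneg) auto
  then have "m0 (t + hit \<bar>x\<bar>) \<le> m0 t" "0 < m0 (t + hit \<bar>x\<bar>)"
    using assms by (intro m0_antimono m0_props; simp)+
  then show ?thesis using False by (simp add: flow_def abs_mult abs_sgn_eq)
qed

lemma flow_deriv:
  assumes "\<bar>x\<bar> \<le> 1" "0 \<le> t"
  shows "(flow x has_real_derivative - flow x t + tanh (\<beta> * flow x t)) (at t)"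
proof (cases "x = 0")
  case True
  then show ?thesis by (simp add: flow_def[abs_def])
next
  case False
  define a where "a = hit \<bar>x\<bar>"
  have a: "0 \<le> a" unfolding a_def using False assms by (intro hit_nonneg) auto
  have "((\<lambda>t. m0 (t + a)) has_real_derivative (- m0 (t + a) + tanh (\<beta> * m0 (t + a))) * 1) (at t)"
    by (rule DERIV_chain2[OF m0_deriv]) (use a assms in \<open>auto intro!: derivative_eq_intros\<close>)
  then have "((\<lambda>t. sgn x * m0 (t + a)) has_real_derivative sgn x * (- m0 (t + a) + tanh (\<beta> * m0 (t + a)))) (at t)"
    by (intro DERIV_cmult) simp
  moreover have "sgn x * (- z + tanh (\<beta> * z)) = - (sgn x * z) + tanh (\<beta> * (sgn x * z))" for z
    by (auto simp: sgn_if)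
  ultimately show ?thesis using False by (simp only: flow_def[abs_def] a_def if_False)
qed

lemma flow_1: "flow 1 t = m0 t"
  by (simp add: flow_def)

end

text \<open>Without interaction the integrand of \<open>c_const\<close> vanishes. The explicit
  solution is needed because site deviations are then not negligible against the flow.\<close>

lemma flow_beta_0:
  assumes "\<bar>x\<bar> \<le> 1" "0 \<le> t"
  shows "mean_field.flow 0 x t = x * exp (- t)"
proof -
  interpret mean_field 0 by unfold_locales auto
  have "c_integrand 0 = (\<lambda>_. 0)" by (auto simp: c_integrand_def)
  then have J: "J x = 0" for x by (simp add: J_def)
  have m: "m0 s = exp (- s)" if "0 \<le> s" for s
  proof -
    have "exp (ln (m0 s)) = exp (- s)" using ln_m0[OF that] by (simp add: J)
    then show ?thesis using m0_props(1)[OF that] by simp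
  qed
  have h: "hit y = - ln y" for y by (simp add: hit_def J)
  show ?thesis
  proof (cases "x = 0")
    case False
    then have "0 \<le> hit \<bar>x\<bar>" using assms by (intro hit_nonneg) auto
    then have "m0 (t + hit \<bar>x\<bar>) = exp (- (t + hit \<bar>x\<bar>))" using assms by (intro m) simp
    also have "\<dots> = exp (- t) * exp (ln \<bar>x\<bar>)" by (simp add: h exp_add[symmetric])
    also have "\<dots> = exp (- t) * \<bar>x\<bar>" using False by simp
    finally have "m0 (t + hit \<bar>x\<bar>) = exp (- t) * \<bar>x\<bar>" .
    then show ?thesis using False by (simp add: flow_def abs_mult_sgn sgn_mult_abs mult_ac)
  qed (simp add: flow_def)
qed

section \<open>The cutoff profile\<close>

context curie_weiss
begin

sublocale mean_field \<beta>
  by unfold_locales (rule beta_nonneg, rule beta_less)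

definition avg :: "(nat \<Rightarrow> int) \<Rightarrow> real" where "avg \<xi> = mag I \<xi> / real n"

text \<open>The mean-field solution at site \<open>i\<close>: all sites feel the same field, so
  differences between them decay at rate 1, while the average follows the flow.\<close>

definition spin_mean :: "(nat \<Rightarrow> int) \<Rightarrow> real \<Rightarrow> nat \<Rightarrow> real" where
  "spin_mean \<xi> t i = flow (avg \<xi>) t + (real_of_int (\<xi> i) - avg \<xi>) * exp (- t)"

definition field_at :: "(nat \<Rightarrow> int) \<Rightarrow> real \<Rightarrow> nat \<Rightarrow> real" where
  "field_at \<xi> t i = spin_mean \<xi> t i - \<beta> * flow (avg \<xi>) t"

lemma avg_le: "\<xi> \<in> \<Omega> \<Longrightarrow> \<bar>avg \<xi>\<bar> \<le> 1"
  using mag_abs_le[of \<xi> I] n_pos by (simp add: avg_def)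

lemma sum_deviation: "(\<Sum>i\<in>I. real_of_int (\<xi> i) - avg \<xi>) = 0"
  using n_pos by (simp add: sum_subtractf avg_def mag_def)

lemma spin_mean_sum: "real n * flow (avg \<xi>) t = (\<Sum>i\<in>I. spin_mean \<xi> t i)"
  unfolding spin_mean_def sum.distrib sum_distrib_right[symmetric] sum_deviation by simp

lemma flow_abs_le_exp: "\<xi> \<in> \<Omega> \<Longrightarrow> 0 \<le> t \<Longrightarrow> \<bar>flow (avg \<xi>) t\<bar> \<le> exp (- (1 - \<beta>) * t)"
  using flow_abs_le[OF avg_le, of \<xi> t] m0_le_exp[of t] by linarith

lemma deviation_abs_le:
  assumes "\<xi> \<in> \<Omega>" "i \<in> I" "0 \<le> t"
  shows "\<bar>(real_of_int (\<xi> i) - avg \<xi>) * exp (- t)\<bar> \<le> 2 * exp (- (1 - \<beta>) * t)"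
proof -
  have "0 \<le> \<beta> * t" using beta_nonneg assms by simp
  then have "- t \<le> - (1 - \<beta>) * t" by (simp add: algebra_simps)
  then have "exp (- t) \<le> exp (- (1 - \<beta>) * t)" by simp
  moreover have "\<bar>real_of_int (\<xi> i) - avg \<xi>\<bar> \<le> 2"
    using spin_abs[OF assms(1,2)] avg_le[OF assms(1)] by linarith
  ultimately show ?thesis unfolding abs_mult by (intro mult_mono) auto
qed

lemma spin_mean_abs_le:
  "\<xi> \<in> \<Omega> \<Longrightarrow> i \<in> I \<Longrightarrow> 0 \<le> t \<Longrightarrow> \<bar>spin_mean \<xi> t i\<bar> \<le> 3 * exp (- (1 - \<beta>) * t)"
  using flow_abs_le_exp[of \<xi> t] deviation_abs_le[of \<xi> i t] unfolding spin_mean_def by linarith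

lemma field_at_eq: "field_at \<xi> t i = (1 - \<beta>) * flow (avg \<xi>) t + (real_of_int (\<xi> i) - avg \<xi>) * exp (- t)"
  by (simp add: field_at_def spin_mean_def algebra_simps)

lemma field_at_abs_le:
  assumes "\<xi> \<in> \<Omega>" "i \<in> I" "0 \<le> t"
  shows "\<bar>field_at \<xi> t i\<bar> \<le> 3 * exp (- (1 - \<beta>) * t)"
proof -
  have "\<bar>(1 - \<beta>) * flow (avg \<xi>) t\<bar> \<le> 1 * exp (- (1 - \<beta>) * t)"
    unfolding abs_mult using flow_abs_le_exp[OF assms(1,3)] beta_nonneg beta_less by (intro mult_mono) auto
  then show ?thesis using deviation_abs_le[OF assms] unfolding field_at_eq by linarith
qed

text \<open>Deviations from the average sum to 0, so the cross terms vanish and their squares sum to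
  \<open>real n * (1 - (avg \<xi>)\<^sup>2)\<close>. For the common part,
  \<open>(1 - \<beta>)\<^sup>2\<close> from the squares and \<open>\<beta> * (1 - \<beta>)\<close>
  from the rank-one correction add up to \<open>1 - \<beta>\<close>.\<close>

lemma V_field_at:
  assumes \<xi>: "\<xi> \<in> \<Omega>"
  shows "V (field_at \<xi> t) = real n * (1 - \<beta>) * (flow (avg \<xi>) t)\<^sup>2 + real n * exp (- 2 * t) * (1 - (avg \<xi>)\<^sup>2)"
proof -
  define f where "f = flow (avg \<xi>) t"
  define a where "a = avg \<xi>"
  define e where "e = exp (- t)"
  have na: "(\<Sum>i\<in>I. real_of_int (\<xi> i)) = real n * a" using n_pos by (simp add: a_def avg_def mag_def)
  have s1: "(\<Sum>i\<in>I. field_at \<xi> t i) = real n * (1 - \<beta>) * f"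
    unfolding field_at_eq sum.distrib sum_distrib_right[symmetric] sum_deviation by (simp add: f_def)
  have "(\<Sum>i\<in>I. (field_at \<xi> t i)\<^sup>2) =
      (\<Sum>i\<in>I. ((1 - \<beta>) * f)\<^sup>2 + 2 * (1 - \<beta>) * f * e * (real_of_int (\<xi> i) - a) + e\<^sup>2 * (real_of_int (\<xi> i) - a)\<^sup>2)"
    unfolding field_at_eq f_def a_def e_def
    by (intro sum.cong refl) (simp add: power2_eq_square algebra_simps)
  also have "\<dots> = real n * ((1 - \<beta>) * f)\<^sup>2 + 2 * (1 - \<beta>) * f * e * (\<Sum>i\<in>I. real_of_int (\<xi> i) - a)
      + e\<^sup>2 * (\<Sum>i\<in>I. (real_of_int (\<xi> i) - a)\<^sup>2)"
    by (simp only: sum.distrib sum_distrib_left[symmetric] sum_constant card_I)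
  also have "(\<Sum>i\<in>I. real_of_int (\<xi> i) - a) = 0" unfolding a_def by (rule sum_deviation)
  also have "(\<Sum>i\<in>I. (real_of_int (\<xi> i) - a)\<^sup>2) = real n * (1 - a\<^sup>2)"
  proof -
    have "(\<Sum>i\<in>I. (real_of_int (\<xi> i) - a)\<^sup>2) = (\<Sum>i\<in>I. (1 + a\<^sup>2) - 2 * a * real_of_int (\<xi> i))"
      by (intro sum.cong refl) (simp add: power2_diff spin_sq[OF \<xi>])
    also have "\<dots> = real n * (1 + a\<^sup>2) - 2 * a * (\<Sum>i\<in>I. real_of_int (\<xi> i))"
      by (simp only: sum_subtractf sum_distrib_left[symmetric] sum_constant card_I)
    also have "\<dots> = real n * (1 - a\<^sup>2)" unfolding na by (simp add: power2_eq_square algebra_simps)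
    finally show ?thesis .
  qed
  finally have s2: "(\<Sum>i\<in>I. (field_at \<xi> t i)\<^sup>2) = real n * ((1 - \<beta>) * f)\<^sup>2 + e\<^sup>2 * (real n * (1 - a\<^sup>2))" by simp
  have s3: "\<beta> / (1 - \<beta>) * ((real n * (1 - \<beta>) * f)\<^sup>2 / real n) = real n * (\<beta> * (1 - \<beta>) * f\<^sup>2)"
  proof -
    have "b / d * ((m * d * f)\<^sup>2 / m) = m * (b * d * f\<^sup>2)" if "d \<noteq> 0" "m \<noteq> 0" for b d m :: real
      using that by (simp add: power2_eq_square)
    then show ?thesis using beta_less n_pos by simp
  qed
  have e2: "e\<^sup>2 = exp (- 2 * t)" by (simp add: e_def power2_eq_square exp_add[symmetric])
  have "V (field_at \<xi> t) = real n * ((1 - \<beta>) * f)\<^sup>2 + e\<^sup>2 * (real n * (1 - a\<^sup>2)) + real n * (\<beta> * (1 - \<beta>) * f\<^sup>2)"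
    unfolding V_def s1 s2 s3 ..
  also have "\<dots> = real n * (1 - \<beta>) * f\<^sup>2 + real n * e\<^sup>2 * (1 - a\<^sup>2)"
    by (simp add: power2_eq_square algebra_simps)
  finally show ?thesis unfolding e2 f_def a_def .
qed

text \<open>The first summand is the value at the all-plus start. For \<open>\<beta> > 0\<close> the
  deviations contribute a term that vanishes in the limit. For \<open>\<beta> = 0\<close> they are
  of the same order as the flow, but the two parts add up to the all-plus value exactly.\<close>

lemma V_field_at_le:
  assumes \<xi>: "\<xi> \<in> \<Omega>" and t: "0 \<le> t"
  shows "V (field_at \<xi> t) \<le> real n * (1 - \<beta>) * (m0 t)\<^sup>2 + (if \<beta> = 0 then 0 else real n * exp (- 2 * t))"
proof (cases "\<beta> = 0")
  case True
  have f: "flow (avg \<xi>) t = avg \<xi> * exp (- t)"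
    using flow_beta_0[OF avg_le[OF \<xi>] t] unfolding True .
  have m: "m0 t = exp (- t)"
    using flow_beta_0[of 1 t] t flow_1[of t] unfolding True by simp
  have e: "exp (- 2 * t) = (exp (- t))\<^sup>2" by (simp add: power2_eq_square exp_add[symmetric])
  show ?thesis unfolding V_field_at[OF \<xi>] f m e using True
    by (simp add: power_mult_distrib algebra_simps)
next
  case False
  have "\<bar>flow (avg \<xi>) t\<bar>\<^sup>2 \<le> (m0 t)\<^sup>2"
    using flow_abs_le[OF avg_le[OF \<xi>] t] by (intro power_mono) auto
  then have "real n * (1 - \<beta>) * (flow (avg \<xi>) t)\<^sup>2 \<le> real n * (1 - \<beta>) * (m0 t)\<^sup>2"
    using beta_less by (intro mult_left_mono) auto
  moreover have "real n * exp (- 2 * t) * (1 - (avg \<xi>)\<^sup>2) \<le> real n * exp (- 2 * t) * 1"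
    by (intro mult_left_mono) auto
  ultimately show ?thesis unfolding V_field_at[OF \<xi>] using False by simp
qed

definition all_plus :: "nat \<Rightarrow> int" where "all_plus = (\<lambda>i\<in>I. 1)"

lemma all_plus_in: "all_plus \<in> \<Omega>"
  by (auto simp: all_plus_def spin_configs_def I_def)

lemma avg_all_plus: "avg all_plus = 1"
  using n_pos by (simp add: avg_def mag_def all_plus_def)

lemma V_all_plus: "V (field_at all_plus t) = real n * (1 - \<beta>) * (m0 t)\<^sup>2"
  by (simp add: V_field_at[OF all_plus_in] avg_all_plus flow_1)

lemma distance_approx:
  assumes large: "\<beta>\<^sup>2 / (real n * \<rho>) \<le> 2 * (1 - \<beta>)" "\<beta> + U\<^sup>2 \<le> sqrt (real n)" "4 * U \<le> sqrt (real n)"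
    and \<xi>: "\<xi> \<in> \<Omega>" and T: "0 \<le> T" and K: "0 < K" and U: "3 * exp (- (1 - \<beta>) * T) \<le> U / sqrt (real n)"
  shows "\<bar>tv_dist (glauber_law \<beta> n (T + K) \<xi>) (cw_measure \<beta> n) - tvt (field_at \<xi> (T + K))\<bar> \<le> error_bound U K"
proof (rule tv_glauber_tilt[OF \<xi>])
  show "0 \<le> T + K" using T K by simp
  have dec: "3 * exp (- (1 - \<beta>) * t) \<le> U / sqrt (real n)" if "T \<le> t" for t
  proof -
    have "(1 - \<beta>) * T \<le> (1 - \<beta>) * t" using that beta_less by (intro mult_left_mono) auto
    then have "exp (- (1 - \<beta>) * t) \<le> exp (- (1 - \<beta>) * T)" unfolding mult_minus_left by simp
    then show ?thesis using U by linarith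
  qed
  have U0: "0 \<le> U"
  proof -
    have "0 \<le> U / sqrt (real n)" using U exp_ge_zero[of "- (1 - \<beta>) * T"] by linarith
    then show ?thesis using n_pos by (simp add: zero_le_divide_iff)
  qed
  show "(\<Sum>\<sigma>\<in>\<Omega>. \<bar>H (T + K) \<xi> \<sigma> - tilt (field_at \<xi> (T + K)) \<sigma>\<bar>) \<le> 2 * error_bound U K"
    unfolding field_at_def
  proof (rule law_close_to_tilt[OF large \<xi> T K U0 spin_mean_sum])
    fix t :: real and i assume t: "0 \<le> t" and i: "i \<in> I"
    have f: "(flow (avg \<xi>) has_real_derivative - flow (avg \<xi>) t + tanh (\<beta> * flow (avg \<xi>) t)) (at t)"
      by (rule flow_deriv[OF avg_le[OF \<xi>] t])
    have "((\<lambda>t. (real_of_int (\<xi> i) - avg \<xi>) * exp (- t)) has_real_derivative (real_of_int (\<xi> i) - avg \<xi>) * (- exp (- t))) (at t)"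
      by (intro DERIV_cmult) (auto intro!: derivative_eq_intros)
    from DERIV_add[OF f this]
    show "((\<lambda>t. spin_mean \<xi> t i) has_real_derivative - spin_mean \<xi> t i + tanh (\<beta> * flow (avg \<xi>) t)) (at t)"
      unfolding spin_mean_def by (simp add: algebra_simps)
  next
    fix i assume "i \<in> I"
    show "spin_mean \<xi> 0 i = real_of_int (\<xi> i)"
      using flow_0[OF avg_le[OF \<xi>]] by (simp add: spin_mean_def)
  next
    fix t :: real and i j assume "\<xi> i = \<xi> j"
    then show "spin_mean \<xi> t i = spin_mean \<xi> t j" by (simp add: spin_mean_def)
  next
    fix t i assume t: "T \<le> t" and i: "i \<in> I"
    then have t0: "0 \<le> t" using T by simp
    show "\<bar>spin_mean \<xi> t i\<bar> \<le> U / sqrt (real n)"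
      using spin_mean_abs_le[OF \<xi> i t0] dec[OF t] by linarith
  next
    fix t assume t: "T \<le> t"
    then have t0: "0 \<le> t" using T by simp
    show "\<bar>flow (avg \<xi>) t\<bar> \<le> U / sqrt (real n)"
      using flow_abs_le_exp[OF \<xi> t0] dec[OF t] exp_ge_zero[of "- (1 - \<beta>) * t"] by linarith
  qed
qed

end

section \<open>The limit of large n, with quantities that depend on n taken from
  \<open>curie_weiss\<close>\<close>

context mean_field
begin

lemma curie_weiss: "0 < n \<Longrightarrow> curie_weiss \<beta> n"
  by unfold_locales (auto simp: b0 b1)

definition time :: "real \<Rightarrow> nat \<Rightarrow> real" where
  "time \<theta> n = 1 / (2 * (1 - \<beta>)) * ln (real n) + \<theta>"

lemma exp_time: "0 < n \<Longrightarrow> exp ((1 - \<beta>) * time \<theta> n) = sqrt (real n) * exp ((1 - \<beta>) * \<theta>)"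
proof -
  assume n: "0 < n"
  have "(1 - \<beta>) * time \<theta> n = ln (real n) / 2 + (1 - \<beta>) * \<theta>"
  proof -
    have "d * (1 / (2 * d) * l) = l / 2" if "d \<noteq> 0" for d l :: real using that by simp
    from this[of "1 - \<beta>" "ln (real n)"] show ?thesis using b1 unfolding time_def distrib_left by simp
  qed
  moreover have "exp (ln (real n) / 2) = sqrt (real n)"
    using n by (simp add: ln_sqrt[symmetric])
  ultimately show ?thesis by (simp add: exp_add)
qed

lemma time_at_top: "filterlim (time \<theta>) at_top sequentially"
proof -
  have "filterlim (\<lambda>n. ln (real n)) at_top sequentially"
    by (rule filterlim_compose[OF ln_at_top filterlim_real_sequentially])
  then have "filterlim (\<lambda>n. 1 / (2 * (1 - \<beta>)) * ln (real n)) at_top sequentially"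
    using b1 by (intro filterlim_tendsto_pos_mult_at_top[OF tendsto_const]) auto
  then have "filterlim (\<lambda>n. \<theta> + 1 / (2 * (1 - \<beta>)) * ln (real n)) at_top sequentially"
    by (rule filterlim_tendsto_add_at_top[OF tendsto_const])
  then show ?thesis by (simp add: time_def[abs_def] add.commute)
qed

definition dist_from :: "real \<Rightarrow> nat \<Rightarrow> (nat \<Rightarrow> int) \<Rightarrow> real" where
  "dist_from \<theta> n \<xi> = tv_dist (glauber_law \<beta> n (time \<theta> n) \<xi>) (cw_measure \<beta> n)"

definition tilt_dist :: "real \<Rightarrow> nat \<Rightarrow> (nat \<Rightarrow> int) \<Rightarrow> real" where
  "tilt_dist \<theta> n \<xi> = curie_weiss.tvt \<beta> n (curie_weiss.field_at \<beta> n \<xi> (time \<theta> n))"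

lemma dist_from_approx:
  assumes \<epsilon>: "0 < \<epsilon>"
  shows "eventually (\<lambda>n. \<forall>\<xi>\<in>spin_configs n. \<bar>dist_from \<theta> n \<xi> - tilt_dist \<theta> n \<xi>\<bar> \<le> \<epsilon>) sequentially"
proof -
  define r where "r = curie_weiss.\<rho> \<beta>"
  define M where "M = curie_weiss.M2 \<beta>"
  \<comment> \<open>The constants depend on \<open>\<beta>\<close> alone, so any instance, here
    \<open>n = 1\<close>, yields their positivity.\<close>
  have cw1: "curie_weiss \<beta> 1" by (rule curie_weiss) simp
  have r: "0 < r" unfolding r_def by (rule curie_weiss.rho_pos[OF cw1])
  have M: "0 < M" unfolding M_def by (rule curie_weiss.M2_pos[OF cw1])
  \<comment> \<open>Chosen so that the smoothing cost is exactly
    \<open>\<epsilon> / 2\<close>.\<close>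
  define K where "K = (2 * (2 + M) / \<epsilon>)\<^sup>2 / r"
  have K: "0 < K" using M \<epsilon> r by (simp add: K_def)
  have sK: "sqrt (r * K) = 2 * (2 + M) / \<epsilon>" using r M \<epsilon> by (simp add: K_def)
  have K2: "(2 + M) / sqrt (r * K) = \<epsilon> / 2" unfolding sK using M \<epsilon> by (simp add: field_simps)
  \<comment> \<open>At time \<open>time \<theta> n - K\<close> the bound
    \<open>3 * exp (- (1 - \<beta>) * T)\<close> on the spin means is exactly
    \<open>U / sqrt (real n)\<close>.\<close>
  define U where "U = 3 * exp ((1 - \<beta>) * (K - \<theta>))"
  define D where "D = K * curie_weiss.DA \<beta> (2 * U)"
  have sq: "filterlim (\<lambda>n. sqrt (real n)) at_top sequentially"
    by (rule filterlim_compose[OF sqrt_at_top filterlim_real_sequentially])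
  have e1: "eventually (\<lambda>n. \<beta> + U\<^sup>2 \<le> sqrt (real n)) sequentially"
    and e2: "eventually (\<lambda>n. 4 * U \<le> sqrt (real n)) sequentially"
    and e3: "eventually (\<lambda>n. 2 * D / \<epsilon> \<le> sqrt (real n)) sequentially"
    using sq by (auto simp: filterlim_at_top)
  have e4: "eventually (\<lambda>n. K \<le> time \<theta> n) sequentially"
    using time_at_top by (auto simp: filterlim_at_top)
  have e5: "eventually (\<lambda>n. \<beta>\<^sup>2 / r / (2 * (1 - \<beta>)) \<le> real n) sequentially"
    using filterlim_real_sequentially by (auto simp: filterlim_at_top)
  show ?thesis
    using e1 e2 e3 e4 e5 eventually_gt_at_top[of 0]
  proof eventually_elim
    case (elim n)
    interpret cw: curie_weiss \<beta> n by (rule curie_weiss) (use elim in simp)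
    have sn: "0 < sqrt (real n)" using elim by simp
    show ?case
    proof
      fix \<xi> assume \<xi>: "\<xi> \<in> spin_configs n"
      define T where "T = time \<theta> n - K"
      have "\<bar>dist_from \<theta> n \<xi> - tilt_dist \<theta> n \<xi>\<bar> \<le> cw.error_bound U K"
      proof -
        have 1: "\<beta>\<^sup>2 / (real n * cw.\<rho>) \<le> 2 * (1 - \<beta>)"
          using elim(5,6) r b1 unfolding r_def[symmetric] by (simp add: field_simps)
        have "exp (- (1 - \<beta>) * T) = exp ((1 - \<beta>) * K) / exp ((1 - \<beta>) * time \<theta> n)"
          unfolding exp_diff[symmetric] by (simp add: T_def algebra_simps)
        also have "\<dots> = exp ((1 - \<beta>) * K) / (sqrt (real n) * exp ((1 - \<beta>) * \<theta>))"
          using elim by (simp only: exp_time)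
        also have "\<dots> = exp ((1 - \<beta>) * (K - \<theta>)) / sqrt (real n)"
          by (simp add: exp_diff right_diff_distrib)
        finally have 2: "3 * exp (- (1 - \<beta>) * T) \<le> U / sqrt (real n)" by (simp add: U_def)
        have TK: "T + K = time \<theta> n" by (simp add: T_def)
        have "0 \<le> T" using elim by (simp add: T_def)
        from cw.distance_approx[OF 1 elim(1,2) \<xi> this K 2]
        show ?thesis unfolding TK dist_from_def tilt_dist_def .
      qed
      also have "\<dots> \<le> \<epsilon> / 2 + \<epsilon> / 2"
      proof -
        have "D / sqrt (real n) \<le> \<epsilon> / 2" using elim(3) sn \<epsilon> by (simp add: field_simps)
        moreover have "cw.error_bound U K = (2 + M) / sqrt (r * K) + D / sqrt (real n)"
          by (simp add: cw.error_bound_def r_def M_def D_def)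
        ultimately show ?thesis using K2 by linarith
      qed
      finally show "\<bar>dist_from \<theta> n \<xi> - tilt_dist \<theta> n \<xi>\<bar> \<le> \<epsilon>" by simp
    qed
  qed
qed

text \<open>The squared mean of the limiting Gaussian divided by its variance
  \<open>1 / (1 - \<beta>)\<close>, as in \<open>tv_dist_gaussian\<close>.\<close>

definition vlim :: "real \<Rightarrow> real" where
  "vlim \<theta> = (1 - \<beta>) * (exp (- (1 - \<beta>) * \<theta> + c_const \<beta>))\<^sup>2"

lemma profile_eq: "limit_profile \<beta> \<theta> = gauss_tv (vlim \<theta>)"
proof -
  have "limit_profile \<beta> \<theta> = gauss_tv ((exp (- (1 - \<beta>) * \<theta> + c_const \<beta>))\<^sup>2 / (1 / (1 - \<beta>)))"
    unfolding limit_profile_def using b1 by (intro tv_dist_gaussian) auto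
  then show ?thesis by (simp add: vlim_def mult.commute)
qed

lemma V_limit:
  "(\<lambda>n. real n * (1 - \<beta>) * (m0 (time \<theta> n))\<^sup>2) \<longlonglongrightarrow> vlim \<theta>"
proof -
  have "(\<lambda>n. (1 - \<beta>) * (exp (- (1 - \<beta>) * \<theta>) * (exp ((1 - \<beta>) * time \<theta> n) * m0 (time \<theta> n)))\<^sup>2)
      \<longlonglongrightarrow> (1 - \<beta>) * (exp (- (1 - \<beta>) * \<theta>) * exp (c_const \<beta>))\<^sup>2"
    by (intro tendsto_intros m0_asymptotics time_at_top)
  also have "(1 - \<beta>) * (exp (- (1 - \<beta>) * \<theta>) * exp (c_const \<beta>))\<^sup>2 = vlim \<theta>"
    by (simp only: vlim_def exp_add)
  finally have 1: "(\<lambda>n. (1 - \<beta>) * (exp (- (1 - \<beta>) * \<theta>) * (exp ((1 - \<beta>) * time \<theta> n) * m0 (time \<theta> n)))\<^sup>2)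
      \<longlonglongrightarrow> vlim \<theta>" .
  have "eventually (\<lambda>n. (1 - \<beta>) * (exp (- (1 - \<beta>) * \<theta>) * (exp ((1 - \<beta>) * time \<theta> n) * m0 (time \<theta> n)))\<^sup>2 =
      real n * (1 - \<beta>) * (m0 (time \<theta> n))\<^sup>2) sequentially"
    using eventually_gt_at_top[of 0]
  proof eventually_elim
    case (elim n)
    have "exp (- (1 - \<beta>) * \<theta>) * (exp ((1 - \<beta>) * time \<theta> n) * m0 (time \<theta> n)) =
        (exp (- (1 - \<beta>) * \<theta>) * exp ((1 - \<beta>) * \<theta>)) * sqrt (real n) * m0 (time \<theta> n)"
      unfolding exp_time[OF elim] by (simp only: mult_ac)
    also have "exp (- (1 - \<beta>) * \<theta>) * exp ((1 - \<beta>) * \<theta>) = 1"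
      unfolding exp_add[symmetric] mult_minus_left by simp
    finally have e: "exp (- (1 - \<beta>) * \<theta>) * (exp ((1 - \<beta>) * time \<theta> n) * m0 (time \<theta> n)) = 1 * sqrt (real n) * m0 (time \<theta> n)" .
    show ?case unfolding e by (simp add: power_mult_distrib)
  qed
  with 1 show ?thesis by (rule Lim_transform_eventually)
qed

text \<open>At the cutoff time the term is \<open>exp (- 2 * \<theta>)\<close> times the power of n
  with exponent \<open>- \<beta> / (1 - \<beta>)\<close>, which is negative unless
  \<open>\<beta> = 0\<close>.\<close>

lemma V_correction_limit:
  "(\<lambda>n. if \<beta> = 0 then 0 else real n * exp (- 2 * time \<theta> n)) \<longlonglongrightarrow> 0"
proof (cases "\<beta> = 0")
  case False
  with b0 have b: "0 < \<beta>" by simp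
  have "filterlim (\<lambda>n. ln (real n)) at_top sequentially"
    by (rule filterlim_compose[OF ln_at_top filterlim_real_sequentially])
  then have "filterlim (\<lambda>n. \<beta> / (1 - \<beta>) * ln (real n)) at_top sequentially"
    using b b1 by (intro filterlim_tendsto_pos_mult_at_top[OF tendsto_const]) auto
  then have "filterlim (\<lambda>n. - (\<beta> / (1 - \<beta>) * ln (real n))) at_bot sequentially"
    by (simp add: filterlim_uminus_at_bot)
  then have "(\<lambda>n. exp (- (\<beta> / (1 - \<beta>) * ln (real n)))) \<longlonglongrightarrow> 0"
    by (rule filterlim_compose[OF exp_at_bot])
  from tendsto_mult_left_zero[OF this, of "exp (- 2 * \<theta>)"]
  have 1: "(\<lambda>n. exp (- (\<beta> / (1 - \<beta>) * ln (real n))) * exp (- 2 * \<theta>)) \<longlonglongrightarrow> 0" .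
  have "eventually (\<lambda>n. exp (- (\<beta> / (1 - \<beta>) * ln (real n))) * exp (- 2 * \<theta>) =
      (if \<beta> = 0 then 0 else real n * exp (- 2 * time \<theta> n))) sequentially"
    using eventually_gt_at_top[of 0]
  proof eventually_elim
    case (elim n)
    have "- (b / (1 - b) * l) = l + - 2 * (1 / (2 * (1 - b)) * l)" if "b < 1" for b l :: real
      using that by (simp add: field_simps)
    from this[OF b1, of "ln (real n)"]
    have "- (\<beta> / (1 - \<beta>) * ln (real n)) + - 2 * \<theta> = ln (real n) + - 2 * time \<theta> n"
      unfolding time_def distrib_left by linarith
    then have "exp (- (\<beta> / (1 - \<beta>) * ln (real n))) * exp (- 2 * \<theta>) = exp (ln (real n)) * exp (- 2 * time \<theta> n)"
      unfolding exp_add[symmetric] by (simp only:)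
    then show ?case using elim False by simp
  qed
  with 1 show ?thesis by (rule Lim_transform_eventually)
qed simp

lemma tilt_dist_limit:
  assumes r: "filterlim r at_top sequentially" and pos: "\<And>j. 0 < r j" "\<And>j. 0 \<le> time \<theta> (r j)"
    and \<xi>: "\<And>j. \<xi> j \<in> spin_configs (r j)"
    and V: "(\<lambda>j. curie_weiss.V \<beta> (r j) (curie_weiss.field_at \<beta> (r j) (\<xi> j) (time \<theta> (r j)))) \<longlonglongrightarrow> v"
  shows "(\<lambda>j. tilt_dist \<theta> (r j) (\<xi> j)) \<longlonglongrightarrow> gauss_tv v"
  unfolding tilt_dist_def
proof (rule tvt_limit[OF _ r _ _ V])
  \<comment> \<open>The exponential bound on the fields at the cutoff time equals
    \<open>A / sqrt (real (r j))\<close>.\<close>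
  define A where "A = 3 * exp (- (1 - \<beta>) * \<theta>)"
  show "curie_weiss \<beta> (r j)" for j by (rule curie_weiss[OF pos(1)])
  show "0 \<le> A" by (simp add: A_def)
  fix j i assume i: "i \<in> {1..r j}"
  interpret cw: curie_weiss \<beta> "r j" by (rule curie_weiss[OF pos(1)])
  have "\<bar>cw.field_at (\<xi> j) (time \<theta> (r j)) i\<bar> \<le> 3 * exp (- (1 - \<beta>) * time \<theta> (r j))"
    using i by (intro cw.field_at_abs_le \<xi> pos) (simp add: cw.I_def)
  also have "exp (- (1 - \<beta>) * time \<theta> (r j)) = inverse (exp ((1 - \<beta>) * time \<theta> (r j)))"
    unfolding mult_minus_left by (rule exp_minus)
  also have "\<dots> = exp (- (1 - \<beta>) * \<theta>) / sqrt (real (r j))"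
    unfolding exp_time[OF pos(1)] mult_minus_left exp_minus by (simp add: field_simps)
  finally show "\<bar>cw.field_at (\<xi> j) (time \<theta> (r j)) i\<bar> \<le> A / sqrt (real (r j))" by (simp add: A_def)
qed

lemma tilt_dist_all_plus:
  "(\<lambda>n. tilt_dist \<theta> n (curie_weiss.all_plus n)) \<longlonglongrightarrow> gauss_tv (vlim \<theta>)"
proof -
  \<comment> \<open>Sizes at which n or the cutoff time is not yet admissible are skipped by a shift
    of the index.\<close>
  have "eventually (\<lambda>n. 0 < n \<and> 0 \<le> time \<theta> n) sequentially"
    using time_at_top[of \<theta>] by (auto simp: filterlim_at_top intro!: eventually_conj eventually_gt_at_top)
  then obtain n1 where n1: "\<And>n. n1 \<le> n \<Longrightarrow> 0 < n" "\<And>n. n1 \<le> n \<Longrightarrow> 0 \<le> time \<theta> n"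
    by (auto simp: eventually_sequentially)
  have "(\<lambda>j. tilt_dist \<theta> (j + n1) (curie_weiss.all_plus (j + n1))) \<longlonglongrightarrow> gauss_tv (vlim \<theta>)"
  proof (rule tilt_dist_limit)
    show "filterlim (\<lambda>j. j + n1) at_top sequentially" by (rule filterlim_add_const_nat_at_top)
    fix j
    interpret cw: curie_weiss \<beta> "j + n1" by (rule curie_weiss) (rule n1, simp)
    show "cw.all_plus \<in> spin_configs (j + n1)" by (rule cw.all_plus_in)
  next
    have "curie_weiss.V \<beta> (j + n1) (curie_weiss.field_at \<beta> (j + n1) (curie_weiss.all_plus (j + n1)) (time \<theta> (j + n1))) =
       real (j + n1) * (1 - \<beta>) * (m0 (time \<theta> (j + n1)))\<^sup>2" for j
      by (rule curie_weiss.V_all_plus[OF curie_weiss]) (rule n1, simp)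
    then show "(\<lambda>j. curie_weiss.V \<beta> (j + n1) (curie_weiss.field_at \<beta> (j + n1) (curie_weiss.all_plus (j + n1)) (time \<theta> (j + n1)))) \<longlonglongrightarrow> vlim \<theta>"
      using LIMSEQ_ignore_initial_segment[OF V_limit, of n1 \<theta>] by (simp only:)
  qed (use n1 in auto)
  then show ?thesis by (rule LIMSEQ_offset)
qed

text \<open>\<open>tvt_limit\<close> speaks about sequences with convergent variances and gives no
  uniformity by itself. Starts that violate the bound along a subsequence have bounded variances; a
  further subsequence converges to some \<open>v\<close> with \<open>v \<le> vlim \<theta>\<close>,
  and monotonicity of \<open>gauss_tv\<close> gives the contradiction.\<close>

lemma tilt_dist_upper:
  assumes \<epsilon>: "0 < \<epsilon>"
  shows "eventually (\<lambda>n. \<forall>\<xi>\<in>spin_configs n. tilt_dist \<theta> n \<xi> \<le> gauss_tv (vlim \<theta>) + \<epsilon>) sequentially"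
proof (rule ccontr)
  assume neg: "\<not> ?thesis"
  have pos: "eventually (\<lambda>n. 0 < n \<and> 0 \<le> time \<theta> n) sequentially"
    using time_at_top[of \<theta>] by (auto simp: filterlim_at_top intro!: eventually_conj eventually_gt_at_top)
  \<comment> \<open>The eventual conditions become a premise, so that every index at which
    \<open>P\<close> fails satisfies them.\<close>
  define P where "P = (\<lambda>n. (0 < n \<and> 0 \<le> time \<theta> n) \<longrightarrow> (\<forall>\<xi>\<in>spin_configs n. tilt_dist \<theta> n \<xi> \<le> gauss_tv (vlim \<theta>) + \<epsilon>))"
  have "\<not> eventually P sequentially"
  proof
    assume "eventually P sequentially"
    with pos have "eventually (\<lambda>n. \<forall>\<xi>\<in>spin_configs n. tilt_dist \<theta> n \<xi> \<le> gauss_tv (vlim \<theta>) + \<epsilon>) sequentially"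
      unfolding P_def by eventually_elim blast
    with neg show False ..
  qed
  from not_eventually_sequentiallyD[OF this] obtain r :: "nat \<Rightarrow> nat"
    where "strict_mono r \<and> (\<forall>j. \<not> P (r j))" by (elim exE)
  then have r: "strict_mono r" "\<And>j. \<not> P (r j)" by simp_all
  then have rp: "\<And>j. 0 < r j" "\<And>j. 0 \<le> time \<theta> (r j)" by (auto simp: P_def)
  from r(2) have "\<forall>j. \<exists>\<xi>\<in>spin_configs (r j). gauss_tv (vlim \<theta>) + \<epsilon> < tilt_dist \<theta> (r j) \<xi>"
    by (auto simp: P_def not_le)
  then obtain \<xi> where \<xi>: "\<And>j. \<xi> j \<in> spin_configs (r j)"
    "\<And>j. gauss_tv (vlim \<theta>) + \<epsilon> < tilt_dist \<theta> (r j) (\<xi> j)" by metis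
  define Vn where "Vn = (\<lambda>j. curie_weiss.V \<beta> (r j) (curie_weiss.field_at \<beta> (r j) (\<xi> j) (time \<theta> (r j))))"
  define Vb where "Vb = (\<lambda>n. real n * (1 - \<beta>) * (m0 (time \<theta> n))\<^sup>2 + (if \<beta> = 0 then 0 else real n * exp (- 2 * time \<theta> n)))"
  have Vb: "Vb \<longlonglongrightarrow> vlim \<theta>"
    using tendsto_add[OF V_limit V_correction_limit] by (simp only: Vb_def add_0_right)
  have Vle: "Vn j \<le> Vb (r j)" for j
    unfolding Vn_def Vb_def by (rule curie_weiss.V_field_at_le[OF curie_weiss[OF rp(1)] \<xi>(1) rp(2)])
  have V0: "0 \<le> Vn j" for j
    unfolding Vn_def by (rule curie_weiss.V_nonneg[OF curie_weiss[OF rp(1)]])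
  obtain B where B: "\<And>n. \<bar>Vb n\<bar> \<le> B"
    using convergent_imp_Bseq[OF convergentI[OF Vb]] by (auto simp: Bseq_def)
  have "Vn j \<in> {0..B}" for j using V0[of j] Vle[of j] B[of "r j"] by auto
  then obtain v s where s: "strict_mono s" "(Vn \<circ> s) \<longlonglongrightarrow> v"
    using compact_Icc[of 0 B, unfolded compact_eq_seq_compact_metric seq_compact_def] by blast
  have rs: "filterlim (\<lambda>j. r (s j)) at_top sequentially"
    using filterlim_subseq[OF strict_mono_o[OF r(1) s(1)]] by (simp add: comp_def)
  have "(\<lambda>j. tilt_dist \<theta> (r (s j)) (\<xi> (s j))) \<longlonglongrightarrow> gauss_tv v"
    using s(2) by (intro tilt_dist_limit rs rp \<xi>(1)) (simp add: Vn_def comp_def)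
  then have ge: "gauss_tv (vlim \<theta>) + \<epsilon> \<le> gauss_tv v"
    by (rule LIMSEQ_le_const) (auto intro!: exI[of _ 0] less_imp_le[OF \<xi>(2)])
  have "v \<le> vlim \<theta>"
  proof (rule LIMSEQ_le[OF s(2)])
    show "(\<lambda>j. Vb (r (s j))) \<longlonglongrightarrow> vlim \<theta>" by (rule filterlim_compose[OF Vb rs])
    show "\<exists>N. \<forall>j\<ge>N. (Vn \<circ> s) j \<le> Vb (r (s j))" using Vle by auto
  qed
  moreover have "0 \<le> v" by (rule LIMSEQ_le_const[OF s(2)]) (auto simp: V0)
  ultimately have "gauss_tv v \<le> gauss_tv (vlim \<theta>)" by (intro gauss_tv_mono)
  with ge \<epsilon> show False by simp
qed

text \<open>The supremum is a maximum over finitely many starts: the all-plus start gives the lower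
  bound, and the uniform bound at a maximizing start gives the upper one.\<close>

lemma glauber_dist_limit: "(\<lambda>n. glauber_dist \<beta> n (time \<theta> n)) \<longlonglongrightarrow> limit_profile \<beta> \<theta>"
  unfolding profile_eq
proof (rule LIMSEQ_I)
  fix \<epsilon> :: real assume \<epsilon>: "0 < \<epsilon>"
  define \<Psi> where "\<Psi> = gauss_tv (vlim \<theta>)"
  have e3: "0 < \<epsilon> / 3" using \<epsilon> by simp
  have "eventually (\<lambda>n. dist (tilt_dist \<theta> n (curie_weiss.all_plus n)) \<Psi> < \<epsilon> / 3) sequentially"
    using tilt_dist_all_plus e3 unfolding \<Psi>_def by (rule tendstoD)
  with dist_from_approx[OF e3, of \<theta>] tilt_dist_upper[OF e3, of \<theta>] eventually_gt_at_top[of 0]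
  have "eventually (\<lambda>n. norm (glauber_dist \<beta> n (time \<theta> n) - \<Psi>) < \<epsilon>) sequentially"
  proof eventually_elim
    case (elim n)
    interpret cw: curie_weiss \<beta> n by (rule curie_weiss) (use elim in simp)
    have g: "glauber_dist \<beta> n (time \<theta> n) = Max (dist_from \<theta> n ` spin_configs n)"
      unfolding glauber_dist_def dist_from_def using cw.spin_configs_nonempty by (intro cSup_eq_Max) auto
    have "glauber_dist \<beta> n (time \<theta> n) \<in> dist_from \<theta> n ` spin_configs n"
      unfolding g using cw.spin_configs_nonempty by (intro Max_in) auto
    then obtain \<xi> where \<xi>: "\<xi> \<in> spin_configs n" "glauber_dist \<beta> n (time \<theta> n) = dist_from \<theta> n \<xi>" by auto
    have "dist_from \<theta> n \<xi> \<le> \<Psi> + \<epsilon> / 3 + \<epsilon> / 3"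
      using elim(1,2) \<xi>(1) unfolding \<Psi>_def by (smt (verit))
    moreover have "dist_from \<theta> n cw.all_plus \<le> glauber_dist \<beta> n (time \<theta> n)"
      unfolding g using cw.all_plus_in by (intro Max_ge) auto
    moreover have "\<bar>dist_from \<theta> n cw.all_plus - tilt_dist \<theta> n cw.all_plus\<bar> \<le> \<epsilon> / 3"
      using elim(1) cw.all_plus_in by blast
    ultimately have "\<bar>glauber_dist \<beta> n (time \<theta> n) - \<Psi>\<bar> < \<epsilon>"
      using elim(4) \<epsilon> unfolding \<xi>(2) dist_real_def by linarith
    then show ?case by simp
  qed
  then show "\<exists>N. \<forall>n\<ge>N. norm (glauber_dist \<beta> n (time \<theta> n) - gauss_tv (vlim \<theta>)) < \<epsilon>"
    by (simp add: eventually_sequentially \<Psi>_def)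
qed

end

text \<open>The first conjunct certifies that \<open>c_const\<close> is a genuine integral: a
  function that is not integrable would have integral 0 by convention.\<close>

theorem theorem1:
  fixes \<beta> :: real
  assumes "0 \<le> \<beta>" and "\<beta> < 1"
  shows "set_integrable lborel {0..1} (c_integrand \<beta>) \<and>
    (\<forall>\<theta>. (\<lambda>n. glauber_dist \<beta> n (1 / (2 * (1 - \<beta>)) * ln (real n) + \<theta>))
            \<longlonglongrightarrow> limit_profile \<beta> \<theta>)"
proof -
  interpret mean_field \<beta> using assms by unfold_locales
  show ?thesis using set_integrable_ci glauber_dist_limit unfolding time_def by blast
qed

end
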